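(* Let $R$ be a complete commutative noetherian local ring, and let $T$ be a quasidualizing $R$-module. Then the class $\mathcal{G}_T^{\text{artin}}(R)$ of artinian derived $T$-reflexive $R$-modules satisfies the two-of-three condition: given an exact sequence of $R$-module homomorphisms $0\to L_1\to L_2\to L_3\to 0$, if any two of the modules $L_1,L_2,L_3$ are in $\mathcal{G}_T^{\text{artin}}(R)$, then so is the third.
   Context: Let $R$ be a commutative noetherian local ring with maximal ideal $\mathfrak{m}$ and $\mathfrak{m}$-adic completion $\widehat{R}$. An $R$-module $T$ is quasidualizing if (i) $T$ is artinian; (ii) the homothety map $\widehat{R}\to\operatorname{Hom}_R(T,T)$, $r\mapsto[t\mapsto rt]$, is an isomorphism; (iii) $\operatorname{Ext}^i_R(T,T)=0$ for all $i>0$. An $R$-module $L$ is derived $T$-reflexive if the biduality map $L\to\operatorname{Hom}_R(\operatorname{Hom}_R(L,T),T)$, $l\mapsto[\phi\mapsto\phi(l)]$, is an isomorphism and $\operatorname{Ext}^i_R(L,T)=0=\operatorname{Ext}^i_R(\operatorname{Hom}_R(L,T),T)$ for all $i>0$. The class $\mathcal{G}_T^{\text{artin}}(R)$ consists of all artinian derived $T$-reflexive $R$-modules. *)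

theory Defs
  imports "HOL-Algebra.Module" "HOL-Algebra.Ideal_Product" "HOL-Algebra.Ring_Divisibility"
begin

section \<open>Linear maps, Hom modules and quotient modules\<close>

definition lin_map ::
  "('r, 'e) ring_scheme \<Rightarrow> ('r, 'a, 'f) module_scheme \<Rightarrow> ('r, 'b, 'g) module_scheme \<Rightarrow> ('a \<Rightarrow> 'b) \<Rightarrow> bool"
  where "lin_map R M N f \<longleftrightarrow>
    f \<in> carrier M \<rightarrow> carrier N \<and>
    (\<forall>x\<in>carrier M. \<forall>y\<in>carrier M. f (x \<oplus>\<^bsub>M\<^esub> y) = f x \<oplus>\<^bsub>N\<^esub> f y) \<and>
    (\<forall>r\<in>carrier R. \<forall>x\<in>carrier M. f (r \<odot>\<^bsub>M\<^esub> x) = r \<odot>\<^bsub>N\<^esub> f x)"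

definition lin_iso ::
  "('r, 'e) ring_scheme \<Rightarrow> ('r, 'a, 'f) module_scheme \<Rightarrow> ('r, 'b, 'g) module_scheme \<Rightarrow> ('a \<Rightarrow> 'b) \<Rightarrow> bool"
  where "lin_iso R M N f \<longleftrightarrow> lin_map R M N f \<and> bij_betw f (carrier M) (carrier N)"

definition short_exact ::
  "('r, 'e) ring_scheme \<Rightarrow> ('r, 'a, 'f) module_scheme \<Rightarrow> ('a \<Rightarrow> 'b) \<Rightarrow> ('r, 'b, 'g) module_scheme
    \<Rightarrow> ('b \<Rightarrow> 'c) \<Rightarrow> ('r, 'c, 'h) module_scheme \<Rightarrow> bool"
  where "short_exact R L1 f L2 g L3 \<longleftrightarrow>
    lin_map R L1 L2 f \<and> lin_map R L2 L3 g \<and>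
    inj_on f (carrier L1) \<and>
    f ` carrier L1 = a_kernel L2 L3 g \<and>
    g ` carrier L2 = carrier L3"

text \<open>
  The record type of modules extends that of rings, so its fields \<open>mult\<close> and \<open>one\<close> must be given
  a value; the locale \<open>module\<close> ignores them. The elements of a Hom module are extensional functions,
  so that linear maps are equal as soon as they agree on the carrier.
\<close>

definition Hom_mod ::
  "('r, 'e) ring_scheme \<Rightarrow> ('r, 'a, 'f) module_scheme \<Rightarrow> ('r, 'b, 'g) module_scheme \<Rightarrow> ('r, 'a \<Rightarrow> 'b) module"
  where "Hom_mod R M N =
    \<lparr> carrier = {f \<in> extensional (carrier M). lin_map R M N f},
      monoid.mult = undefined, one = undefined,
      ring.zero = (\<lambda>x\<in>carrier M. \<zero>\<^bsub>N\<^esub>),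
      add = (\<lambda>f g. \<lambda>x\<in>carrier M. f x \<oplus>\<^bsub>N\<^esub> g x),
      smult = (\<lambda>r f. \<lambda>x\<in>carrier M. r \<odot>\<^bsub>N\<^esub> f x) \<rparr>"

definition quot_mod :: "('r, 'a, 'f) module_scheme \<Rightarrow> 'a set \<Rightarrow> ('r, 'a set) module"
  where "quot_mod M H =
    \<lparr> carrier = a_rcosets\<^bsub>M\<^esub> H,
      monoid.mult = undefined, one = undefined,
      ring.zero = H,
      add = set_add M,
      smult = (\<lambda>r C. \<Union>x\<in>C. H +>\<^bsub>M\<^esub> (r \<odot>\<^bsub>M\<^esub> x)) \<rparr>"

definition zero_mod :: "('r, 'a, 'f) module_scheme \<Rightarrow> bool"
  where "zero_mod M \<longleftrightarrow> carrier M = {\<zero>\<^bsub>M\<^esub>}"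

definition artinian_module :: "('r, 'e) ring_scheme \<Rightarrow> ('r, 'a, 'f) module_scheme \<Rightarrow> bool"
  where "artinian_module R M \<longleftrightarrow> module R M \<and>
    (\<forall>N :: nat \<Rightarrow> 'a set. (\<forall>n. submodule (N n) R M) \<and> (\<forall>n. N (Suc n) \<subseteq> N n)
       \<longrightarrow> (\<exists>k. \<forall>n\<ge>k. N n = N k))"


section \<open>Ext modules\<close>

definition free_mod :: "('r, 'e) ring_scheme \<Rightarrow> 'x set \<Rightarrow> ('r, 'x \<Rightarrow> 'r) module"
  where "free_mod R B =
    \<lparr> carrier = {f. (\<forall>x. f x \<in> carrier R) \<and> (\<forall>x. x \<notin> B \<longrightarrow> f x = \<zero>\<^bsub>R\<^esub>) \<and> finite {x. f x \<noteq> \<zero>\<^bsub>R\<^esub>}},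
      monoid.mult = undefined, one = undefined,
      ring.zero = (\<lambda>x. \<zero>\<^bsub>R\<^esub>),
      add = (\<lambda>f g x. f x \<oplus>\<^bsub>R\<^esub> g x),
      smult = (\<lambda>r f x. r \<otimes>\<^bsub>R\<^esub> f x) \<rparr>"

definition free_basis :: "('r, 'e) ring_scheme \<Rightarrow> 'x \<Rightarrow> 'x \<Rightarrow> 'r"
  where "free_basis R x = (\<lambda>y. if y = x then \<one>\<^bsub>R\<^esub> else \<zero>\<^bsub>R\<^esub>)"

definition free_lift ::
  "('r, 'e) ring_scheme \<Rightarrow> ('r, 'a, 'f) module_scheme \<Rightarrow> ('x \<Rightarrow> 'a) \<Rightarrow> ('x \<Rightarrow> 'r) \<Rightarrow> 'a"
  where "free_lift R M \<phi> f = (\<Oplus>\<^bsub>M\<^esub>x\<in>{x. f x \<noteq> \<zero>\<^bsub>R\<^esub>}. f x \<odot>\<^bsub>M\<^esub> \<phi> x)"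

definition lin_comb :: "('r, 'a, 'f) module_scheme \<Rightarrow> ('x \<Rightarrow> 'a) \<Rightarrow> ('r \<times> 'x) list \<Rightarrow> 'a"
  where "lin_comb M \<phi> l = foldr (\<lambda>(r, x) s. r \<odot>\<^bsub>M\<^esub> \<phi> x \<oplus>\<^bsub>M\<^esub> s) l \<zero>\<^bsub>M\<^esub>"

text \<open>
  Ext is computed from an explicit free resolution
  \<open>\<dots> \<rightarrow> F\<^sub>2 \<rightarrow> F\<^sub>1 \<rightarrow> F\<^sub>0 \<rightarrow> M \<rightarrow> 0\<close>. The module \<open>F\<^sub>0\<close> is free on the elements of \<open>M\<close>, and
  \<open>F\<^sub>n\<^sub>+\<^sub>1\<close> is free on all formal linear combinations of basis elements of \<open>F\<^sub>n\<close> that represent an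
  element of the kernel of \<open>F\<^sub>n \<rightarrow> F\<^sub>n\<^sub>-\<^sub>1\<close> (of \<open>F\<^sub>0 \<rightarrow> M\<close> if \<open>n = 0\<close>). The datatype below provides one
  type that contains the bases of all \<open>F\<^sub>n\<close>.
\<close>

datatype ('r, 'm) cell = Gen 'm | Rel "('r \<times> ('r, 'm) cell) list"

fun cell_aug :: "('r, 'm, 'f) module_scheme \<Rightarrow> ('r, 'm) cell \<Rightarrow> 'm"
  where
    "cell_aug M (Gen m) = m"
  | "cell_aug M (Rel l) = \<zero>\<^bsub>M\<^esub>"

fun cell_bdry :: "('r, 'e) ring_scheme \<Rightarrow> ('r, 'm) cell \<Rightarrow> ('r, 'm) cell \<Rightarrow> 'r"
  where
    "cell_bdry R (Gen m) = \<zero>\<^bsub>free_mod R UNIV\<^esub>"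
  | "cell_bdry R (Rel l) = lin_comb (free_mod R UNIV) (free_basis R) l"

primrec cells :: "('r, 'e) ring_scheme \<Rightarrow> ('r, 'm, 'f) module_scheme \<Rightarrow> nat \<Rightarrow> ('r, 'm) cell set"
  where
    "cells R M 0 = Gen ` carrier M"
  | "cells R M (Suc n) = {Rel l | l. set l \<subseteq> carrier R \<times> cells R M n \<and>
       (if n = 0 then lin_comb M (cell_aug M) l = \<zero>\<^bsub>M\<^esub>
        else lin_comb (free_mod R UNIV) (cell_bdry R) l = \<zero>\<^bsub>free_mod R UNIV\<^esub>)}"

definition res_mod ::
  "('r, 'e) ring_scheme \<Rightarrow> ('r, 'm, 'f) module_scheme \<Rightarrow> nat \<Rightarrow> ('r, ('r, 'm) cell \<Rightarrow> 'r) module"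
  where "res_mod R M n = free_mod R (cells R M n)"

text \<open>The differential \<open>F\<^sub>n\<^sub>+\<^sub>1 \<rightarrow> F\<^sub>n\<close> and the augmentation \<open>F\<^sub>0 \<rightarrow> M\<close>.\<close>

definition res_diff ::
  "('r, 'e) ring_scheme \<Rightarrow> ('r, 'm, 'f) module_scheme \<Rightarrow> nat
    \<Rightarrow> (('r, 'm) cell \<Rightarrow> 'r) \<Rightarrow> (('r, 'm) cell \<Rightarrow> 'r)"
  where "res_diff R M n = free_lift R (res_mod R M n) (cell_bdry R)"

definition res_aug ::
  "('r, 'e) ring_scheme \<Rightarrow> ('r, 'm, 'f) module_scheme \<Rightarrow> (('r, 'm) cell \<Rightarrow> 'r) \<Rightarrow> 'm"
  where "res_aug R M = free_lift R M (cell_aug M)"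

subsection \<open>The resolution is exact\<close>

lemma free_mod_simps:
  "carrier (free_mod R B) = {f. (\<forall>x. f x \<in> carrier R) \<and> (\<forall>x. x \<notin> B \<longrightarrow> f x = \<zero>\<^bsub>R\<^esub>) \<and> finite {x. f x \<noteq> \<zero>\<^bsub>R\<^esub>}}"
  "\<zero>\<^bsub>free_mod R B\<^esub> = (\<lambda>x. \<zero>\<^bsub>R\<^esub>)"
  "f \<oplus>\<^bsub>free_mod R B\<^esub> g = (\<lambda>x. f x \<oplus>\<^bsub>R\<^esub> g x)"
  "r \<odot>\<^bsub>free_mod R B\<^esub> f = (\<lambda>x. r \<otimes>\<^bsub>R\<^esub> f x)"
  by (auto simp: free_mod_def)

context cring begin

lemma free_module: "module R (free_mod R B)"
proof (rule moduleI)
  have fin: "finite {x. f x \<oplus> g x \<noteq> \<zero>}" if "finite {x. f x \<noteq> \<zero>}" "finite {x. g x \<noteq> \<zero>}" for f g :: "'x \<Rightarrow> 'a"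
    by (rule finite_subset[of _ "{x. f x \<noteq> \<zero>} \<union> {x. g x \<noteq> \<zero>}"]) (use that in auto)
  have fin2: "finite {x. r \<otimes> f x \<noteq> \<zero>}" if "finite {x. f x \<noteq> \<zero>}" "r \<in> carrier R" for f :: "'x \<Rightarrow> 'a" and r
    by (rule finite_subset[of _ "{x. f x \<noteq> \<zero>}"]) (use that in auto)
  show "abelian_group (free_mod R B)"
  proof (rule abelian_groupI)
    fix f assume f: "f \<in> carrier (free_mod R B)"
    have "finite {x. \<ominus> f x \<noteq> \<zero>}"
      by (rule finite_subset[of _ "{x. f x \<noteq> \<zero>}"]) (use f in \<open>auto simp: free_mod_simps\<close>)
    then show "\<exists>y\<in>carrier (free_mod R B). y \<oplus>\<^bsub>free_mod R B\<^esub> f = \<zero>\<^bsub>free_mod R B\<^esub>"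
      using f by (intro bexI[of _ "\<lambda>x. \<ominus> f x"]) (auto simp: free_mod_simps l_neg)
  next
    fix f g assume "f \<in> carrier (free_mod R B)" "g \<in> carrier (free_mod R B)"
    then show "f \<oplus>\<^bsub>free_mod R B\<^esub> g = g \<oplus>\<^bsub>free_mod R B\<^esub> f"
      by (auto simp: free_mod_simps a_comm)
  qed (auto simp: free_mod_simps fin a_assoc)
  show "a \<odot>\<^bsub>free_mod R B\<^esub> f \<in> carrier (free_mod R B)" if "a \<in> carrier R" "f \<in> carrier (free_mod R B)" for a f
    using that fin2 by (auto simp: free_mod_simps)
qed (auto simp: free_mod_simps l_distr r_distr m_assoc is_cring)

lemma basis_in: "x \<in> B \<Longrightarrow> free_basis R x \<in> carrier (free_mod R B)"
  by (auto simp: free_mod_simps free_basis_def)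

end

context module begin

lemma lin_comb_in:
  assumes "set l \<subseteq> carrier R \<times> B" "\<And>x. x \<in> B \<Longrightarrow> \<phi> x \<in> carrier M"
  shows "lin_comb M \<phi> l \<in> carrier M"
  using assms by (induction l) (auto simp: lin_comb_def)

lemma free_lift_superset:
  assumes "f \<in> carrier (free_mod R B)" "finite A" "{x. f x \<noteq> \<zero>} \<subseteq> A" "A \<subseteq> B"
      "\<And>x. x \<in> B \<Longrightarrow> \<phi> x \<in> carrier M"
  shows "free_lift R M \<phi> f = (\<Oplus>\<^bsub>M\<^esub>x\<in>A. f x \<odot>\<^bsub>M\<^esub> \<phi> x)"
  unfolding free_lift_def
  by (rule M.add.finprod_mono_neutral_cong_left) (use assms in \<open>auto simp: free_mod_simps subset_iff\<close>)

lemma free_lift_in: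
  assumes "f \<in> carrier (free_mod R B)" "\<And>x. x \<in> B \<Longrightarrow> \<phi> x \<in> carrier M"
  shows "free_lift R M \<phi> f \<in> carrier M"
  unfolding free_lift_def
  by (rule M.finsum_closed) (use assms in \<open>auto simp: free_mod_simps Pi_def\<close>)

lemma free_lift_linear:
  assumes \<phi>: "\<And>x. x \<in> B \<Longrightarrow> \<phi> x \<in> carrier M"
  shows "lin_map R (free_mod R B) M (free_lift R M \<phi>)"
proof -
  interpret F: module R "free_mod R B" by (rule R.free_module)
  have sub: "{x. f x \<noteq> \<zero>} \<subseteq> B" if "f \<in> carrier (free_mod R B)" for f
    using that by (auto simp: free_mod_simps)
  have fin: "finite {x. f x \<noteq> \<zero>}" if "f \<in> carrier (free_mod R B)" for f
    using that by (auto simp: free_mod_simps)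
  have c: "f x \<in> carrier R" if "f \<in> carrier (free_mod R B)" for f x
    using that by (auto simp: free_mod_simps)
  have 1: "free_lift R M \<phi> (f \<oplus>\<^bsub>free_mod R B\<^esub> g) = free_lift R M \<phi> f \<oplus>\<^bsub>M\<^esub> free_lift R M \<phi> g"
    if f: "f \<in> carrier (free_mod R B)" and g: "g \<in> carrier (free_mod R B)" for f g
  proof -
    let ?A = "{x. f x \<noteq> \<zero>} \<union> {x. g x \<noteq> \<zero>}"
    have A: "finite ?A" "?A \<subseteq> B" using sub fin f g by auto
    have "free_lift R M \<phi> (f \<oplus>\<^bsub>free_mod R B\<^esub> g) = (\<Oplus>\<^bsub>M\<^esub>x\<in>?A. (f x \<oplus> g x) \<odot>\<^bsub>M\<^esub> \<phi> x)"
      by (subst free_lift_superset[where A="?A" and B=B])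
         (use f g A \<phi> F.a_closed in \<open>auto simp: free_mod_simps(3)\<close>)
    also have "\<dots> = (\<Oplus>\<^bsub>M\<^esub>x\<in>?A. f x \<odot>\<^bsub>M\<^esub> \<phi> x \<oplus>\<^bsub>M\<^esub> g x \<odot>\<^bsub>M\<^esub> \<phi> x)"
      by (rule M.finsum_cong') (use c[OF f] c[OF g] A \<phi> in \<open>auto simp: smult_l_distr subset_iff\<close>)
    also have "\<dots> = (\<Oplus>\<^bsub>M\<^esub>x\<in>?A. f x \<odot>\<^bsub>M\<^esub> \<phi> x) \<oplus>\<^bsub>M\<^esub> (\<Oplus>\<^bsub>M\<^esub>x\<in>?A. g x \<odot>\<^bsub>M\<^esub> \<phi> x)"
      by (rule M.finsum_addf) (use c[OF f] c[OF g] A \<phi> in \<open>auto simp: subset_iff\<close>)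
    also have "\<dots> = free_lift R M \<phi> f \<oplus>\<^bsub>M\<^esub> free_lift R M \<phi> g"
      using free_lift_superset[OF f A(1) _ A(2), of \<phi>] free_lift_superset[OF g A(1) _ A(2), of \<phi>] \<phi> by simp
    finally show ?thesis .
  qed
  have 2: "free_lift R M \<phi> (r \<odot>\<^bsub>free_mod R B\<^esub> f) = r \<odot>\<^bsub>M\<^esub> free_lift R M \<phi> f"
    if f: "f \<in> carrier (free_mod R B)" and r: "r \<in> carrier R" for f r
  proof -
    let ?A = "{x. f x \<noteq> \<zero>}"
    have A: "finite ?A" "?A \<subseteq> B" using sub fin f by auto
    have "free_lift R M \<phi> (r \<odot>\<^bsub>free_mod R B\<^esub> f) = (\<Oplus>\<^bsub>M\<^esub>x\<in>?A. (r \<otimes> f x) \<odot>\<^bsub>M\<^esub> \<phi> x)"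
      by (subst free_lift_superset[where A="?A" and B=B])
         (use f r A \<phi> F.smult_closed in \<open>auto simp: free_mod_simps(4)\<close>)
    also have "\<dots> = (\<Oplus>\<^bsub>M\<^esub>x\<in>?A. r \<odot>\<^bsub>M\<^esub> (f x \<odot>\<^bsub>M\<^esub> \<phi> x))"
      by (rule M.finsum_cong') (use c[OF f] r A \<phi> in \<open>auto simp: smult_assoc1 subset_iff\<close>)
    also have "\<dots> = r \<odot>\<^bsub>M\<^esub> free_lift R M \<phi> f"
      unfolding free_lift_def
      by (rule finsum_smult_ldistr[symmetric]) (use c[OF f] r A \<phi> in \<open>auto simp: subset_iff\<close>)
    finally show ?thesis .
  qed
  show ?thesis unfolding lin_map_def using 1 2 free_lift_in[of _ B \<phi>] \<phi> by blast
qed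

lemma free_lift_basis:
  assumes "x \<in> B" and "\<And>x. x \<in> B \<Longrightarrow> \<phi> x \<in> carrier M"
  shows "free_lift R M \<phi> (free_basis R x) = \<phi> x"
proof -
  have "free_lift R M \<phi> (free_basis R x) = (\<Oplus>\<^bsub>M\<^esub>y\<in>{x}. free_basis R x y \<odot>\<^bsub>M\<^esub> \<phi> y)"
    by (rule free_lift_superset[OF R.basis_in]) (use assms in \<open>auto simp: free_basis_def\<close>)
  also have "\<dots> = free_basis R x x \<odot>\<^bsub>M\<^esub> \<phi> x"
    using assms by (subst M.finsum_insert) (auto simp: free_basis_def)
  finally show ?thesis using assms by (simp add: free_basis_def)
qed

lemma lin_comb_free_cong: "lin_comb (free_mod R B) \<psi> l = lin_comb (free_mod R UNIV) \<psi> l"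
  by (simp add: lin_comb_def free_mod_simps)

lemma free_lift_lin_comb:
  assumes \<phi>: "\<And>x. x \<in> B \<Longrightarrow> \<phi> x \<in> carrier M" and l: "set l \<subseteq> carrier R \<times> B"
  shows "free_lift R M \<phi> (lin_comb (free_mod R UNIV) (free_basis R) l) = lin_comb M \<phi> l"
proof -
  interpret F: module R "free_mod R B" by (rule R.free_module)
  have lin: "lin_map R (free_mod R B) M (free_lift R M \<phi>)" using \<phi> by (rule free_lift_linear)
  have add: "free_lift R M \<phi> (f \<oplus>\<^bsub>free_mod R B\<^esub> g) = free_lift R M \<phi> f \<oplus>\<^bsub>M\<^esub> free_lift R M \<phi> g"
    if "f \<in> carrier (free_mod R B)" "g \<in> carrier (free_mod R B)" for f g
    using lin that unfolding lin_map_def by blast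
  have smult: "free_lift R M \<phi> (r \<odot>\<^bsub>free_mod R B\<^esub> f) = r \<odot>\<^bsub>M\<^esub> free_lift R M \<phi> f"
    if "r \<in> carrier R" "f \<in> carrier (free_mod R B)" for r f
    using lin that unfolding lin_map_def by blast
  have z: "free_lift R M \<phi> \<zero>\<^bsub>free_mod R B\<^esub> = \<zero>\<^bsub>M\<^esub>"
    by (simp add: free_lift_def free_mod_simps)
  have "free_lift R M \<phi> (lin_comb (free_mod R B) (free_basis R) l) = lin_comb M \<phi> l"
    using l
  proof (induction l)
    case Nil then show ?case by (simp add: lin_comb_def z)
  next
    case (Cons p l)
    obtain r x where p: "p = (r, x)" by force
    have in1: "lin_comb (free_mod R B) (free_basis R) l \<in> carrier (free_mod R B)"
      by (rule F.lin_comb_in[where B=B]) (use Cons in \<open>auto intro: R.basis_in\<close>)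
    have r: "r \<in> carrier R" "x \<in> B" using Cons p by auto
    have b: "free_basis R x \<in> carrier (free_mod R B)" using r by (auto intro: R.basis_in)
    have "lin_comb (free_mod R B) (free_basis R) (p # l) = r \<odot>\<^bsub>free_mod R B\<^esub> free_basis R x \<oplus>\<^bsub>free_mod R B\<^esub> lin_comb (free_mod R B) (free_basis R) l"
      by (simp add: lin_comb_def p)
    then have "free_lift R M \<phi> (lin_comb (free_mod R B) (free_basis R) (p # l)) =
        r \<odot>\<^bsub>M\<^esub> \<phi> x \<oplus>\<^bsub>M\<^esub> free_lift R M \<phi> (lin_comb (free_mod R B) (free_basis R) l)"
      using add[OF F.smult_closed[OF r(1) b] in1] smult[OF r(1) b] free_lift_basis[of x B \<phi>] r(2) \<phi> by simp
    moreover have "free_lift R M \<phi> (lin_comb (free_mod R B) (free_basis R) l) = lin_comb M \<phi> l"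
      using Cons by auto
    ultimately show ?case by (simp add: p lin_comb_def)
  qed
  then show ?thesis by (simp add: lin_comb_free_cong[of B])
qed

end

lemma (in cring) free_span:
  assumes f: "f \<in> carrier (free_mod R B)"
  shows "\<exists>l. set l \<subseteq> carrier R \<times> B \<and> f = lin_comb (free_mod R UNIV) (free_basis R) l"
proof -
  interpret F: module R "free_mod R B" by (rule free_module)
  have "\<forall>f. f \<in> carrier (free_mod R B) \<and> {x. f x \<noteq> \<zero>} \<subseteq> A \<longrightarrow> (\<exists>l. set l \<subseteq> carrier R \<times> B \<and> f = lin_comb (free_mod R UNIV) (free_basis R) l)"
    if "finite A" "A \<subseteq> B" for A
    using that
  proof (induction A)
    case empty
    show ?case by (intro allI impI exI[of _ "[]"]) (auto simp: lin_comb_def free_mod_simps)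
  next
    case (insert a A)
    show ?case
    proof (intro allI impI)
      fix f assume f: "f \<in> carrier (free_mod R B) \<and> {x. f x \<noteq> \<zero>} \<subseteq> insert a A"
      let ?g = "f(a := \<zero>)"
      have "finite {x. ?g x \<noteq> \<zero>}"
        by (rule finite_subset[of _ "{x. f x \<noteq> \<zero>}"]) (use f in \<open>auto simp: free_mod_simps\<close>)
      then have "?g \<in> carrier (free_mod R B)" "{x. ?g x \<noteq> \<zero>} \<subseteq> A"
        using f by (auto simp: free_mod_simps)
      then obtain l where l: "set l \<subseteq> carrier R \<times> B" "?g = lin_comb (free_mod R UNIV) (free_basis R) l"
        using insert by blast
      have fc: "f x \<in> carrier R" for x using f by (auto simp: free_mod_simps)
      have "f x = f a \<otimes> free_basis R a x \<oplus> ?g x" for x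
        using fc by (auto simp: free_basis_def)
      moreover have "lin_comb (free_mod R UNIV) (free_basis R) ((f a, a) # l) =
          (\<lambda>x. f a \<otimes> free_basis R a x \<oplus> ?g x)"
        unfolding l(2) by (simp add: lin_comb_def free_mod_simps)
      ultimately have "f = lin_comb (free_mod R UNIV) (free_basis R) ((f a, a) # l)"
        by (simp add: fun_eq_iff)
      then show "\<exists>l. set l \<subseteq> carrier R \<times> B \<and> f = lin_comb (free_mod R UNIV) (free_basis R) l"
        using l fc insert.prems by (intro exI[of _ "(f a, a) # l"]) auto
    qed
  qed
  from this[of "{x. f x \<noteq> \<zero>}"] f show ?thesis by (auto simp: free_mod_simps)
qed

context module begin

lemma cell_aug_in: "x \<in> cells R M 0 \<Longrightarrow> cell_aug M x \<in> carrier M"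
  by auto

lemma cell_bdry_in: "x \<in> cells R M (Suc n) \<Longrightarrow> cell_bdry R x \<in> carrier (res_mod R M n)"
proof -
  assume "x \<in> cells R M (Suc n)"
  then obtain l where x: "x = Rel l" and l: "set l \<subseteq> carrier R \<times> cells R M n" by auto
  interpret F: module R "res_mod R M n" unfolding res_mod_def by (rule R.free_module)
  have "lin_comb (res_mod R M n) (free_basis R) l \<in> carrier (res_mod R M n)"
    by (rule F.lin_comb_in[OF l]) (auto simp: res_mod_def intro: R.basis_in)
  then show ?thesis by (simp add: x res_mod_def lin_comb_free_cong[of "cells R M n"])
qed

lemma res_aug_linear: "lin_map R (res_mod R M 0) M (res_aug R M)"
  unfolding res_mod_def res_aug_def by (rule free_lift_linear) (rule cell_aug_in)

lemma res_diff_linear: "lin_map R (res_mod R M (Suc n)) (res_mod R M n) (res_diff R M n)"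
proof -
  interpret F: module R "res_mod R M n" unfolding res_mod_def by (rule R.free_module)
  show ?thesis unfolding res_diff_def by (subst res_mod_def) (rule F.free_lift_linear, rule cell_bdry_in)
qed

lemma res_aug_surj: "res_aug R M ` carrier (res_mod R M 0) = carrier M"
proof -
  have "m \<in> res_aug R M ` carrier (res_mod R M 0)" if m: "m \<in> carrier M" for m
  proof -
    have g: "Gen m \<in> cells R M 0" using m by simp
    have "res_aug R M (free_basis R (Gen m)) = m"
      unfolding res_aug_def using free_lift_basis[OF g cell_aug_in] by simp
    then show ?thesis using R.basis_in[OF g] by (force simp: res_mod_def)
  qed
  then show ?thesis using res_aug_linear unfolding lin_map_def by blast
qed

lemma exact_step:
  fixes N :: "('a, 'n, 'k) module_scheme"
  assumes N: "module R N" and \<phi>: "\<And>x. x \<in> cells R M n \<Longrightarrow> \<phi> x \<in> carrier N"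
   and c: "cells R M (Suc n) = {Rel l | l. set l \<subseteq> carrier R \<times> cells R M n \<and> lin_comb N \<phi> l = \<zero>\<^bsub>N\<^esub>}"
  shows "res_diff R M n ` carrier (res_mod R M (Suc n)) = {x \<in> carrier (res_mod R M n). free_lift R N \<phi> x = \<zero>\<^bsub>N\<^esub>}"
proof -
  interpret N: module R N by (rule N)
  interpret F: module R "res_mod R M n" unfolding res_mod_def by (rule R.free_module)
  have b: "free_lift R N \<phi> (cell_bdry R x) = \<zero>\<^bsub>N\<^esub>" if "x \<in> cells R M (Suc n)" for x
  proof -
    from that c obtain l where l: "x = Rel l" "set l \<subseteq> carrier R \<times> cells R M n" "lin_comb N \<phi> l = \<zero>\<^bsub>N\<^esub>" by auto
    show ?thesis using N.free_lift_lin_comb[OF \<phi> l(2)] l by simp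
  qed
  have lin: "lin_map R (res_mod R M n) N (free_lift R N \<phi>)" unfolding res_mod_def by (rule N.free_lift_linear[OF \<phi>])
  have d: "free_lift R N \<phi> (res_diff R M n x) = \<zero>\<^bsub>N\<^esub>" if "x \<in> carrier (res_mod R M (Suc n))" for x
  proof -
    obtain l where l: "set l \<subseteq> carrier R \<times> cells R M (Suc n)" "x = lin_comb (free_mod R UNIV) (free_basis R) l"
      using R.free_span[of x "cells R M (Suc n)"] \<open>x \<in> _\<close> by (auto simp: res_mod_def)
    have "res_diff R M n x = lin_comb (res_mod R M n) (cell_bdry R) l"
      unfolding res_diff_def l(2) by (rule F.free_lift_lin_comb[OF cell_bdry_in l(1)])
    moreover have "free_lift R N \<phi> (lin_comb (res_mod R M n) (cell_bdry R) l) = \<zero>\<^bsub>N\<^esub>"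
      using l(1)
    proof (induction l)
      case Nil then show ?case by (simp add: lin_comb_def free_lift_def res_mod_def free_mod_simps)
    next
      case (Cons p l)
      obtain r y where p: "p = (r, y)" by force
      have in1: "lin_comb (res_mod R M n) (cell_bdry R) l \<in> carrier (res_mod R M n)"
        by (rule F.lin_comb_in[where B="cells R M (Suc n)"]) (use Cons cell_bdry_in in auto)
      have r: "r \<in> carrier R" "y \<in> cells R M (Suc n)" using Cons p by auto
      have "lin_comb (res_mod R M n) (cell_bdry R) (p # l) = r \<odot>\<^bsub>res_mod R M n\<^esub> cell_bdry R y \<oplus>\<^bsub>res_mod R M n\<^esub> lin_comb (res_mod R M n) (cell_bdry R) l"
        by (simp add: lin_comb_def p)
      then show ?case using lin in1 r cell_bdry_in[OF r(2)] F.smult_closed[OF r(1) cell_bdry_in[OF r(2)]] Cons b[OF r(2)]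
        by (simp add: lin_map_def)
    qed
    ultimately show ?thesis by simp
  qed
  have k: "x \<in> res_diff R M n ` carrier (res_mod R M (Suc n))"
    if x: "x \<in> carrier (res_mod R M n)" "free_lift R N \<phi> x = \<zero>\<^bsub>N\<^esub>" for x
  proof -
    obtain l where l: "set l \<subseteq> carrier R \<times> cells R M n" "x = lin_comb (free_mod R UNIV) (free_basis R) l"
      using R.free_span[of x "cells R M n"] x by (auto simp: res_mod_def)
    have g: "Rel l \<in> cells R M (Suc n)" unfolding c using N.free_lift_lin_comb[OF \<phi> l(1)] l x by simp
    have "res_diff R M n (free_basis R (Rel l)) = x"
      unfolding res_diff_def using F.free_lift_basis[OF g cell_bdry_in] l by simp
    then show ?thesis using R.basis_in[OF g] by (force simp: res_mod_def)
  qed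
  show ?thesis using d k res_diff_linear[of n] unfolding lin_map_def by blast
qed

lemma res_exact_0: "res_diff R M 0 ` carrier (res_mod R M (Suc 0)) = a_kernel (res_mod R M 0) M (res_aug R M)"
  unfolding a_kernel_def kernel_def res_aug_def
  using exact_step[OF module_axioms, of 0 "cell_aug M"] cell_aug_in by (simp add: image_def)

lemma res_exact_Suc: "res_diff R M (Suc n) ` carrier (res_mod R M (Suc (Suc n))) = a_kernel (res_mod R M (Suc n)) (res_mod R M n) (res_diff R M n)"
proof -
  have N: "module R (res_mod R M n)" unfolding res_mod_def by (rule R.free_module)
  have "cells R M (Suc (Suc n)) = {Rel l | l. set l \<subseteq> carrier R \<times> cells R M (Suc n) \<and> lin_comb (res_mod R M n) (cell_bdry R) l = \<zero>\<^bsub>res_mod R M n\<^esub>}"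
    by (simp add: res_mod_def lin_comb_free_cong[of "cells R M n"] free_mod_simps)
  from exact_step[OF N cell_bdry_in this] show ?thesis
    unfolding a_kernel_def kernel_def res_diff_def[of R M n] by simp
qed
end


subsection \<open>Cohomology of the Hom complex\<close>

definition cochain_mod ::
  "('r, 'e) ring_scheme \<Rightarrow> ('r, 'm, 'f) module_scheme \<Rightarrow> ('r, 'n, 'g) module_scheme \<Rightarrow> nat
    \<Rightarrow> ('r, (('r, 'm) cell \<Rightarrow> 'r) \<Rightarrow> 'n) module"
  where "cochain_mod R M N n = Hom_mod R (res_mod R M n) N"

definition cobdry ::
  "('r, 'e) ring_scheme \<Rightarrow> ('r, 'm, 'f) module_scheme \<Rightarrow> nat
    \<Rightarrow> ((('r, 'm) cell \<Rightarrow> 'r) \<Rightarrow> 'n) \<Rightarrow> ((('r, 'm) cell \<Rightarrow> 'r) \<Rightarrow> 'n)"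
  where "cobdry R M n f = (\<lambda>x\<in>carrier (res_mod R M (Suc n)). f (res_diff R M n x))"

definition cocycles ::
  "('r, 'e) ring_scheme \<Rightarrow> ('r, 'm, 'f) module_scheme \<Rightarrow> ('r, 'n, 'g) module_scheme \<Rightarrow> nat
    \<Rightarrow> ((('r, 'm) cell \<Rightarrow> 'r) \<Rightarrow> 'n) set"
  where "cocycles R M N n =
    {f \<in> carrier (cochain_mod R M N n). cobdry R M n f = \<zero>\<^bsub>cochain_mod R M N (Suc n)\<^esub>}"

primrec coboundaries ::
  "('r, 'e) ring_scheme \<Rightarrow> ('r, 'm, 'f) module_scheme \<Rightarrow> ('r, 'n, 'g) module_scheme \<Rightarrow> nat
    \<Rightarrow> ((('r, 'm) cell \<Rightarrow> 'r) \<Rightarrow> 'n) set"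
  where
    "coboundaries R M N 0 = {\<zero>\<^bsub>cochain_mod R M N 0\<^esub>}"
  | "coboundaries R M N (Suc n) = cobdry R M n ` carrier (cochain_mod R M N n)"

definition Ext_mod ::
  "('r, 'e) ring_scheme \<Rightarrow> nat \<Rightarrow> ('r, 'm, 'f) module_scheme \<Rightarrow> ('r, 'n, 'g) module_scheme
    \<Rightarrow> ('r, ((('r, 'm) cell \<Rightarrow> 'r) \<Rightarrow> 'n) set) module"
  where "Ext_mod R i M N =
    quot_mod (cochain_mod R M N i \<lparr> carrier := cocycles R M N i \<rparr>) (coboundaries R M N i)"


section \<open>Local rings and completion\<close>

locale noetherian_local_ring = cring R + noetherian_ring R for R (structure) +
  assumes unique_maximal: "\<exists>!I. maximalideal I R"

definition max_ideal :: "('r, 'e) ring_scheme \<Rightarrow> 'r set"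
  where "max_ideal R = (THE I. maximalideal I R)"

definition max_pow :: "('r, 'e) ring_scheme \<Rightarrow> nat \<Rightarrow> 'r set"
  where "max_pow R n = max_ideal R [^]\<^bsub>ideals_set R\<^esub> n"

text \<open>
  The completion is the inverse limit of the rings \<open>R/\<mm>\<^sup>n\<close>. An element is a sequence of cosets; the
  projection from \<open>R/\<mm>\<^sup>n\<^sup>+\<^sup>1\<close> to \<open>R/\<mm>\<^sup>n\<close> maps a coset to the unique coset containing it. The same record
  carries the ring structure and the \<open>R\<close>-module structure.
\<close>

definition completion :: "('r, 'e) ring_scheme \<Rightarrow> ('r, nat \<Rightarrow> 'r set) module"
  where "completion R =
    \<lparr> carrier = {x. (\<forall>n. x n \<in> carrier (R Quot max_pow R n)) \<and> (\<forall>n. x (Suc n) \<subseteq> x n)},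
      monoid.mult = (\<lambda>x y n. x n \<otimes>\<^bsub>R Quot max_pow R n\<^esub> y n),
      one = (\<lambda>n. \<one>\<^bsub>R Quot max_pow R n\<^esub>),
      ring.zero = (\<lambda>n. \<zero>\<^bsub>R Quot max_pow R n\<^esub>),
      add = (\<lambda>x y n. x n \<oplus>\<^bsub>R Quot max_pow R n\<^esub> y n),
      smult = (\<lambda>r x n. (max_pow R n +>\<^bsub>R\<^esub> r) \<otimes>\<^bsub>R Quot max_pow R n\<^esub> x n) \<rparr>"

definition completion_map :: "('r, 'e) ring_scheme \<Rightarrow> 'r \<Rightarrow> nat \<Rightarrow> 'r set"
  where "completion_map R r = (\<lambda>n. max_pow R n +>\<^bsub>R\<^esub> r)"

locale complete_noetherian_local_ring = noetherian_local_ring R for R (structure) +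
  assumes complete: "completion_map R \<in> ring_iso R (completion R)"

text \<open>
  The completion acts on every module whose elements are each annihilated by a power of the maximal
  ideal, in particular on every artinian module: if \<open>\<mm>\<^sup>n t = 0\<close>, then \<open>x\<close> acts on \<open>t\<close> as any
  representative of its component in \<open>R/\<mm>\<^sup>n\<close>. The value does not depend on \<open>n\<close> or on the representative.
\<close>

definition completion_act ::
  "('r, 'e) ring_scheme \<Rightarrow> ('r, 't, 'f) module_scheme \<Rightarrow> (nat \<Rightarrow> 'r set) \<Rightarrow> 't \<Rightarrow> 't"
  where "completion_act R T x t =
    (THE u. \<exists>n. (\<forall>a\<in>max_pow R n. a \<odot>\<^bsub>T\<^esub> t = \<zero>\<^bsub>T\<^esub>) \<and> (\<exists>r\<in>x n. u = r \<odot>\<^bsub>T\<^esub> t))"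


section \<open>Quasidualizing modules and derived reflexivity\<close>

definition homothety ::
  "('r, 'e) ring_scheme \<Rightarrow> ('r, 't, 'f) module_scheme \<Rightarrow> (nat \<Rightarrow> 'r set) \<Rightarrow> 't \<Rightarrow> 't"
  where "homothety R T x = (\<lambda>t\<in>carrier T. completion_act R T x t)"

definition quasidualizing :: "('r, 'e) ring_scheme \<Rightarrow> ('r, 't, 'f) module_scheme \<Rightarrow> bool"
  where "quasidualizing R T \<longleftrightarrow>
    artinian_module R T \<and>
    lin_iso R (completion R) (Hom_mod R T T) (homothety R T) \<and>
    (\<forall>i>0. zero_mod (Ext_mod R i T T))"

definition biduality ::
  "('r, 'e) ring_scheme \<Rightarrow> ('r, 'l, 'f) module_scheme \<Rightarrow> ('r, 't, 'g) module_scheme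
    \<Rightarrow> 'l \<Rightarrow> ('l \<Rightarrow> 't) \<Rightarrow> 't"
  where "biduality R L T l = (\<lambda>\<phi>\<in>carrier (Hom_mod R L T). \<phi> l)"

definition derived_reflexive ::
  "('r, 'e) ring_scheme \<Rightarrow> ('r, 't, 'g) module_scheme \<Rightarrow> ('r, 'l, 'f) module_scheme \<Rightarrow> bool"
  where "derived_reflexive R T L \<longleftrightarrow>
    module R L \<and>
    lin_iso R L (Hom_mod R (Hom_mod R L T) T) (biduality R L T) \<and>
    (\<forall>i>0. zero_mod (Ext_mod R i L T) \<and> zero_mod (Ext_mod R i (Hom_mod R L T) T))"

definition G_artin ::
  "('r, 'e) ring_scheme \<Rightarrow> ('r, 't, 'g) module_scheme \<Rightarrow> ('r, 'l, 'f) module_scheme set"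
  where "G_artin R T = {L. artinian_module R L \<and> derived_reflexive R T L}"

end

theory Submission
  imports Defs
begin

text \<open>
  For an exact sequence \<open>0 \<rightarrow> A \<rightarrow> B \<rightarrow> C \<rightarrow> 0\<close>, a chain map between the free resolutions of \<open>A\<close> and \<open>B\<close>
  lifts \<open>A \<rightarrow> B\<close>, and its mapping cone is a projective resolution of \<open>C\<close>. Computing \<open>Ext(C, T)\<close> from the
  cone gives all instances of the long exact sequence that are needed to move the vanishing of
  \<open>Ext(-, T)\<close> between the three modules; applying this to \<open>L\<close> and to the dual modules \<open>Hom(L, T)\<close>, and
  the short five lemma to the biduality maps, settles everything as soon as
  \<open>Hom(L2, T) \<rightarrow> Hom(L1, T)\<close> is surjective.

  Surjectivity is automatic when \<open>Ext^1(L3, T) = 0\<close>. If instead \<open>L1\<close> and \<open>L2\<close> are in the class, it holds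
  modulo the maximal ideal: otherwise a nonzero functional on the cokernel with values in the socle of
  \<open>T\<close> would be evaluation at an element of \<open>L1\<close>, contradicting biduality for \<open>L2\<close>. It then holds outright
  by successive approximation, since elements of an artinian module are annihilated by powers of the
  maximal ideal.
\<close>

text \<open>Ext is defined through one particular resolution, and the standard resolutions of three
  modules in an exact sequence do not themselves form an exact sequence. The cone avoids this at the
  price of a comparison theorem for \<open>C\<close>. No connecting maps between Ext modules are
  formed: every fragment of the long exact sequence is an implication between vanishing statements
  about cochains.

  Biduality also needs \<open>Hom(Hom(L2, T), T)\<close> to map onto
  \<open>Hom(Hom(L3, T), T)\<close>. If \<open>L1\<close> is in the class this follows from
  \<open>Ext^1(Hom(L1, T), T) = 0\<close>. If only \<open>L2\<close> and \<open>L3\<close> are, that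
  vanishing is still to be proved, and the surjectivity comes from biduality for \<open>L3\<close>
  instead.

  Nakayama's lemma is not applied to the cokernel of \<open>Hom(L2, T)\<close> in
  \<open>Hom(L1, T)\<close>, since no finite generation of the latter is established. It is used
  only inside cyclic submodules of artinian modules, where the noetherian ring supplies finiteness;
  this yields the torsion that makes the approximation locally finite.\<close>

lemma (in abelian_group) minus_eq_zero_iff:
  assumes "x \<in> carrier G" "y \<in> carrier G"
  shows "x \<ominus> y = \<zero> \<longleftrightarrow> x = y"
proof
  assume "x \<ominus> y = \<zero>"
  then have "\<ominus> (\<ominus> y) = x" using assms by (intro minus_equality) (simp_all add: a_minus_def)
  then show "x = y" using assms by simp
qed (use assms in \<open>simp add: a_minus_def r_neg\<close>)

lemma (in abelian_group) a_inv_zero [simp]: "\<ominus> \<zero> = \<zero>"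
  by (rule minus_equality) auto

subsection \<open>Linear maps\<close>

lemma lin_mapD:
  assumes "lin_map R M N f"
  shows "x \<in> carrier M \<Longrightarrow> f x \<in> carrier N"
    and "x \<in> carrier M \<Longrightarrow> y \<in> carrier M \<Longrightarrow> f (x \<oplus>\<^bsub>M\<^esub> y) = f x \<oplus>\<^bsub>N\<^esub> f y"
    and "r \<in> carrier R \<Longrightarrow> x \<in> carrier M \<Longrightarrow> f (r \<odot>\<^bsub>M\<^esub> x) = r \<odot>\<^bsub>N\<^esub> f x"
  using assms unfolding lin_map_def by auto

lemma lin_mapI:
  assumes "\<And>x. x \<in> carrier M \<Longrightarrow> f x \<in> carrier N"
    and "\<And>x y. x \<in> carrier M \<Longrightarrow> y \<in> carrier M \<Longrightarrow> f (x \<oplus>\<^bsub>M\<^esub> y) = f x \<oplus>\<^bsub>N\<^esub> f y"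
    and "\<And>r x. r \<in> carrier R \<Longrightarrow> x \<in> carrier M \<Longrightarrow> f (r \<odot>\<^bsub>M\<^esub> x) = r \<odot>\<^bsub>N\<^esub> f x"
  shows "lin_map R M N f"
  using assms unfolding lin_map_def by auto

lemma lin_map_zero:
  assumes "module R M" "module R N" "lin_map R M N f"
  shows "f \<zero>\<^bsub>M\<^esub> = \<zero>\<^bsub>N\<^esub>"
proof -
  interpret M: module R M by fact
  interpret N: module R N by fact
  have "f \<zero>\<^bsub>M\<^esub> \<oplus>\<^bsub>N\<^esub> f \<zero>\<^bsub>M\<^esub> = f \<zero>\<^bsub>M\<^esub>"
    using lin_mapD(2)[OF assms(3), of "\<zero>\<^bsub>M\<^esub>" "\<zero>\<^bsub>M\<^esub>"] by simp
  then show ?thesis using lin_mapD(1)[OF assms(3), of "\<zero>\<^bsub>M\<^esub>"] by simp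
qed

lemma lin_map_neg:
  assumes "module R M" "module R N" "lin_map R M N f" "x \<in> carrier M"
  shows "f (\<ominus>\<^bsub>M\<^esub> x) = \<ominus>\<^bsub>N\<^esub> f x"
proof -
  interpret M: module R M by fact
  interpret N: module R N by fact
  have "f (\<ominus>\<^bsub>M\<^esub> x) \<oplus>\<^bsub>N\<^esub> f x = \<zero>\<^bsub>N\<^esub>"
    using lin_mapD(2)[OF assms(3), of "\<ominus>\<^bsub>M\<^esub> x" x] lin_map_zero[OF assms(1-3)] assms(4)
    by (simp add: M.l_neg)
  then show ?thesis using lin_mapD(1)[OF assms(3)] assms(4) by (simp add: N.minus_equality)
qed

lemma lin_map_minus:
  assumes "module R M" "module R N" "lin_map R M N f" "x \<in> carrier M" "y \<in> carrier M"
  shows "f (x \<ominus>\<^bsub>M\<^esub> y) = f x \<ominus>\<^bsub>N\<^esub> f y"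
proof -
  interpret M: module R M by fact
  show ?thesis
    using assms(4,5) by (simp add: a_minus_def lin_mapD(2)[OF assms(3)] lin_map_neg[OF assms(1-3)])
qed

lemma lin_map_comp: "lin_map R M N f \<Longrightarrow> lin_map R N P g \<Longrightarrow> lin_map R M P (\<lambda>x. g (f x))"
  by (intro lin_mapI) (simp_all add: lin_mapD)

lemma lin_map_cong:
  assumes "lin_map R M N f" "module R M" "\<And>x. x \<in> carrier M \<Longrightarrow> f x = g x"
  shows "lin_map R M N g"
proof -
  interpret M: module R M by fact
  show ?thesis
    by (rule lin_mapI) (simp_all add: lin_mapD[OF assms(1)] flip: assms(3))
qed

lemma lin_map_id: "lin_map R M M (\<lambda>x. x)"
  by (simp add: lin_map_def)

lemma lin_map_const_zero: "module R N \<Longrightarrow> lin_map R M N (\<lambda>x. \<zero>\<^bsub>N\<^esub>)"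
proof -
  assume "module R N"
  then interpret N: module R N .
  show ?thesis by (rule lin_mapI) auto
qed

lemma lin_map_add:
  assumes "module R M" "module R N" "lin_map R M N f" "lin_map R M N g"
  shows "lin_map R M N (\<lambda>x. f x \<oplus>\<^bsub>N\<^esub> g x)"
proof -
  interpret N: module R N by fact
  show ?thesis
    by (rule lin_mapI)
       (auto simp: lin_mapD[OF assms(3)] lin_mapD[OF assms(4)] N.smult_r_distr N.a_ac)
qed

lemma lin_map_neg_map:
  assumes "module R M" "module R N" "lin_map R M N f"
  shows "lin_map R M N (\<lambda>x. \<ominus>\<^bsub>N\<^esub> f x)"
proof -
  interpret N: module R N by fact
  show ?thesis
    by (rule lin_mapI)
       (auto simp: lin_mapD[OF assms(3)] N.smult_r_minus N.minus_add)
qed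

lemma lin_map_diff:
  assumes "module R M" "module R N" "lin_map R M N f" "lin_map R M N g"
  shows "lin_map R M N (\<lambda>x. f x \<ominus>\<^bsub>N\<^esub> g x)"
  unfolding a_minus_def using lin_map_add[OF assms(1-3)] lin_map_neg_map[OF assms(1,2,4)] by blast

text \<open>Two preimages under \<open>e\<close> of the same element differ by a kernel element,
  which \<open>h\<close> kills, so \<open>h\<close> descends to \<open>M\<close>. This stands in for
  quotient modules: it pushes cochains that vanish on boundaries down to maps on the resolved
  module.\<close>

lemma lin_map_factor:
  assumes "module R P" "module R M" "module R N"
    and e: "lin_map R P M e" "e ` carrier P = carrier M"
    and h: "lin_map R P N h" "\<And>x. x \<in> carrier P \<Longrightarrow> e x = \<zero>\<^bsub>M\<^esub> \<Longrightarrow> h x = \<zero>\<^bsub>N\<^esub>"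
  obtains q where "lin_map R M N q" "\<And>x. x \<in> carrier P \<Longrightarrow> q (e x) = h x"
proof -
  interpret P: module R P by fact
  interpret M: module R M by fact
  interpret N: module R N by fact
  define q where "q m = h (SOME x. x \<in> carrier P \<and> e x = m)" for m
  have wd: "h x = h y" if "x \<in> carrier P" "y \<in> carrier P" "e x = e y" for x y
  proof -
    have "h (x \<ominus>\<^bsub>P\<^esub> y) = \<zero>\<^bsub>N\<^esub>"
      using that lin_mapD(1)[OF e(1)]
      by (intro h(2)) (simp_all add: lin_map_minus[OF assms(1,2) e(1)] M.minus_eq_zero_iff)
    then show ?thesis
      using that lin_mapD(1)[OF h(1)] by (simp add: lin_map_minus[OF assms(1,3) h(1)] N.minus_eq_zero_iff)
  qed
  have q: "q (e x) = h x" if "x \<in> carrier P" for x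
    unfolding q_def by (rule someI2[of _ x]) (use that in \<open>auto intro: wd\<close>)
  have "lin_map R M N q"
  proof (rule lin_mapI)
    fix x assume "x \<in> carrier M"
    then obtain x' where "x = e x'" "x' \<in> carrier P" using e(2) by blast
    then show "q x \<in> carrier N" by (simp add: q lin_mapD(1)[OF h(1)])
  next
    fix x y assume "x \<in> carrier M" "y \<in> carrier M"
    then obtain x' y' where "x = e x'" "x' \<in> carrier P" "y = e y'" "y' \<in> carrier P" using e(2) by blast
    then show "q (x \<oplus>\<^bsub>M\<^esub> y) = q x \<oplus>\<^bsub>N\<^esub> q y"
      using q[of "x' \<oplus>\<^bsub>P\<^esub> y'"] by (simp add: q lin_mapD(2)[OF h(1)] lin_mapD(2)[OF e(1)])
  next
    fix r x assume "r \<in> carrier R" "x \<in> carrier M"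
    moreover from this obtain x' where "x = e x'" "x' \<in> carrier P" using e(2) by blast
    ultimately show "q (r \<odot>\<^bsub>M\<^esub> x) = r \<odot>\<^bsub>N\<^esub> q x"
      using q[of "r \<odot>\<^bsub>P\<^esub> x'"] by (simp add: q lin_mapD(3)[OF h(1)] lin_mapD(3)[OF e(1)])
  qed
  with q show ?thesis using that by blast
qed


subsection \<open>Hom modules\<close>

lemma Hom_mod_simps:
  "carrier (Hom_mod R M N) = {f \<in> extensional (carrier M). lin_map R M N f}"
  "\<zero>\<^bsub>Hom_mod R M N\<^esub> = (\<lambda>x\<in>carrier M. \<zero>\<^bsub>N\<^esub>)"
  "f \<oplus>\<^bsub>Hom_mod R M N\<^esub> g = (\<lambda>x\<in>carrier M. f x \<oplus>\<^bsub>N\<^esub> g x)"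
  "r \<odot>\<^bsub>Hom_mod R M N\<^esub> f = (\<lambda>x\<in>carrier M. r \<odot>\<^bsub>N\<^esub> f x)"
  by (auto simp: Hom_mod_def)

lemma restrict_in_Hom: "module R M \<Longrightarrow> lin_map R M N f \<Longrightarrow> restrict f (carrier M) \<in> carrier (Hom_mod R M N)"
  by (auto simp: Hom_mod_simps intro: lin_map_cong)

lemma Hom_modD: "f \<in> carrier (Hom_mod R M N) \<Longrightarrow> lin_map R M N f"
  by (auto simp: Hom_mod_simps)

lemma Hom_mod_eqI:
  assumes "f \<in> carrier (Hom_mod R M N)" "g \<in> carrier (Hom_mod R M N)" "\<And>x. x \<in> carrier M \<Longrightarrow> f x = g x"
  shows "f = g"
  using assms by (auto simp: Hom_mod_simps intro: extensionalityI)

lemma Hom_module: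
  assumes "module R M" "module R N"
  shows "module R (Hom_mod R M N)"
proof -
  interpret M: module R M by fact
  interpret N: module R N by fact
  have add: "restrict (\<lambda>x. f x \<oplus>\<^bsub>N\<^esub> g x) (carrier M) \<in> carrier (Hom_mod R M N)"
    if "lin_map R M N f" "lin_map R M N g" for f g
    by (rule restrict_in_Hom[OF assms(1) lin_map_add[OF assms that]])
  have zero: "restrict (\<lambda>x. \<zero>\<^bsub>N\<^esub>) (carrier M) \<in> carrier (Hom_mod R M N)"
    by (rule restrict_in_Hom[OF assms(1) lin_map_const_zero[OF assms(2)]])
  \<comment> \<open>Here the commutativity of \<open>R\<close> enters: \<open>r\<close> has to move
    past the scalar for the scaled map to stay linear.\<close>
  have smult: "restrict (\<lambda>x. r \<odot>\<^bsub>N\<^esub> f x) (carrier M) \<in> carrier (Hom_mod R M N)"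
    if "r \<in> carrier R" "lin_map R M N f" for f r
    by (rule restrict_in_Hom[OF assms(1)], rule lin_mapI)
       (use that in \<open>auto simp: lin_mapD N.smult_r_distr M.R.m_comm simp flip: N.smult_assoc1\<close>)
  note D = lin_mapD[OF Hom_modD]
  show ?thesis
  proof (rule moduleI)
    show "abelian_group (Hom_mod R M N)"
    proof (rule abelian_groupI)
      fix f assume f: "f \<in> carrier (Hom_mod R M N)"
      have "restrict (\<lambda>x. \<ominus>\<^bsub>N\<^esub> f x) (carrier M) \<in> carrier (Hom_mod R M N)"
        by (rule restrict_in_Hom[OF assms(1) lin_map_neg_map[OF assms Hom_modD[OF f]]])
      then show "\<exists>g\<in>carrier (Hom_mod R M N). g \<oplus>\<^bsub>Hom_mod R M N\<^esub> f = \<zero>\<^bsub>Hom_mod R M N\<^esub>"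
        by (rule bexI[rotated]) (auto simp: Hom_mod_simps(2,3) fun_eq_iff D(1)[OF f] N.l_neg)
      show "\<zero>\<^bsub>Hom_mod R M N\<^esub> \<oplus>\<^bsub>Hom_mod R M N\<^esub> f = f"
        using f extensional_arb[of f "carrier M"]
        by (auto simp: Hom_mod_simps fun_eq_iff lin_mapD)
      fix g assume g: "g \<in> carrier (Hom_mod R M N)"
      show "f \<oplus>\<^bsub>Hom_mod R M N\<^esub> g \<in> carrier (Hom_mod R M N)"
        using add[OF Hom_modD[OF f] Hom_modD[OF g]] by (simp add: Hom_mod_simps(3))
      show "f \<oplus>\<^bsub>Hom_mod R M N\<^esub> g = g \<oplus>\<^bsub>Hom_mod R M N\<^esub> f"
        using D(1)[OF f] D(1)[OF g] by (auto simp: Hom_mod_simps(3) fun_eq_iff N.a_comm)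
      fix h assume h: "h \<in> carrier (Hom_mod R M N)"
      show "f \<oplus>\<^bsub>Hom_mod R M N\<^esub> g \<oplus>\<^bsub>Hom_mod R M N\<^esub> h = f \<oplus>\<^bsub>Hom_mod R M N\<^esub> (g \<oplus>\<^bsub>Hom_mod R M N\<^esub> h)"
        using D(1)[OF f] D(1)[OF g] D(1)[OF h] by (auto simp: Hom_mod_simps(3) fun_eq_iff N.a_assoc)
    next
      show "\<zero>\<^bsub>Hom_mod R M N\<^esub> \<in> carrier (Hom_mod R M N)"
        using zero by (simp add: Hom_mod_simps(2))
    qed
    fix f assume f: "f \<in> carrier (Hom_mod R M N)"
    then show "\<one>\<^bsub>R\<^esub> \<odot>\<^bsub>Hom_mod R M N\<^esub> f = f"
      using extensional_arb[of f "carrier M"] by (auto simp: Hom_mod_simps fun_eq_iff lin_mapD)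
    fix r assume r: "r \<in> carrier R"
    show "r \<odot>\<^bsub>Hom_mod R M N\<^esub> f \<in> carrier (Hom_mod R M N)"
      using smult[OF r Hom_modD[OF f]] by (simp add: Hom_mod_simps(4))
    show "r \<odot>\<^bsub>Hom_mod R M N\<^esub> (f \<oplus>\<^bsub>Hom_mod R M N\<^esub> g) = r \<odot>\<^bsub>Hom_mod R M N\<^esub> f \<oplus>\<^bsub>Hom_mod R M N\<^esub> r \<odot>\<^bsub>Hom_mod R M N\<^esub> g"
      if g: "g \<in> carrier (Hom_mod R M N)" for g
      using r D(1)[OF f] D(1)[OF g] by (auto simp: Hom_mod_simps(3,4) fun_eq_iff N.smult_r_distr)
    fix s assume s: "s \<in> carrier R"
    show "(r \<oplus>\<^bsub>R\<^esub> s) \<odot>\<^bsub>Hom_mod R M N\<^esub> f = r \<odot>\<^bsub>Hom_mod R M N\<^esub> f \<oplus>\<^bsub>Hom_mod R M N\<^esub> s \<odot>\<^bsub>Hom_mod R M N\<^esub> f"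
      using r s D(1)[OF f] by (auto simp: Hom_mod_simps(3,4) fun_eq_iff N.smult_l_distr)
    show "(r \<otimes>\<^bsub>R\<^esub> s) \<odot>\<^bsub>Hom_mod R M N\<^esub> f = r \<odot>\<^bsub>Hom_mod R M N\<^esub> (s \<odot>\<^bsub>Hom_mod R M N\<^esub> f)"
      using r s D(1)[OF f] by (auto simp: Hom_mod_simps(4) fun_eq_iff N.smult_assoc1)
  qed (rule M.R.is_cring)
qed

subsection \<open>Projective resolutions\<close>

text \<open>Projectivity is only ever needed as the lifting property against one given map.\<close>

definition lifts ::
  "('r, 'e) ring_scheme \<Rightarrow> ('r, 'p, 'f) module_scheme \<Rightarrow> ('r, 'x, 'g) module_scheme
    \<Rightarrow> ('r, 'y, 'h) module_scheme \<Rightarrow> ('x \<Rightarrow> 'y) \<Rightarrow> bool"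
  where "lifts R P X Y d \<longleftrightarrow>
    (\<forall>u. lin_map R P Y u \<and> u ` carrier P \<subseteq> d ` carrier X \<longrightarrow>
      (\<exists>v. lin_map R P X v \<and> (\<forall>p\<in>carrier P. d (v p) = u p)))"

lemma liftsE:
  assumes "lifts R P X Y d" "lin_map R P Y u" "\<And>p. p \<in> carrier P \<Longrightarrow> u p \<in> d ` carrier X"
  obtains v where "lin_map R P X v" "\<And>p. p \<in> carrier P \<Longrightarrow> d (v p) = u p"
  using assms unfolding lifts_def by (metis image_subsetI)

lemma lin_map_lin_comb:
  assumes "module R M" "module R N" "lin_map R M N f"
    and "set l \<subseteq> carrier R \<times> B" "\<And>x. x \<in> B \<Longrightarrow> \<phi> x \<in> carrier M" "\<And>x. x \<in> B \<Longrightarrow> \<psi> x = f (\<phi> x)"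
  shows "f (lin_comb M \<phi> l) = lin_comb N \<psi> l"
  using assms(4)
proof (induction l)
  case Nil
  then show ?case using lin_map_zero[OF assms(1-3)] by (simp add: lin_comb_def)
next
  case (Cons p l)
  interpret M: module R M by fact
  obtain r x where p: "p = (r, x)" by force
  have "lin_comb M \<phi> l \<in> carrier M"
    using Cons.prems assms(5) by (intro M.lin_comb_in[of _ B]) auto
  moreover have "f (lin_comb M \<phi> l) = lin_comb N \<psi> l" using Cons by auto
  ultimately show ?case
    using Cons.prems assms(5,6)
    by (simp add: p lin_comb_def lin_mapD(2)[OF assms(3)] lin_mapD(3)[OF assms(3)])
qed

text \<open>Preimages under \<open>d\<close> of the values of \<open>u\<close> on the basis are
  chosen and extended linearly. Equality with \<open>u\<close> is then checked on formal
  combinations, which by \<open>free_span\<close> exhaust the free module.\<close>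

lemma free_lifts:
  assumes X: "module R X" and Y: "module R Y" and d: "lin_map R X Y d"
  shows "lifts R (free_mod R B) X Y d"
  unfolding lifts_def
proof (intro allI impI)
  fix u assume u: "lin_map R (free_mod R B) Y u \<and> u ` carrier (free_mod R B) \<subseteq> d ` carrier X"
  interpret X: module R X by fact
  interpret Y: module R Y by fact
  have b: "free_basis R x \<in> carrier (free_mod R B)" if "x \<in> B" for x
    using that by (rule X.R.basis_in)
  obtain \<phi> where \<phi>: "\<And>x. x \<in> B \<Longrightarrow> \<phi> x \<in> carrier X" "\<And>x. x \<in> B \<Longrightarrow> d (\<phi> x) = u (free_basis R x)"
  proof -
    have "\<forall>x\<in>B. \<exists>y. y \<in> carrier X \<and> d y = u (free_basis R x)" using u b by (smt (verit) image_iff image_subset_iff)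
    then show ?thesis using that by metis
  qed
  have lin: "lin_map R (free_mod R B) X (free_lift R X \<phi>)"
    by (rule X.free_lift_linear[OF \<phi>(1)])
  have "d (free_lift R X \<phi> p) = u p" if p: "p \<in> carrier (free_mod R B)" for p
  proof -
    obtain l where l: "set l \<subseteq> carrier R \<times> B" "p = lin_comb (free_mod R UNIV) (free_basis R) l"
      using X.R.free_span[OF p] by blast
    have "d (free_lift R X \<phi> p) = d (lin_comb X \<phi> l)"
      by (simp add: l(2) X.free_lift_lin_comb[OF \<phi>(1) l(1)])
    also have "\<dots> = lin_comb Y (\<lambda>x. u (free_basis R x)) l"
      by (rule lin_map_lin_comb[OF X Y d l(1)]) (simp_all add: \<phi>)
    also have "\<dots> = u (lin_comb (free_mod R B) (free_basis R) l)"
      by (rule lin_map_lin_comb[OF X.R.free_module Y _ l(1), symmetric]) (use u b in auto)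
    finally show ?thesis by (simp add: l(2) X.lin_comb_free_cong[of B])
  qed
  with lin show "\<exists>v. lin_map R (free_mod R B) X v \<and> (\<forall>p\<in>carrier (free_mod R B). d (v p) = u p)" by blast
qed

text \<open>Projectivity is left out; results that need it take \<open>lifts\<close> premises.
  Exactness has the form of membership in an image because that is the side condition of
  \<open>lifts\<close>. One element type \<open>'p\<close> for all degrees lets a complex be a
  function on \<open>nat\<close>.\<close>

locale resolution =
  fixes R :: "('r, 'e) ring_scheme" and M :: "('r, 'm, 'f) module_scheme"
    and P :: "nat \<Rightarrow> ('r, 'p) module" and d :: "nat \<Rightarrow> 'p \<Rightarrow> 'p" and aug :: "'p \<Rightarrow> 'm"
  assumes module_M: "module R M"
    and module_P: "\<And>n. module R (P n)"
    and lin_d: "\<And>n. lin_map R (P (Suc n)) (P n) (d n)"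
    and lin_aug: "lin_map R (P 0) M aug"
    and aug_surj: "aug ` carrier (P 0) = carrier M"
    and exact_0: "\<And>x. x \<in> carrier (P 0) \<Longrightarrow> x \<in> d 0 ` carrier (P (Suc 0)) \<longleftrightarrow> aug x = \<zero>\<^bsub>M\<^esub>"
    and exact_Suc: "\<And>n x. x \<in> carrier (P (Suc n)) \<Longrightarrow>
      x \<in> d (Suc n) ` carrier (P (Suc (Suc n))) \<longleftrightarrow> d n x = \<zero>\<^bsub>P n\<^esub>"
begin

lemma d_closed: "x \<in> carrier (P (Suc n)) \<Longrightarrow> d n x \<in> carrier (P n)"
  by (rule lin_mapD(1)[OF lin_d])

lemma d_d: "x \<in> carrier (P (Suc (Suc n))) \<Longrightarrow> d n (d (Suc n) x) = \<zero>\<^bsub>P n\<^esub>"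
  using exact_Suc[of "d (Suc n) x" n] d_closed by blast

lemma aug_d: "x \<in> carrier (P (Suc 0)) \<Longrightarrow> aug (d 0 x) = \<zero>\<^bsub>M\<^esub>"
  using exact_0[of "d 0 x"] d_closed by blast

lemma d_zero: "d n \<zero>\<^bsub>P (Suc n)\<^esub> = \<zero>\<^bsub>P n\<^esub>"
  by (rule lin_map_zero[OF module_P module_P lin_d])

end

text \<open>The comparison theorem. A commuting square in one degree makes the next composite a
  cycle, hence by exactness of \<open>Q\<close> a boundary, so that it can be lifted; this
  liftability is part of the induction invariant.\<close>

lemma chain_map_exists:
  assumes P: "resolution R M P d e" and Q: "resolution R N Q d' e'" and f: "lin_map R M N f"
    and l0: "lifts R (P 0) (Q 0) N e'" and l: "\<And>n. lifts R (P (Suc n)) (Q (Suc n)) (Q n) (d' n)"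
  obtains \<phi> where "\<And>n. lin_map R (P n) (Q n) (\<phi> n)"
    "\<And>x. x \<in> carrier (P 0) \<Longrightarrow> e' (\<phi> 0 x) = f (e x)"
    "\<And>n x. x \<in> carrier (P (Suc n)) \<Longrightarrow> d' n (\<phi> (Suc n) x) = \<phi> n (d n x)"
proof -
  interpret P: resolution R M P d e by fact
  interpret Q: resolution R N Q d' e' by fact
  have ef: "lin_map R (P 0) N (\<lambda>x. f (e x))" by (rule lin_map_comp[OF P.lin_aug f])
  then obtain \<phi>0 where \<phi>0: "lin_map R (P 0) (Q 0) \<phi>0" "\<And>x. x \<in> carrier (P 0) \<Longrightarrow> e' (\<phi>0 x) = f (e x)"
    using liftsE[OF l0] Q.aug_surj lin_mapD(1)[OF ef] by metis
  \<comment> \<open>The clause guarded by \<open>n = 0\<close> carries the augmentation square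
    through the dependent choice, which does not return the initial value \<open>\<phi>0\<close>
    itself.\<close>
  let ?ok = "\<lambda>n \<phi>. lin_map R (P n) (Q n) \<phi> \<and> (\<forall>x\<in>carrier (P (Suc n)). \<phi> (d n x) \<in> d' n ` carrier (Q (Suc n)))
    \<and> (n = 0 \<longrightarrow> (\<forall>x\<in>carrier (P 0). e' (\<phi> x) = f (e x)))"
  have "\<exists>\<phi>. \<forall>n. ?ok n (\<phi> n) \<and> (\<forall>x\<in>carrier (P (Suc n)). d' n (\<phi> (Suc n) x) = \<phi> n (d n x))"
  proof (rule dependent_nat_choice)
    have "\<phi>0 (d 0 x) \<in> d' 0 ` carrier (Q (Suc 0))" if "x \<in> carrier (P (Suc 0))" for x
      using that by (simp add: Q.exact_0 lin_mapD(1)[OF \<phi>0(1)] P.d_closed \<phi>0 P.aug_d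
          lin_map_zero[OF P.module_M Q.module_M f])
    then show "\<exists>\<phi>. ?ok 0 \<phi>" using \<phi>0 by blast
  next
    fix \<phi> n assume \<phi>: "?ok n \<phi>"
    then have "lin_map R (P (Suc n)) (Q n) (\<lambda>x. \<phi> (d n x))" using lin_map_comp[OF P.lin_d] by blast
    then obtain \<psi> where \<psi>: "lin_map R (P (Suc n)) (Q (Suc n)) \<psi>" "\<And>x. x \<in> carrier (P (Suc n)) \<Longrightarrow> d' n (\<psi> x) = \<phi> (d n x)"
      using liftsE[OF l] \<phi> by metis
    have "\<psi> (d (Suc n) x) \<in> d' (Suc n) ` carrier (Q (Suc (Suc n)))" if "x \<in> carrier (P (Suc (Suc n)))" for x
      using that \<phi> by (simp add: Q.exact_Suc lin_mapD(1)[OF \<psi>(1)] P.d_closed \<psi> P.d_d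
          lin_map_zero[OF P.module_P Q.module_P])
    then show "\<exists>\<psi>. ?ok (Suc n) \<psi> \<and> (\<forall>x\<in>carrier (P (Suc n)). d' n (\<psi> x) = \<phi> (d n x))" using \<psi> by blast
  qed
  then show ?thesis using that by metis
qed

text \<open>The usual construction: the difference between \<open>\<psi> (Suc n)\<close> and
  \<open>s n\<close> after \<open>d n\<close> is a cycle and is lifted to the next degree. Only the
  homotopy identities in positive degrees are returned, as cohomology in degree \<open>n + 1\<close>
  sees nothing else.\<close>

lemma null_homotopy_exists:
  assumes P: "resolution R M P d e" and Q: "resolution R N Q d' e'"
    and \<psi>: "\<And>n. lin_map R (P n) (Q n) (\<psi> n)"
      "\<And>n x. x \<in> carrier (P (Suc n)) \<Longrightarrow> d' n (\<psi> (Suc n) x) = \<psi> n (d n x)"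
      "\<And>x. x \<in> carrier (P 0) \<Longrightarrow> e' (\<psi> 0 x) = \<zero>\<^bsub>N\<^esub>"
    and l: "\<And>n. lifts R (P n) (Q (Suc n)) (Q n) (d' n)"
  obtains s where "\<And>n. lin_map R (P n) (Q (Suc n)) (s n)"
    "\<And>n x. x \<in> carrier (P (Suc n)) \<Longrightarrow> d' (Suc n) (s (Suc n) x) = \<psi> (Suc n) x \<ominus>\<^bsub>Q (Suc n)\<^esub> s n (d n x)"
proof -
  interpret P: resolution R M P d e by fact
  interpret Q: resolution R N Q d' e' by fact
  have "\<psi> 0 x \<in> d' 0 ` carrier (Q (Suc 0))" if "x \<in> carrier (P 0)" for x
    using that \<psi>(3) by (simp add: Q.exact_0 lin_mapD(1)[OF \<psi>(1)])
  then obtain s0 where s0: "lin_map R (P 0) (Q (Suc 0)) s0" "\<And>x. x \<in> carrier (P 0) \<Longrightarrow> d' 0 (s0 x) = \<psi> 0 x"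
    using liftsE[OF l \<psi>(1)] by metis
  let ?ok = "\<lambda>n s. lin_map R (P n) (Q (Suc n)) s \<and>
    (\<forall>x\<in>carrier (P (Suc n)). \<psi> (Suc n) x \<ominus>\<^bsub>Q (Suc n)\<^esub> s (d n x) \<in> d' (Suc n) ` carrier (Q (Suc (Suc n))))"
  have lin: "lin_map R (P (Suc n)) (Q (Suc n)) (\<lambda>x. \<psi> (Suc n) x \<ominus>\<^bsub>Q (Suc n)\<^esub> s (d n x))"
    if "lin_map R (P n) (Q (Suc n)) s" for n s
    by (rule lin_map_diff[OF P.module_P Q.module_P \<psi>(1) lin_map_comp[OF P.lin_d that]])
  \<comment> \<open>The premise \<open>eq\<close> is the homotopy identity at a boundary, where any
    term from one degree lower has vanished because \<open>d\<close> squares to zero.\<close>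
  have im: "\<psi> (Suc n) x \<ominus>\<^bsub>Q (Suc n)\<^esub> s (d n x) \<in> d' (Suc n) ` carrier (Q (Suc (Suc n)))"
    if s: "lin_map R (P n) (Q (Suc n)) s" and x: "x \<in> carrier (P (Suc n))"
      and eq: "d' n (s (d n x)) = \<psi> n (d n x)" for n s x
  proof -
    interpret Qn: module R "Q n" by (rule Q.module_P)
    have "d' n (\<psi> (Suc n) x \<ominus>\<^bsub>Q (Suc n)\<^esub> s (d n x)) = \<zero>\<^bsub>Q n\<^esub>"
      using x by (subst lin_map_minus[OF Q.module_P Q.module_P Q.lin_d])
        (simp_all add: lin_mapD(1)[OF \<psi>(1)] lin_mapD(1)[OF s] P.d_closed \<psi>(2) eq Qn.minus_eq_zero_iff)
    then show ?thesis using lin_mapD(1)[OF lin[OF s] x] by (simp add: Q.exact_Suc)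
  qed
  have "\<exists>s. \<forall>n. ?ok n (s n) \<and>
      (\<forall>x\<in>carrier (P (Suc n)). d' (Suc n) (s (Suc n) x) = \<psi> (Suc n) x \<ominus>\<^bsub>Q (Suc n)\<^esub> s n (d n x))"
  proof (rule dependent_nat_choice)
    show "\<exists>s. ?ok 0 s" using s0 im[OF s0(1)] P.d_closed by blast
  next
    fix s n assume s: "?ok n s"
    then obtain t where t: "lin_map R (P (Suc n)) (Q (Suc (Suc n))) t"
      "\<And>x. x \<in> carrier (P (Suc n)) \<Longrightarrow> d' (Suc n) (t x) = \<psi> (Suc n) x \<ominus>\<^bsub>Q (Suc n)\<^esub> s (d n x)"
      using liftsE[OF l lin[of n s]] by metis
    have "d' (Suc n) (t (d (Suc n) x)) = \<psi> (Suc n) (d (Suc n) x)" if x: "x \<in> carrier (P (Suc (Suc n)))" for x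
    proof -
      interpret Qn: module R "Q (Suc n)" by (rule Q.module_P)
      have "s \<zero>\<^bsub>P n\<^esub> = \<zero>\<^bsub>Q (Suc n)\<^esub>" using s lin_map_zero[OF P.module_P Q.module_P] by blast
      then show ?thesis
        using x by (simp add: t P.d_closed P.d_d lin_mapD(1)[OF \<psi>(1)] a_minus_def)
    qed
    then show "\<exists>t. ?ok (Suc n) t \<and>
        (\<forall>x\<in>carrier (P (Suc n)). d' (Suc n) (t x) = \<psi> (Suc n) x \<ominus>\<^bsub>Q (Suc n)\<^esub> s (d n x))"
      using t im[OF t(1)] by blast
  qed
  then show ?thesis using that by metis
qed

text \<open>Index shift: \<open>n\<close> stands for the cohomology of \<open>Hom(P, T)\<close> in degree \<open>n + 1\<close>.\<close>

definition cohom_vanish ::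
  "('r, 'e) ring_scheme \<Rightarrow> (nat \<Rightarrow> ('r, 'p) module) \<Rightarrow> (nat \<Rightarrow> 'p \<Rightarrow> 'p) \<Rightarrow> ('r, 't, 'f) module_scheme \<Rightarrow> nat \<Rightarrow> bool"
  where "cohom_vanish R P d T n \<longleftrightarrow>
    (\<forall>h. lin_map R (P (Suc n)) T h \<and> (\<forall>x\<in>carrier (P (Suc (Suc n))). h (d (Suc n) x) = \<zero>\<^bsub>T\<^esub>)
      \<longrightarrow> (\<exists>k. lin_map R (P n) T k \<and> (\<forall>x\<in>carrier (P (Suc n)). h x = k (d n x))))"

lemma cohom_vanishE:
  assumes "cohom_vanish R P d T n" "lin_map R (P (Suc n)) T h"
    and "\<And>x. x \<in> carrier (P (Suc (Suc n))) \<Longrightarrow> h (d (Suc n) x) = \<zero>\<^bsub>T\<^esub>"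
  obtains k where "lin_map R (P n) T k" "\<And>x. x \<in> carrier (P (Suc n)) \<Longrightarrow> h x = k (d n x)"
  using assms unfolding cohom_vanish_def by blast

text \<open>A cocycle on \<open>P\<close> is pulled back along \<open>v\<close>, bounded over
  \<open>Q\<close>, and the bound is pulled back along \<open>u\<close>; the homotopy from
  \<open>v\<close> after \<open>u\<close> to the identity supplies the correction. As only vanishing
  is transferred, a homotopy on \<open>P\<close> alone suffices.\<close>

lemma cohom_vanish_transfer:
  assumes P: "resolution R M P d e" and Q: "resolution R M Q d' e'" and T: "module R T"
    and "lifts R (P 0) (Q 0) M e'" "\<And>n. lifts R (P (Suc n)) (Q (Suc n)) (Q n) (d' n)"
    and "lifts R (Q 0) (P 0) M e" "\<And>n. lifts R (Q (Suc n)) (P (Suc n)) (P n) (d n)"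
    and l: "\<And>n. lifts R (P n) (P (Suc n)) (P n) (d n)"
    and van: "cohom_vanish R Q d' T n"
  shows "cohom_vanish R P d T n"
  unfolding cohom_vanish_def
proof (intro allI impI)
  fix h assume h: "lin_map R (P (Suc n)) T h \<and> (\<forall>x\<in>carrier (P (Suc (Suc n))). h (d (Suc n) x) = \<zero>\<^bsub>T\<^esub>)"
  interpret P: resolution R M P d e by fact
  interpret Q: resolution R M Q d' e' by fact
  interpret T: module R T by fact
  obtain u where u: "\<And>n. lin_map R (P n) (Q n) (u n)"
    "\<And>x. x \<in> carrier (P 0) \<Longrightarrow> e' (u 0 x) = e x"
    "\<And>n x. x \<in> carrier (P (Suc n)) \<Longrightarrow> d' n (u (Suc n) x) = u n (d n x)"
  proof (rule chain_map_exists[OF P Q lin_map_id assms(4,5)], goal_cases)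
    case (1 s)
    from 1(2-) show thesis by (rule 1(1))
  qed
  obtain v where v: "\<And>n. lin_map R (Q n) (P n) (v n)"
    "\<And>x. x \<in> carrier (Q 0) \<Longrightarrow> e (v 0 x) = e' x"
    "\<And>n x. x \<in> carrier (Q (Suc n)) \<Longrightarrow> d n (v (Suc n) x) = v n (d' n x)"
  proof (rule chain_map_exists[OF Q P lin_map_id assms(6,7)], goal_cases)
    case (1 s)
    from 1(2-) show thesis by (rule 1(1))
  qed
  note uD = lin_mapD(1)[OF u(1)] and vD = lin_mapD(1)[OF v(1)]
  define \<psi> where "\<psi> n x = x \<ominus>\<^bsub>P n\<^esub> v n (u n x)" for n x
  have lin_\<psi>: "lin_map R (P n) (P n) (\<psi> n)" for n
    unfolding \<psi>_def by (rule lin_map_diff[OF P.module_P P.module_P lin_map_id lin_map_comp[OF u(1) v(1)]])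
  have \<psi>_d: "d n (\<psi> (Suc n) x) = \<psi> n (d n x)" if "x \<in> carrier (P (Suc n))" for n x
    unfolding \<psi>_def using that
    by (simp add: lin_map_minus[OF P.module_P P.module_P P.lin_d] uD vD v(3) u(3))
  have \<psi>_e: "e (\<psi> 0 x) = \<zero>\<^bsub>M\<^esub>" if "x \<in> carrier (P 0)" for x
  proof -
    interpret M: module R M by (rule P.module_M)
    show ?thesis unfolding \<psi>_def using that
      by (simp add: lin_map_minus[OF P.module_P P.module_M P.lin_aug] uD vD u v
          M.minus_eq_zero_iff lin_mapD(1)[OF P.lin_aug])
  qed
  obtain s where s: "\<And>n. lin_map R (P n) (P (Suc n)) (s n)"
    "\<And>n x. x \<in> carrier (P (Suc n)) \<Longrightarrow> d (Suc n) (s (Suc n) x) = \<psi> (Suc n) x \<ominus>\<^bsub>P (Suc n)\<^esub> s n (d n x)"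
  proof (rule null_homotopy_exists[OF P P, of \<psi>], goal_cases)
    case (5 s)
    from 5(2-) show thesis by (rule 5(1))
  qed (use lin_\<psi> \<psi>_d \<psi>_e l in blast)+
  note sD = lin_mapD(1)[OF s(1)]
  from h have hl: "lin_map R (P (Suc n)) T h" by simp
  have "lin_map R (Q (Suc n)) T (\<lambda>y. h (v (Suc n) y))" by (rule lin_map_comp[OF v(1) hl])
  moreover have "h (v (Suc n) (d' (Suc n) y)) = \<zero>\<^bsub>T\<^esub>" if "y \<in> carrier (Q (Suc (Suc n)))" for y
    using that h vD by (simp flip: v(3))
  ultimately obtain k where k: "lin_map R (Q n) T k"
    "\<And>y. y \<in> carrier (Q (Suc n)) \<Longrightarrow> h (v (Suc n) y) = k (d' n y)"
    using cohom_vanishE[OF van] by metis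
  \<comment> \<open>Applying \<open>h\<close> to the homotopy identity kills the term
    \<open>d (Suc n) (s (Suc n) x)\<close>, since \<open>h\<close> is a cocycle. What remains
    expresses \<open>h x\<close> through \<open>d n x\<close>.\<close>
  let ?k = "\<lambda>y. h (s n y) \<oplus>\<^bsub>T\<^esub> k (u n y)"
  have "lin_map R (P n) T ?k"
    by (rule lin_map_add[OF P.module_P T lin_map_comp[OF s(1) hl] lin_map_comp[OF u(1) k(1)]])
  moreover have "h x = ?k (d n x)" if x: "x \<in> carrier (P (Suc n))" for x
  proof -
    interpret Pn: module R "P (Suc n)" by (rule P.module_P)
    have c: "v (Suc n) (u (Suc n) x) \<in> carrier (P (Suc n))" "s n (d n x) \<in> carrier (P (Suc n))"
      using x by (simp_all add: uD vD sD P.d_closed)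
    have "h (d (Suc n) (s (Suc n) x)) = \<zero>\<^bsub>T\<^esub>" using h sD x by blast
    then have "h x \<ominus>\<^bsub>T\<^esub> h (v (Suc n) (u (Suc n) x)) \<ominus>\<^bsub>T\<^esub> h (s n (d n x)) = \<zero>\<^bsub>T\<^esub>"
      using x c by (simp add: s(2) \<psi>_def lin_map_minus[OF P.module_P T hl])
    then have eq: "h x \<ominus>\<^bsub>T\<^esub> h (v (Suc n) (u (Suc n) x)) = h (s n (d n x))"
      using x c lin_mapD(1)[OF hl] by (simp add: T.minus_eq_zero_iff)
    then have "h x = h (s n (d n x)) \<oplus>\<^bsub>T\<^esub> h (v (Suc n) (u (Suc n) x))"
      using x c lin_mapD(1)[OF hl] by (simp add: a_minus_def T.a_assoc T.l_neg flip: eq)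
    then show ?thesis using x by (simp add: k(2) uD u(3))
  qed
  ultimately show "\<exists>k. lin_map R (P n) T k \<and> (\<forall>x\<in>carrier (P (Suc n)). h x = k (d n x))" by blast
qed

subsection \<open>The vanishing of Ext\<close>

text \<open>A coset contains its representative, so \<open>z + B = B\<close> puts \<open>z\<close>
  in \<open>B\<close>; the converse is translation in a group. Cosets are written as images because
  this is the form in which \<open>quot_mod\<close> unfolds.\<close>

lemma (in abelian_group) cosets_trivial_iff:
  assumes B: "B \<subseteq> carrier G" and Z: "Z \<subseteq> carrier G" and zero: "\<zero> \<in> B" "\<zero> \<in> Z"
    and add: "\<And>x y. x \<in> B \<Longrightarrow> y \<in> B \<Longrightarrow> x \<oplus> y \<in> B" and minus: "\<And>x y. x \<in> B \<Longrightarrow> y \<in> B \<Longrightarrow> x \<ominus> y \<in> B"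
  shows "(\<lambda>z. (\<lambda>b. b \<oplus> z) ` B) ` Z = {B} \<longleftrightarrow> Z \<subseteq> B"
proof
  assume eq: "(\<lambda>z. (\<lambda>b. b \<oplus> z) ` B) ` Z = {B}"
  show "Z \<subseteq> B"
  proof
    fix z assume z: "z \<in> Z"
    then have "(\<lambda>b. b \<oplus> z) ` B \<in> {B}" unfolding eq[symmetric] by (rule imageI)
    then have "(\<lambda>b. b \<oplus> z) ` B = B" by simp
    moreover have "z \<in> (\<lambda>b. b \<oplus> z) ` B"
      using z Z zero(1) by (intro image_eqI[of _ _ \<zero>]) auto
    ultimately show "z \<in> B" by blast
  qed
next
  assume s: "Z \<subseteq> B"
  have "(\<lambda>b. b \<oplus> z) ` B = B" if "z \<in> Z" for z
  proof -
    have z: "z \<in> B" using that s by blast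
    have "x \<in> (\<lambda>b. b \<oplus> z) ` B" if x: "x \<in> B" for x
    proof (rule image_eqI)
      have "x \<in> carrier G" "z \<in> carrier G" using x z B by auto
      then show "x = (x \<ominus> z) \<oplus> z" by (simp add: a_minus_def a_assoc l_neg)
    qed (rule minus[OF x z])
    then show ?thesis using add[OF _ z] by (intro equalityI subsetI) auto
  qed
  then show "(\<lambda>z. (\<lambda>b. b \<oplus> z) ` B) ` Z = {B}" using zero(2) by (subst image_cong[OF refl]) auto
qed

context module begin

lemma resolution_res: "resolution R M (res_mod R M) (res_diff R M) (res_aug R M)"
proof (rule resolution.intro)
  show "module R (res_mod R M n)" for n unfolding res_mod_def by (rule R.free_module)
  show "x \<in> res_diff R M 0 ` carrier (res_mod R M (Suc 0)) \<longleftrightarrow> res_aug R M x = \<zero>\<^bsub>M\<^esub>"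
    if "x \<in> carrier (res_mod R M 0)" for x
    using that by (simp add: res_exact_0 a_kernel_def')
  show "x \<in> res_diff R M (Suc n) ` carrier (res_mod R M (Suc (Suc n))) \<longleftrightarrow> res_diff R M n x = \<zero>\<^bsub>res_mod R M n\<^esub>"
    if "x \<in> carrier (res_mod R M (Suc n))" for x n
    using that by (simp add: res_exact_Suc a_kernel_def')
qed (rule module_axioms res_aug_linear res_diff_linear res_aug_surj)+

text \<open>The definition of Ext is unfolded only here; afterwards everything is phrased with
  cochains as plain linear maps. Passing between the two sides means restricting functions to
  carriers and reading equations of extensional functions pointwise.\<close>

lemma zero_mod_Ext_iff:
  assumes N: "module R N"
  shows "zero_mod (Ext_mod R (Suc n) M N) \<longleftrightarrow> cohom_vanish R (res_mod R M) (res_diff R M) N n"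
proof -
  interpret F: resolution R M "res_mod R M" "res_diff R M" "res_aug R M" by (rule resolution_res)
  let ?C = "cochain_mod R M N" and ?Z = "cocycles R M N (Suc n)" and ?B = "coboundaries R M N (Suc n)"
  have mC: "module R (?C i)" for i
    unfolding cochain_mod_def by (rule Hom_module[OF F.module_P N])
  interpret C: module R "?C (Suc n)" by (rule mC)
  interpret N: module R N by fact
  have cobdry: "lin_map R (?C i) (?C (Suc i)) (cobdry R M i)" for i
  proof (rule lin_mapI)
    fix x assume "x \<in> carrier (?C i)"
    then show "cobdry R M i x \<in> carrier (?C (Suc i))"
      unfolding cobdry_def cochain_mod_def
      by (intro restrict_in_Hom F.module_P lin_map_comp[OF F.lin_d]) (simp add: Hom_mod_simps)
  qed (auto simp: cobdry_def cochain_mod_def Hom_mod_simps(3,4) F.d_closed fun_eq_iff)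
  have sub: "?B \<subseteq> carrier (?C (Suc n))" using lin_mapD(1)[OF cobdry] by auto
  have B_add: "x \<oplus>\<^bsub>?C (Suc n)\<^esub> y \<in> ?B" "x \<ominus>\<^bsub>?C (Suc n)\<^esub> y \<in> ?B" if "x \<in> ?B" "y \<in> ?B" for x y
  proof -
    interpret Cn: module R "?C n" by (rule mC)
    obtain a b where "x = cobdry R M n a" "y = cobdry R M n b" "a \<in> carrier (?C n)" "b \<in> carrier (?C n)"
      using \<open>x \<in> ?B\<close> \<open>y \<in> ?B\<close> by auto
    then show "x \<oplus>\<^bsub>?C (Suc n)\<^esub> y \<in> ?B" "x \<ominus>\<^bsub>?C (Suc n)\<^esub> y \<in> ?B"
      by (auto simp flip: lin_mapD(2)[OF cobdry] lin_map_minus[OF mC mC cobdry])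
  qed
  have B_zero: "\<zero>\<^bsub>?C (Suc n)\<^esub> \<in> ?B"
  proof -
    interpret Cn: module R "?C n" by (rule mC)
    show ?thesis using lin_map_zero[OF mC mC cobdry, of n] Cn.zero_closed
      by (auto intro: image_eqI[OF sym])
  qed
  have Z_zero: "\<zero>\<^bsub>?C (Suc n)\<^esub> \<in> ?Z"
    unfolding cocycles_def using lin_map_zero[OF mC mC cobdry] by simp
  let ?cos = "\<lambda>z. (\<lambda>b. b \<oplus>\<^bsub>?C (Suc n)\<^esub> z) ` ?B"
  have "zero_mod (Ext_mod R (Suc n) M N) \<longleftrightarrow> ?cos ` ?Z = {?B}"
    unfolding zero_mod_def Ext_mod_def quot_mod_def A_RCOSETS_defs
    by (simp add: RCOSETS_def r_coset_def UNION_singleton_eq_range del: coboundaries.simps)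
  also have "\<dots> \<longleftrightarrow> ?Z \<subseteq> ?B"
    by (rule C.cosets_trivial_iff[OF sub _ B_zero Z_zero B_add]) (auto simp: cocycles_def)
  also have "\<dots> \<longleftrightarrow> cohom_vanish R (res_mod R M) (res_diff R M) N n"
  proof
    assume s: "?Z \<subseteq> ?B"
    show "cohom_vanish R (res_mod R M) (res_diff R M) N n"
      unfolding cohom_vanish_def
    proof (intro allI impI)
      fix h assume h: "lin_map R (res_mod R M (Suc n)) N h \<and>
        (\<forall>x\<in>carrier (res_mod R M (Suc (Suc n))). h (res_diff R M (Suc n) x) = \<zero>\<^bsub>N\<^esub>)"
      let ?h = "restrict h (carrier (res_mod R M (Suc n)))"
      have "?h \<in> ?Z"
        using h restrict_in_Hom[OF F.module_P, of "Suc n" N h] F.d_closed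
        by (auto simp: cocycles_def cochain_mod_def cobdry_def Hom_mod_simps(2) fun_eq_iff)
      then obtain k where k: "k \<in> carrier (?C n)" "?h = cobdry R M n k" using s by auto
      have "h x = k (res_diff R M n x)" if "x \<in> carrier (res_mod R M (Suc n))" for x
        using that fun_cong[OF k(2), of x] by (simp add: cobdry_def)
      then show "\<exists>k. lin_map R (res_mod R M n) N k \<and>
          (\<forall>x\<in>carrier (res_mod R M (Suc n)). h x = k (res_diff R M n x))"
        using k(1) by (auto simp: cochain_mod_def Hom_mod_simps)
    qed
  next
    assume v: "cohom_vanish R (res_mod R M) (res_diff R M) N n"
    show "?Z \<subseteq> ?B"
    proof
      fix z assume "z \<in> ?Z"
      then have z: "z \<in> carrier (?C (Suc n))" "cobdry R M (Suc n) z = \<zero>\<^bsub>?C (Suc (Suc n))\<^esub>"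
        by (auto simp: cocycles_def)
      have "z (res_diff R M (Suc n) x) = \<zero>\<^bsub>N\<^esub>" if "x \<in> carrier (res_mod R M (Suc (Suc n)))" for x
        using that fun_cong[OF z(2), of x] by (simp add: cobdry_def cochain_mod_def Hom_mod_simps(2))
      moreover have "lin_map R (res_mod R M (Suc n)) N z"
        using z(1) by (simp add: cochain_mod_def Hom_mod_simps)
      ultimately obtain k where k: "lin_map R (res_mod R M n) N k"
        "\<And>x. x \<in> carrier (res_mod R M (Suc n)) \<Longrightarrow> z x = k (res_diff R M n x)"
        using cohom_vanishE[OF v] by metis
      let ?k = "restrict k (carrier (res_mod R M n))"
      have kC: "?k \<in> carrier (?C n)" unfolding cochain_mod_def by (rule restrict_in_Hom[OF F.module_P k(1)])
      have "z = cobdry R M n ?k"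
        using z(1) lin_mapD(1)[OF cobdry kC] unfolding cochain_mod_def
        by (rule Hom_mod_eqI) (simp add: cobdry_def k(2) F.d_closed)
      then show "z \<in> ?B" using kC by simp
    qed
  qed
  finally show ?thesis .
qed

end


subsection \<open>Products and the mapping cone\<close>

definition prod_mod ::
  "('r, 'a, 'f) module_scheme \<Rightarrow> ('r, 'b, 'g) module_scheme \<Rightarrow> ('r, 'a \<times> 'b) module"
  where "prod_mod M N =
    \<lparr> carrier = carrier M \<times> carrier N,
      monoid.mult = undefined, one = undefined,
      ring.zero = (\<zero>\<^bsub>M\<^esub>, \<zero>\<^bsub>N\<^esub>),
      add = (\<lambda>p q. (fst p \<oplus>\<^bsub>M\<^esub> fst q, snd p \<oplus>\<^bsub>N\<^esub> snd q)),
      smult = (\<lambda>r p. (r \<odot>\<^bsub>M\<^esub> fst p, r \<odot>\<^bsub>N\<^esub> snd p)) \<rparr>"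

lemma prod_mod_simps:
  "carrier (prod_mod M N) = carrier M \<times> carrier N"
  "\<zero>\<^bsub>prod_mod M N\<^esub> = (\<zero>\<^bsub>M\<^esub>, \<zero>\<^bsub>N\<^esub>)"
  "p \<oplus>\<^bsub>prod_mod M N\<^esub> q = (fst p \<oplus>\<^bsub>M\<^esub> fst q, snd p \<oplus>\<^bsub>N\<^esub> snd q)"
  "r \<odot>\<^bsub>prod_mod M N\<^esub> p = (r \<odot>\<^bsub>M\<^esub> fst p, r \<odot>\<^bsub>N\<^esub> snd p)"
  by (auto simp: prod_mod_def)

lemma prod_module:
  assumes "module R M" "module R N"
  shows "module R (prod_mod M N)"
proof -
  interpret M: module R M by fact
  interpret N: module R N by fact
  show ?thesis
  proof (rule moduleI)
    show "abelian_group (prod_mod M N)"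
    proof (rule abelian_groupI)
      fix p assume "p \<in> carrier (prod_mod M N)"
      then show "\<exists>q\<in>carrier (prod_mod M N). q \<oplus>\<^bsub>prod_mod M N\<^esub> p = \<zero>\<^bsub>prod_mod M N\<^esub>"
        by (intro bexI[of _ "(\<ominus>\<^bsub>M\<^esub> fst p, \<ominus>\<^bsub>N\<^esub> snd p)"]) (auto simp: prod_mod_simps M.l_neg N.l_neg)
    next
      fix p q assume "p \<in> carrier (prod_mod M N)" "q \<in> carrier (prod_mod M N)"
      then show "p \<oplus>\<^bsub>prod_mod M N\<^esub> q = q \<oplus>\<^bsub>prod_mod M N\<^esub> p"
        by (auto simp: prod_mod_simps M.a_comm N.a_comm)
    qed (auto simp: prod_mod_simps M.a_assoc N.a_assoc)
  qed (auto simp: prod_mod_simps M.R.is_cring M.smult_l_distr N.smult_l_distr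
      M.smult_r_distr N.smult_r_distr M.smult_assoc1 N.smult_assoc1)
qed

lemma lin_map_fst: "lin_map R (prod_mod M N) M fst"
  and lin_map_snd: "lin_map R (prod_mod M N) N snd"
  by (auto simp: lin_map_def prod_mod_simps)

lemma lin_map_pair:
  "lin_map R P M h \<Longrightarrow> lin_map R P N k \<Longrightarrow> lin_map R P (prod_mod M N) (\<lambda>x. (h x, k x))"
  by (auto simp: lin_map_def prod_mod_simps)

lemma lin_map_inl: "module R N \<Longrightarrow> lin_map R M (prod_mod M N) (\<lambda>x. (x, \<zero>\<^bsub>N\<^esub>))"
  by (rule lin_map_pair[OF lin_map_id lin_map_const_zero])

lemma lin_map_inr: "module R M \<Longrightarrow> lin_map R N (prod_mod M N) (\<lambda>x. (\<zero>\<^bsub>M\<^esub>, x))"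
  by (rule lin_map_pair[OF lin_map_const_zero lin_map_id])

lemma lin_map_split:
  assumes "module R M" "module R N" "lin_map R (prod_mod M N) X u" "x \<in> carrier M" "y \<in> carrier N"
  shows "u (x, y) = u (x, \<zero>\<^bsub>N\<^esub>) \<oplus>\<^bsub>X\<^esub> u (\<zero>\<^bsub>M\<^esub>, y)"
proof -
  interpret M: module R M by fact
  interpret N: module R N by fact
  show ?thesis
    using assms(4,5) lin_mapD(2)[OF assms(3), of "(x, \<zero>\<^bsub>N\<^esub>)" "(\<zero>\<^bsub>M\<^esub>, y)"] by (simp add: prod_mod_simps)
qed

lemma lin_map_case_prod:
  assumes "module R M" "module R N" "module R X" "lin_map R M X h" "lin_map R N X k"
  shows "lin_map R (prod_mod M N) X (\<lambda>p. h (fst p) \<oplus>\<^bsub>X\<^esub> k (snd p))"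
  by (rule lin_map_add[OF prod_module[OF assms(1,2)] assms(3)
        lin_map_comp[OF lin_map_fst assms(4)] lin_map_comp[OF lin_map_snd assms(5)]])

lemma lifts_prod:
  assumes "module R M" "module R N" "module R X" "module R Y" "lin_map R X Y d"
    and M: "lifts R M X Y d" and N: "lifts R N X Y d"
  shows "lifts R (prod_mod M N) X Y d"
  unfolding lifts_def
proof (intro allI impI)
  fix u assume u: "lin_map R (prod_mod M N) Y u \<and> u ` carrier (prod_mod M N) \<subseteq> d ` carrier X"
  then have ul: "lin_map R (prod_mod M N) Y u" by simp
  interpret M: module R M by fact
  interpret N: module R N by fact
  have im: "u (x, y) \<in> d ` carrier X" if "x \<in> carrier M" "y \<in> carrier N" for x y
    using u that by (simp add: prod_mod_simps image_subset_iff)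
  obtain v where v: "lin_map R M X v" "\<And>x. x \<in> carrier M \<Longrightarrow> d (v x) = u (x, \<zero>\<^bsub>N\<^esub>)"
    using liftsE[OF M lin_map_comp[OF lin_map_inl[OF assms(2)] ul]] im by (metis N.zero_closed)
  obtain w where w: "lin_map R N X w" "\<And>x. x \<in> carrier N \<Longrightarrow> d (w x) = u (\<zero>\<^bsub>M\<^esub>, x)"
    using liftsE[OF N lin_map_comp[OF lin_map_inr[OF assms(1)] ul]] im by (metis M.zero_closed)
  have "d (v (fst p) \<oplus>\<^bsub>X\<^esub> w (snd p)) = u p" if "p \<in> carrier (prod_mod M N)" for p
    using that lin_map_split[OF assms(1,2) ul, of "fst p" "snd p"]
    by (auto simp: prod_mod_simps lin_mapD(2)[OF assms(5)] lin_mapD(1)[OF v(1)] lin_mapD(1)[OF w(1)] v(2) w(2))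
  then show "\<exists>v. lin_map R (prod_mod M N) X v \<and> (\<forall>p\<in>carrier (prod_mod M N). d (v p) = u p)"
    using lin_map_case_prod[OF assms(1-3) v(1) w(1)] by blast
qed

lemma zero_submodule_module:
  assumes "module R M"
  shows "module R (M\<lparr>carrier := {\<zero>\<^bsub>M\<^esub>}\<rparr>)"
proof -
  interpret M: module R M by fact
  have "submodule {\<zero>\<^bsub>M\<^esub>} R M" by (rule M.submoduleI) auto
  then show ?thesis using assms by (rule submodule.submodule_is_module)
qed

text \<open>The zero map lifts every map out of a zero module, since such a map is zero. This covers
  the bottom degree of \<open>shift\<close>.\<close>

lemma lifts_zero:
  assumes "module R M" "module R X" "module R Y" "lin_map R X Y d"
  shows "lifts R (M\<lparr>carrier := {\<zero>\<^bsub>M\<^esub>}\<rparr>) X Y d"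
  unfolding lifts_def
  using lin_map_const_zero[OF assms(2)] lin_map_zero[OF zero_submodule_module[OF assms(1)] assms(3)]
    lin_map_zero[OF assms(2-4)] by fastforce

lemma short_exactD:
  assumes "short_exact R A f B g C"
  shows "lin_map R A B f" "lin_map R B C g" "inj_on f (carrier A)" "g ` carrier B = carrier C"
    and "\<And>y. y \<in> carrier B \<Longrightarrow> g y = \<zero>\<^bsub>C\<^esub> \<longleftrightarrow> y \<in> f ` carrier A"
    and "\<And>x. x \<in> carrier A \<Longrightarrow> g (f x) = \<zero>\<^bsub>C\<^esub>"
  using assms unfolding short_exact_def a_kernel_def' by auto

locale mapping_cone =
  A: resolution R A PA dA eA + B: resolution R B PB dB eB
  for R :: "('r, 'e) ring_scheme"
    and A :: "('r, 'a, 'f) module_scheme" and PA :: "nat \<Rightarrow> ('r, 'p) module" and dA eA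
    and B :: "('r, 'b, 'g) module_scheme" and PB :: "nat \<Rightarrow> ('r, 'q) module" and dB eB +
  fixes C :: "('r, 'c, 'h) module_scheme" and f :: "'a \<Rightarrow> 'b" and g :: "'b \<Rightarrow> 'c" and \<alpha> :: "nat \<Rightarrow> 'p \<Rightarrow> 'q"
  assumes module_C: "module R C"
    and ses: "short_exact R A f B g C"
    and lin_\<alpha>: "\<And>n. lin_map R (PA n) (PB n) (\<alpha> n)"
    and aug_\<alpha>: "\<And>x. x \<in> carrier (PA 0) \<Longrightarrow> eB (\<alpha> 0 x) = f (eA x)"
    and d_\<alpha>: "\<And>n x. x \<in> carrier (PA (Suc n)) \<Longrightarrow> dB n (\<alpha> (Suc n) x) = \<alpha> n (dA n x)"
begin

text \<open>Degree \<open>0\<close> is a zero module, so that all degrees have the same type.\<close>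

definition shift :: "nat \<Rightarrow> ('r, 'p) module"
  where "shift n = (case n of 0 \<Rightarrow> (PA 0)\<lparr>carrier := {\<zero>\<^bsub>PA 0\<^esub>}\<rparr> | Suc m \<Rightarrow> PA m)"

definition cone :: "nat \<Rightarrow> ('r, 'q \<times> 'p) module"
  where "cone n = prod_mod (PB n) (shift n)"

text \<open>The differential of the mapping cone with \<open>PA\<close> shifted up by one degree.
  The minus sign makes the two contributions of \<open>\<alpha>\<close> to its square cancel; in the
  case \<open>n = 0\<close> the second component falls into the zero module
  \<open>shift 0\<close>.\<close>

definition cone_d :: "nat \<Rightarrow> 'q \<times> 'p \<Rightarrow> 'q \<times> 'p"
  where "cone_d n p = (dB n (fst p) \<oplus>\<^bsub>PB n\<^esub> \<alpha> n (snd p),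
    case n of 0 \<Rightarrow> \<zero>\<^bsub>PA 0\<^esub> | Suc m \<Rightarrow> \<ominus>\<^bsub>PA m\<^esub> dA m (snd p))"

definition cone_aug :: "'q \<times> 'p \<Rightarrow> 'c"
  where "cone_aug p = g (eB (fst p))"

lemma shift_simps [simp]: "shift 0 = (PA 0)\<lparr>carrier := {\<zero>\<^bsub>PA 0\<^esub>}\<rparr>" "shift (Suc n) = PA n"
  by (simp_all add: shift_def)

lemma cone_d_simps:
  "cone_d 0 (b, a) = (dB 0 b \<oplus>\<^bsub>PB 0\<^esub> \<alpha> 0 a, \<zero>\<^bsub>PA 0\<^esub>)"
  "cone_d (Suc n) (b, a) = (dB (Suc n) b \<oplus>\<^bsub>PB (Suc n)\<^esub> \<alpha> (Suc n) a, \<ominus>\<^bsub>PA n\<^esub> dA n a)"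
  by (simp_all add: cone_d_def)

lemma module_shift: "module R (shift n)"
  by (cases n) (auto intro: A.module_P zero_submodule_module)

lemma module_cone: "module R (cone n)"
  unfolding cone_def by (rule prod_module[OF B.module_P module_shift])

lemma carrier_cone: "carrier (cone n) = carrier (PB n) \<times> carrier (shift n)"
  by (simp add: cone_def prod_mod_simps)

lemma lin_cone_d: "lin_map R (cone (Suc n)) (cone n) (cone_d n)"
proof -
  have 1: "lin_map R (cone (Suc n)) (PB n) (\<lambda>p. dB n (fst p) \<oplus>\<^bsub>PB n\<^esub> \<alpha> n (snd p))"
    unfolding cone_def shift_simps
    by (rule lin_map_case_prod[OF B.module_P A.module_P B.module_P B.lin_d lin_\<alpha>])
  have 2: "lin_map R (cone (Suc n)) (shift n) (\<lambda>p. case n of 0 \<Rightarrow> \<zero>\<^bsub>PA 0\<^esub> | Suc m \<Rightarrow> \<ominus>\<^bsub>PA m\<^esub> dA m (snd p))"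
  proof (cases n)
    case 0
    then show ?thesis using lin_map_const_zero[OF module_shift[of 0]] by simp
  next
    case (Suc m)
    have "lin_map R (cone (Suc n)) (PA m) (\<lambda>p. \<ominus>\<^bsub>PA m\<^esub> dA m (snd p))"
      unfolding Suc cone_def shift_simps
      by (rule lin_map_neg_map[OF prod_module[OF B.module_P A.module_P] A.module_P
            lin_map_comp[OF lin_map_snd A.lin_d]])
    then show ?thesis using Suc by simp
  qed
  have "cone_d n = (\<lambda>p. (dB n (fst p) \<oplus>\<^bsub>PB n\<^esub> \<alpha> n (snd p), case n of 0 \<Rightarrow> \<zero>\<^bsub>PA 0\<^esub> | Suc m \<Rightarrow> \<ominus>\<^bsub>PA m\<^esub> dA m (snd p)))"
    by (simp add: cone_d_def fun_eq_iff)
  then show ?thesis using lin_map_pair[OF 1 2] unfolding cone_def[of n] by simp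
qed

lemma lin_cone_aug: "lin_map R (cone 0) C cone_aug"
proof -
  have "lin_map R (cone 0) C (\<lambda>p. g (eB (fst p)))"
    unfolding cone_def using lin_map_comp[OF lin_map_comp[OF lin_map_fst B.lin_aug] short_exactD(2)[OF ses]] .
  then show ?thesis by (simp add: cone_aug_def[abs_def])
qed

text \<open>The common end of the exactness arguments: once the second component of a cycle is
  realised by some \<open>a\<close>, only the first component is left, and it may be corrected by a
  boundary of \<open>PB\<close>.\<close>

lemma in_image_cone_d:
  assumes b: "b \<in> carrier (PB n)" and a: "a \<in> carrier (PA n)"
    and b': "b \<ominus>\<^bsub>PB n\<^esub> \<alpha> n a \<in> dB n ` carrier (PB (Suc n))"
    and p: "p = (b, case n of 0 \<Rightarrow> \<zero>\<^bsub>PA 0\<^esub> | Suc m \<Rightarrow> \<ominus>\<^bsub>PA m\<^esub> dA m a)"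
  shows "p \<in> cone_d n ` carrier (cone (Suc n))"
proof -
  interpret Bn: module R "PB n" by (rule B.module_P)
  obtain c where c: "c \<in> carrier (PB (Suc n))" "dB n c = b \<ominus>\<^bsub>PB n\<^esub> \<alpha> n a" using b' by auto
  have "dB n c \<oplus>\<^bsub>PB n\<^esub> \<alpha> n a = b"
    using b a lin_mapD(1)[OF lin_\<alpha>] by (simp add: c a_minus_def Bn.a_assoc Bn.l_neg)
  then show ?thesis
    using c a by (intro image_eqI[of _ _ "(c, a)"]) (auto simp: cone_d_def carrier_cone p split: nat.split)
qed

text \<open>Besides exactness of the two given resolutions, degree zero uses exactness at
  \<open>B\<close>, degree one uses injectivity of \<open>f\<close>, and the augmentation is onto
  because \<open>g\<close> is.\<close>

sublocale cone: resolution R C cone cone_d cone_aug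
proof (rule resolution.intro)
  interpret A0: module R A by (rule A.module_M)
  interpret B0: module R B by (rule B.module_M)
  note f = short_exactD(1)[OF ses] and g = short_exactD(2)[OF ses]
  show "cone_aug ` carrier (cone 0) = carrier C"
  proof -
    have "cone_aug ` carrier (cone 0) = g ` eB ` carrier (PB 0)"
      by (force simp: cone_aug_def carrier_cone image_def)
    then show ?thesis by (simp add: B.aug_surj short_exactD(4)[OF ses])
  qed
  show "p \<in> cone_d 0 ` carrier (cone (Suc 0)) \<longleftrightarrow> cone_aug p = \<zero>\<^bsub>C\<^esub>" if p: "p \<in> carrier (cone 0)" for p
  proof
    assume "p \<in> cone_d 0 ` carrier (cone (Suc 0))"
    then obtain b a where ba: "p = cone_d 0 (b, a)" "b \<in> carrier (PB (Suc 0))" "a \<in> carrier (PA 0)"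
      by (auto simp: carrier_cone)
    then show "cone_aug p = \<zero>\<^bsub>C\<^esub>"
      by (simp add: cone_d_simps cone_aug_def lin_mapD(2)[OF B.lin_aug] B.d_closed lin_mapD(1)[OF lin_\<alpha>]
          B.aug_d aug_\<alpha> lin_mapD(1)[OF A.lin_aug] lin_mapD(1)[OF f] short_exactD(6)[OF ses])
  next
    assume e: "cone_aug p = \<zero>\<^bsub>C\<^esub>"
    obtain b where b: "p = (b, \<zero>\<^bsub>PA 0\<^esub>)" "b \<in> carrier (PB 0)" using p by (auto simp: carrier_cone)
    have "eB b \<in> f ` carrier A"
      using e b short_exactD(5)[OF ses lin_mapD(1)[OF B.lin_aug]] by (simp add: cone_aug_def)
    then obtain a where a: "a \<in> carrier (PA 0)" "eB b = f (eA a)"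
      using A.aug_surj by (metis imageE image_eqI)
    have c: "\<alpha> 0 a \<in> carrier (PB 0)" using a lin_mapD(1)[OF lin_\<alpha>] by blast
    interpret P0: module R "PB 0" by (rule B.module_P)
    have "eB (b \<ominus>\<^bsub>PB 0\<^esub> \<alpha> 0 a) = \<zero>\<^bsub>B\<^esub>"
      using a b c lin_mapD(1)[OF B.lin_aug] lin_mapD(1)[OF f] lin_mapD(1)[OF A.lin_aug]
      by (simp add: lin_map_minus[OF B.module_P B.module_M B.lin_aug] aug_\<alpha> B0.minus_eq_zero_iff)
    then have "b \<ominus>\<^bsub>PB 0\<^esub> \<alpha> 0 a \<in> dB 0 ` carrier (PB (Suc 0))"
      using b c by (simp add: B.exact_0)
    then show "p \<in> cone_d 0 ` carrier (cone (Suc 0))"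
      by (rule in_image_cone_d[OF b(2) a(1)]) (simp add: b)
  qed
  show "p \<in> cone_d (Suc n) ` carrier (cone (Suc (Suc n))) \<longleftrightarrow> cone_d n p = \<zero>\<^bsub>cone n\<^esub>"
    if p: "p \<in> carrier (cone (Suc n))" for p n
  proof -
    interpret An: module R "PA n" by (rule A.module_P)
    interpret Bn: module R "PB n" by (rule B.module_P)
    interpret As: module R "PA (Suc n)" by (rule A.module_P)
    interpret Bs: module R "PB (Suc n)" by (rule B.module_P)
    have neg: "\<alpha> n (\<ominus>\<^bsub>PA n\<^esub> a) = \<ominus>\<^bsub>PB n\<^esub> \<alpha> n a" if "a \<in> carrier (PA n)" for a
      by (rule lin_map_neg[OF A.module_P B.module_P lin_\<alpha> that])
    show ?thesis
    proof
      assume "p \<in> cone_d (Suc n) ` carrier (cone (Suc (Suc n)))"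
      then obtain b a where ba: "p = cone_d (Suc n) (b, a)" "b \<in> carrier (PB (Suc (Suc n)))" "a \<in> carrier (PA (Suc n))"
        by (auto simp: carrier_cone)
      have "\<ominus>\<^bsub>PA m\<^esub> dA m (\<ominus>\<^bsub>PA (Suc m)\<^esub> dA (Suc m) a) = \<zero>\<^bsub>PA m\<^esub>" if "n = Suc m" for m
      proof -
        interpret Am: module R "PA m" by (rule A.module_P)
        show ?thesis
          using ba(3) that by (simp add: lin_map_neg[OF A.module_P A.module_P A.lin_d] A.d_closed A.d_d)
      qed
      moreover have "dB n (dB (Suc n) b \<oplus>\<^bsub>PB (Suc n)\<^esub> \<alpha> (Suc n) a) \<oplus>\<^bsub>PB n\<^esub> \<alpha> n (\<ominus>\<^bsub>PA n\<^esub> dA n a) = \<zero>\<^bsub>PB n\<^esub>"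
        using ba by (simp add: lin_mapD(2)[OF B.lin_d] B.d_closed B.d_d d_\<alpha> neg
            A.d_closed lin_mapD(1)[OF lin_\<alpha>] Bn.r_neg)
      ultimately show "cone_d n p = \<zero>\<^bsub>cone n\<^esub>"
        using ba by (cases n) (simp_all add: cone_d_def cone_def prod_mod_simps)
    next
      assume z: "cone_d n p = \<zero>\<^bsub>cone n\<^esub>"
      obtain b a where ba: "p = (b, a)" "b \<in> carrier (PB (Suc n))" "a \<in> carrier (PA n)"
        using p by (auto simp: carrier_cone)
      have eq: "dB n b \<oplus>\<^bsub>PB n\<^esub> \<alpha> n a = \<zero>\<^bsub>PB n\<^esub>" using z ba by (simp add: cone_d_def cone_def prod_mod_simps)
      \<comment> \<open>In degree one this is where injectivity of \<open>f\<close> is used; in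
        higher degrees the second component of \<open>z\<close> already says that \<open>a\<close>
        is a cycle.\<close>
      have "a \<in> dA n ` carrier (PA (Suc n))"
      proof (cases n)
        case 0
        have "eB (dB 0 b \<oplus>\<^bsub>PB 0\<^esub> \<alpha> 0 a) = \<zero>\<^bsub>B\<^esub>"
          using eq 0 lin_map_zero[OF B.module_P B.module_M B.lin_aug] by simp
        then have "f (eA a) = \<zero>\<^bsub>B\<^esub>"
          using ba 0 lin_mapD(1)[OF f] lin_mapD(1)[OF A.lin_aug]
          by (simp add: lin_mapD(2)[OF B.lin_aug] B.d_closed lin_mapD(1)[OF lin_\<alpha>] B.aug_d aug_\<alpha>)
        then have "f (eA a) = f \<zero>\<^bsub>A\<^esub>" by (simp add: lin_map_zero[OF A.module_M B.module_M f])
        then have "eA a = \<zero>\<^bsub>A\<^esub>"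
          using short_exactD(3)[OF ses] ba 0 lin_mapD(1)[OF A.lin_aug] by (simp add: inj_on_eq_iff)
        then show ?thesis using ba 0 by (simp add: A.exact_0)
      next
        case (Suc m)
        interpret Am: module R "PA m" by (rule A.module_P)
        have "\<ominus>\<^bsub>PA m\<^esub> dA m a = \<zero>\<^bsub>PA m\<^esub>" using z ba Suc by (simp add: cone_d_def cone_def prod_mod_simps)
        then have "dA m a = \<zero>\<^bsub>PA m\<^esub>"
          using ba Suc A.d_closed[of a m] by (metis Am.minus_minus Am.a_inv_zero)
        then show ?thesis using ba Suc by (simp add: A.exact_Suc)
      qed
      then obtain c where c: "c \<in> carrier (PA (Suc n))" "a = dA n c" by auto
      \<comment> \<open>The minus sign in \<open>cone_d\<close> requires the negative of
        \<open>c\<close> as second component of the preimage.\<close>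
      let ?c = "\<ominus>\<^bsub>PA (Suc n)\<^esub> c"
      have cc: "\<alpha> (Suc n) c \<in> carrier (PB (Suc n))" by (rule lin_mapD(1)[OF lin_\<alpha> c(1)])
      have eq2: "b \<ominus>\<^bsub>PB (Suc n)\<^esub> \<alpha> (Suc n) ?c = b \<oplus>\<^bsub>PB (Suc n)\<^esub> \<alpha> (Suc n) c"
        using c cc by (simp add: a_minus_def lin_map_neg[OF A.module_P B.module_P lin_\<alpha>])
      have "dB n (b \<oplus>\<^bsub>PB (Suc n)\<^esub> \<alpha> (Suc n) c) = \<zero>\<^bsub>PB n\<^esub>"
        using ba c cc eq by (simp add: lin_mapD(2)[OF B.lin_d] d_\<alpha>)
      then have "b \<ominus>\<^bsub>PB (Suc n)\<^esub> \<alpha> (Suc n) ?c \<in> dB (Suc n) ` carrier (PB (Suc (Suc n)))"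
        unfolding eq2 using ba cc by (simp add: B.exact_Suc)
      moreover have "\<ominus>\<^bsub>PA n\<^esub> dA n ?c = a"
        using c A.d_closed[OF c(1)] by (simp add: lin_map_neg[OF A.module_P A.module_P A.lin_d])
      ultimately show "p \<in> cone_d (Suc n) ` carrier (cone (Suc (Suc n)))"
        using ba(2) c by (intro in_image_cone_d[of b _ ?c]) (simp_all add: ba)
    qed
  qed
qed (rule module_C module_cone lin_cone_d lin_cone_aug)+

lemma lifts_cone:
  assumes "module R X" "module R Y" "lin_map R X Y d"
    and "\<And>n. lifts R (PA n) X Y d" "\<And>n. lifts R (PB n) X Y d"
  shows "lifts R (cone n) X Y d"
proof -
  have "lifts R (shift n) X Y d"
    by (cases n) (simp_all add: assms lifts_zero A.module_P)
  then show ?thesis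
    unfolding cone_def using assms by (intro lifts_prod B.module_P module_shift)
qed

lemma lin_cone_inl: "lin_map R (PB n) (cone n) (\<lambda>x. (x, \<zero>\<^bsub>shift n\<^esub>))"
  unfolding cone_def by (rule lin_map_inl[OF module_shift])

lemma lin_cone_inr: "lin_map R (PA n) (cone (Suc n)) (\<lambda>x. (\<zero>\<^bsub>PB (Suc n)\<^esub>, x))"
  unfolding cone_def shift_simps by (rule lin_map_inr[OF B.module_P])

lemma lin_cone_case:
  assumes "module R T" "lin_map R (PB (Suc n)) T h" "lin_map R (PA n) T k"
  shows "lin_map R (cone (Suc n)) T (\<lambda>p. h (fst p) \<oplus>\<^bsub>T\<^esub> k (snd p))"
  unfolding cone_def shift_simps by (rule lin_map_case_prod[OF B.module_P A.module_P assms])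

section \<open>Fragments of the long exact sequence for Hom into \<open>T\<close>, computed on the
  cone\<close>

context
  fixes T :: "('r, 't, 'i) module_scheme"
  assumes T: "module R T"
begin

interpretation T: module R T by (rule T)

text \<open>Exactness at \<open>Ext(B, T)\<close> in degree \<open>n + 1\<close>. If
  \<open>h\<close> is a cocycle on \<open>PB\<close> and \<open>k\<close> bounds its pullback along
  \<open>\<alpha>\<close>, then \<open>h\<close> and \<open>k\<close> together form a cocycle on the
  cone; a bound for it, restricted to \<open>PB\<close>, bounds \<open>h\<close>.\<close>

lemma cohom_vanish_middle:
  assumes vA: "cohom_vanish R PA dA T n" and vC: "cohom_vanish R cone cone_d T n"
  shows "cohom_vanish R PB dB T n"
  unfolding cohom_vanish_def
proof (intro allI impI)
  fix h assume "lin_map R (PB (Suc n)) T h \<and> (\<forall>x\<in>carrier (PB (Suc (Suc n))). h (dB (Suc n) x) = \<zero>\<^bsub>T\<^esub>)"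
  then have h: "lin_map R (PB (Suc n)) T h" "\<And>x. x \<in> carrier (PB (Suc (Suc n))) \<Longrightarrow> h (dB (Suc n) x) = \<zero>\<^bsub>T\<^esub>"
    by auto
  interpret As: module R "PA (Suc n)" by (rule A.module_P)
  interpret An: module R "PA n" by (rule A.module_P)
  obtain k where k: "lin_map R (PA n) T k" "\<And>x. x \<in> carrier (PA (Suc n)) \<Longrightarrow> h (\<alpha> (Suc n) x) = k (dA n x)"
    using cohom_vanishE[OF vA lin_map_comp[OF lin_\<alpha> h(1)]] h(2) lin_mapD(1)[OF lin_\<alpha>] by (metis d_\<alpha>)
  let ?H = "\<lambda>p. h (fst p) \<oplus>\<^bsub>T\<^esub> k (snd p)"
  have "?H (cone_d (Suc n) p) = \<zero>\<^bsub>T\<^esub>" if "p \<in> carrier (cone (Suc (Suc n)))" for p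
    using that by (auto simp: carrier_cone cone_d_simps lin_mapD(2)[OF h(1)] B.d_closed h(2) k(2)
        lin_mapD(1)[OF lin_\<alpha>] lin_mapD(1)[OF k(1)] A.d_closed lin_map_neg[OF A.module_P T k(1)] T.r_neg)
  then obtain K where K: "lin_map R (cone n) T K" "\<And>p. p \<in> carrier (cone (Suc n)) \<Longrightarrow> ?H p = K (cone_d n p)"
    using cohom_vanishE[OF vC lin_cone_case[OF T h(1) k(1)]] by metis
  have "h x = K (dB n x, \<zero>\<^bsub>shift n\<^esub>)" if x: "x \<in> carrier (PB (Suc n))" for x
  proof -
    interpret Bn: module R "PB n" by (rule B.module_P)
    have "cone_d n (x, \<zero>\<^bsub>PA n\<^esub>) = (dB n x, \<zero>\<^bsub>shift n\<^esub>)"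
    proof (cases n)
      case (Suc m)
      interpret Am: module R "PA m" by (rule A.module_P)
      show ?thesis using x Suc lin_map_zero[OF A.module_P B.module_P lin_\<alpha>] B.d_closed[of x n] Bn.r_zero
        by (simp add: cone_d_def A.d_zero)
    qed (use x lin_map_zero[OF A.module_P B.module_P lin_\<alpha>] B.d_closed[of x n] Bn.r_zero in \<open>simp add: cone_d_def\<close>)
    then show ?thesis
      using K(2)[of "(x, \<zero>\<^bsub>PA n\<^esub>)"] x lin_mapD(1)[OF h(1)]
      by (simp add: carrier_cone lin_map_zero[OF A.module_P T k(1)])
  qed
  then show "\<exists>k. lin_map R (PB n) T k \<and> (\<forall>x\<in>carrier (PB (Suc n)). h x = k (dB n x))"
    using lin_map_comp[OF lin_cone_inl K(1)] by blast
qed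

text \<open>Exactness at \<open>Ext(A, T)\<close> before the connecting map, which extends a cocycle
  \<open>k\<close> on \<open>PA\<close> by zero to the cone one degree up. A bound \<open>K\<close>
  there restricts to a cocycle on \<open>PB\<close>; bounding this by \<open>m\<close> expresses
  \<open>k\<close> as the coboundary of \<open>m\<close> after \<open>\<alpha>\<close> minus the
  \<open>PA\<close>-part of \<open>K\<close>.\<close>

lemma cohom_vanish_left:
  assumes vB: "cohom_vanish R PB dB T n" and vC: "cohom_vanish R cone cone_d T (Suc n)"
  shows "cohom_vanish R PA dA T n"
  unfolding cohom_vanish_def
proof (intro allI impI)
  fix k assume "lin_map R (PA (Suc n)) T k \<and> (\<forall>x\<in>carrier (PA (Suc (Suc n))). k (dA (Suc n) x) = \<zero>\<^bsub>T\<^esub>)"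
  then have k: "lin_map R (PA (Suc n)) T k" "\<And>x. x \<in> carrier (PA (Suc (Suc n))) \<Longrightarrow> k (dA (Suc n) x) = \<zero>\<^bsub>T\<^esub>"
    by auto
  interpret As: module R "PA (Suc n)" by (rule A.module_P)
  interpret An: module R "PA n" by (rule A.module_P)
  interpret Bs: module R "PB (Suc n)" by (rule B.module_P)
  interpret Bss: module R "PB (Suc (Suc n))" by (rule B.module_P)
  let ?H = "\<lambda>p. k (snd p)"
  have "lin_map R (cone (Suc (Suc n))) T ?H"
    unfolding cone_def shift_simps by (rule lin_map_comp[OF lin_map_snd k(1)])
  moreover have "?H (cone_d (Suc (Suc n)) p) = \<zero>\<^bsub>T\<^esub>" if "p \<in> carrier (cone (Suc (Suc (Suc n))))" for p
    using that by (auto simp: carrier_cone cone_d_simps A.d_closed k(2) lin_map_neg[OF A.module_P T k(1)])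
  ultimately obtain K where K: "lin_map R (cone (Suc n)) T K"
    "\<And>p. p \<in> carrier (cone (Suc (Suc n))) \<Longrightarrow> ?H p = K (cone_d (Suc n) p)"
    using cohom_vanishE[OF vC] by metis
  have dz: "cone_d (Suc n) (b, \<zero>\<^bsub>PA (Suc n)\<^esub>) = (dB (Suc n) b, \<zero>\<^bsub>PA n\<^esub>)" if "b \<in> carrier (PB (Suc (Suc n)))" for b
    using that B.d_closed[of b "Suc n"] lin_map_zero[OF A.module_P B.module_P lin_\<alpha>]
    by (simp add: cone_d_simps A.d_zero)
  let ?h = "\<lambda>b. K (b, \<zero>\<^bsub>PA n\<^esub>)" and ?l = "\<lambda>a. K (\<zero>\<^bsub>PB (Suc n)\<^esub>, a)"
  have lin_h: "lin_map R (PB (Suc n)) T ?h"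
    using lin_map_comp[OF lin_cone_inl[of "Suc n"] K(1)] by simp
  have lin_l: "lin_map R (PA n) T ?l" by (rule lin_map_comp[OF lin_cone_inr K(1)])
  have "?h (dB (Suc n) b) = \<zero>\<^bsub>T\<^esub>" if "b \<in> carrier (PB (Suc (Suc n)))" for b
    using K(2)[of "(b, \<zero>\<^bsub>PA (Suc n)\<^esub>)"] that
    by (simp add: carrier_cone dz lin_map_zero[OF A.module_P T k(1)])
  then obtain m where m: "lin_map R (PB n) T m" "\<And>b. b \<in> carrier (PB (Suc n)) \<Longrightarrow> ?h b = m (dB n b)"
    using cohom_vanishE[OF vB lin_h] by metis
  have "k a = m (\<alpha> n (dA n a)) \<ominus>\<^bsub>T\<^esub> ?l (dA n a)" if a: "a \<in> carrier (PA (Suc n))" for a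
  proof -
    have c: "\<alpha> (Suc n) a \<in> carrier (PB (Suc n))" by (rule lin_mapD(1)[OF lin_\<alpha> a])
    have "k a = K (\<alpha> (Suc n) a, \<ominus>\<^bsub>PA n\<^esub> dA n a)"
      using K(2)[of "(\<zero>\<^bsub>PB (Suc (Suc n))\<^esub>, a)"] a c by (simp add: carrier_cone cone_d_simps B.d_zero)
    also have "\<dots> = ?h (\<alpha> (Suc n) a) \<oplus>\<^bsub>T\<^esub> ?l (\<ominus>\<^bsub>PA n\<^esub> dA n a)"
      by (rule lin_map_split[OF B.module_P A.module_P K(1)[unfolded cone_def shift_simps] c])
         (simp add: A.d_closed[OF a])
    also have "\<dots> = m (\<alpha> n (dA n a)) \<ominus>\<^bsub>T\<^esub> ?l (dA n a)"
      using c A.d_closed[OF a] by (simp add: m(2) d_\<alpha> a lin_map_neg[OF A.module_P T lin_l] a_minus_def)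
    finally show ?thesis .
  qed
  then show "\<exists>l. lin_map R (PA n) T l \<and> (\<forall>x\<in>carrier (PA (Suc n)). k x = l (dA n x))"
    using lin_map_diff[OF A.module_P T lin_map_comp[OF lin_\<alpha> m(1)] lin_l] by blast
qed

text \<open>Exactness at \<open>Ext(C, T)\<close> after the connecting map. The
  \<open>PB\<close>-part of a cocycle \<open>H\<close> is bounded by \<open>m\<close>, and
  \<open>?l\<close> measures how far \<open>m\<close> is from bounding \<open>H\<close> on the
  \<open>PA\<close>-part; being a cocycle on \<open>PA\<close>, it is bounded too.\<close>

lemma cohom_vanish_right:
  assumes vA: "cohom_vanish R PA dA T n" and vB: "cohom_vanish R PB dB T (Suc n)"
  shows "cohom_vanish R cone cone_d T (Suc n)"
  unfolding cohom_vanish_def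
proof (intro allI impI)
  fix H assume "lin_map R (cone (Suc (Suc n))) T H \<and>
    (\<forall>x\<in>carrier (cone (Suc (Suc (Suc n)))). H (cone_d (Suc (Suc n)) x) = \<zero>\<^bsub>T\<^esub>)"
  then have H: "lin_map R (cone (Suc (Suc n))) T H"
    "\<And>x. x \<in> carrier (cone (Suc (Suc (Suc n)))) \<Longrightarrow> H (cone_d (Suc (Suc n)) x) = \<zero>\<^bsub>T\<^esub>" by auto
  interpret A0: module R "PA n" by (rule A.module_P)
  interpret A1: module R "PA (Suc n)" by (rule A.module_P)
  interpret A2: module R "PA (Suc (Suc n))" by (rule A.module_P)
  interpret B1: module R "PB (Suc n)" by (rule B.module_P)
  interpret B2: module R "PB (Suc (Suc n))" by (rule B.module_P)
  interpret B3: module R "PB (Suc (Suc (Suc n)))" by (rule B.module_P)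
  let ?h = "\<lambda>b. H (b, \<zero>\<^bsub>PA (Suc n)\<^esub>)" and ?k = "\<lambda>a. H (\<zero>\<^bsub>PB (Suc (Suc n))\<^esub>, a)"
  have lin_h: "lin_map R (PB (Suc (Suc n))) T ?h"
    using lin_map_comp[OF lin_cone_inl[of "Suc (Suc n)"] H(1)] by simp
  have lin_k: "lin_map R (PA (Suc n)) T ?k" by (rule lin_map_comp[OF lin_cone_inr H(1)])
  have split: "H (b, a) = ?h b \<oplus>\<^bsub>T\<^esub> ?k a" if "b \<in> carrier (PB (Suc (Suc n)))" "a \<in> carrier (PA (Suc n))" for b a
    by (rule lin_map_split[OF B.module_P A.module_P H(1)[unfolded cone_def shift_simps] that])
  have "?h (dB (Suc (Suc n)) b) = \<zero>\<^bsub>T\<^esub>" if b: "b \<in> carrier (PB (Suc (Suc (Suc n))))" for b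
    using H(2)[of "(b, \<zero>\<^bsub>PA (Suc (Suc n))\<^esub>)"] b B.d_closed[OF b]
    by (simp add: carrier_cone cone_d_simps A.d_zero lin_map_zero[OF A.module_P B.module_P lin_\<alpha>])
  then obtain m where m: "lin_map R (PB (Suc n)) T m"
    "\<And>b. b \<in> carrier (PB (Suc (Suc n))) \<Longrightarrow> ?h b = m (dB (Suc n) b)"
    using cohom_vanishE[OF vB lin_h] by metis
  let ?l = "\<lambda>a. m (\<alpha> (Suc n) a) \<ominus>\<^bsub>T\<^esub> ?k a"
  have lin_l: "lin_map R (PA (Suc n)) T ?l"
    by (rule lin_map_diff[OF A.module_P T lin_map_comp[OF lin_\<alpha> m(1)] lin_k])
  have "?l (dA (Suc n) a) = \<zero>\<^bsub>T\<^esub>" if a: "a \<in> carrier (PA (Suc (Suc n)))" for a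
  proof -
    have c: "\<alpha> (Suc (Suc n)) a \<in> carrier (PB (Suc (Suc n)))" "dA (Suc n) a \<in> carrier (PA (Suc n))"
      by (rule lin_mapD(1)[OF lin_\<alpha> a]) (rule A.d_closed[OF a])
    have "H (\<alpha> (Suc (Suc n)) a, \<ominus>\<^bsub>PA (Suc n)\<^esub> dA (Suc n) a) = \<zero>\<^bsub>T\<^esub>"
      using H(2)[of "(\<zero>\<^bsub>PB (Suc (Suc (Suc n)))\<^esub>, a)"] a c
      by (simp add: carrier_cone cone_d_simps B.d_zero)
    then show ?thesis
      using c a by (simp add: split[OF c(1) A1.a_inv_closed[OF c(2)]] m(2) d_\<alpha> lin_map_neg[OF A.module_P T lin_k] a_minus_def)
  qed
  then obtain l where l: "lin_map R (PA n) T l" "\<And>a. a \<in> carrier (PA (Suc n)) \<Longrightarrow> ?l a = l (dA n a)"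
    using cohom_vanishE[OF vA lin_l] by metis
  let ?K = "\<lambda>p. m (fst p) \<oplus>\<^bsub>T\<^esub> l (snd p)"
  have "H p = ?K (cone_d (Suc n) p)" if "p \<in> carrier (cone (Suc (Suc n)))" for p
  proof -
    obtain b a where p: "p = (b, a)" "b \<in> carrier (PB (Suc (Suc n)))" "a \<in> carrier (PA (Suc n))"
      using \<open>p \<in> _\<close> by (auto simp: carrier_cone)
    have c: "\<alpha> (Suc n) a \<in> carrier (PB (Suc n))" by (rule lin_mapD(1)[OF lin_\<alpha> p(3)])
    have mc: "m (\<alpha> (Suc n) a) \<in> carrier T" "?k a \<in> carrier T" "m (dB (Suc n) b) \<in> carrier T"
      using lin_mapD(1)[OF m(1)] lin_mapD(1)[OF lin_k] c p B.d_closed by auto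
    have "?K (cone_d (Suc n) p) = m (dB (Suc n) b) \<oplus>\<^bsub>T\<^esub> m (\<alpha> (Suc n) a) \<oplus>\<^bsub>T\<^esub> \<ominus>\<^bsub>T\<^esub> (m (\<alpha> (Suc n) a) \<ominus>\<^bsub>T\<^esub> ?k a)"
      using p c by (simp add: cone_d_simps lin_mapD(2)[OF m(1)] B.d_closed A.d_closed
          lin_map_neg[OF A.module_P T l(1)] l(2))
    also have "\<dots> = m (dB (Suc n) b) \<oplus>\<^bsub>T\<^esub> ?k a"
      using mc by (simp add: a_minus_def T.minus_add T.a_assoc T.r_neg2)
    finally show ?thesis using split[OF p(2,3)] m(2)[OF p(2)] by (simp add: p(1))
  qed
  then show "\<exists>K. lin_map R (cone (Suc n)) T K \<and> (\<forall>x\<in>carrier (cone (Suc (Suc n))). H x = K (cone_d (Suc n) x))"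
    using lin_cone_case[OF T m(1) l(1)] by blast
qed

text \<open>Exactness at \<open>Hom(A, T)\<close>. The connecting map sends \<open>k\<close> to its
  pullback to \<open>PA 0\<close>, extended by zero; a bound for this on the cone restricts to a map
  on \<open>PB 0\<close> that vanishes on boundaries and therefore descends to
  \<open>B\<close>.\<close>

lemma hom_extends:
  assumes vC: "cohom_vanish R cone cone_d T 0" and k: "lin_map R A T k"
  shows "\<exists>q. lin_map R B T q \<and> (\<forall>x\<in>carrier A. q (f x) = k x)"
proof -
  interpret A0: module R "PA 0" by (rule A.module_P)
  interpret A1: module R "PA (Suc 0)" by (rule A.module_P)
  interpret B0: module R "PB 0" by (rule B.module_P)
  interpret B1: module R "PB (Suc 0)" by (rule B.module_P)
  let ?H = "\<lambda>p. k (eA (snd p))"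
  have lin_ke: "lin_map R (PA 0) T (\<lambda>a. k (eA a))" by (rule lin_map_comp[OF A.lin_aug k])
  have lin_H: "lin_map R (cone (Suc 0)) T ?H"
    unfolding cone_def shift_simps by (rule lin_map_comp[OF lin_map_snd lin_ke])
  have H_d: "?H (cone_d (Suc 0) p) = \<zero>\<^bsub>T\<^esub>" if "p \<in> carrier (cone (Suc (Suc 0)))" for p
    using that by (auto simp: carrier_cone cone_d_simps lin_map_neg[OF A.module_P T lin_ke] A.d_closed A.aug_d
        lin_map_zero[OF A.module_M T k])
  obtain K where K: "lin_map R (cone 0) T K"
    "\<And>p. p \<in> carrier (cone (Suc 0)) \<Longrightarrow> ?H p = K (cone_d 0 p)"
    using cohom_vanishE[OF vC lin_H H_d] by blast
  let ?h = "\<lambda>b. K (b, \<zero>\<^bsub>PA 0\<^esub>)"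
  have lin_h: "lin_map R (PB 0) T ?h" using lin_map_comp[OF lin_cone_inl[of 0] K(1)] by simp
  have h_d: "?h (dB 0 b) = \<zero>\<^bsub>T\<^esub>" if "b \<in> carrier (PB (Suc 0))" for b
    using K(2)[of "(b, \<zero>\<^bsub>PA 0\<^esub>)"] that B.d_closed[OF that]
    by (simp add: carrier_cone cone_d_simps lin_map_zero[OF A.module_P B.module_P lin_\<alpha>] lin_map_zero[OF A.module_P T lin_ke])
  have h_\<alpha>: "?h (\<alpha> 0 a) = k (eA a)" if "a \<in> carrier (PA 0)" for a
    using K(2)[of "(\<zero>\<^bsub>PB (Suc 0)\<^esub>, a)"] that lin_mapD(1)[OF lin_\<alpha> that]
    by (simp add: carrier_cone cone_d_simps B.d_zero)
  have "?h b = \<zero>\<^bsub>T\<^esub>" if b: "b \<in> carrier (PB 0)" "eB b = \<zero>\<^bsub>B\<^esub>" for b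
    using b h_d B.exact_0[of b] by auto
  then obtain q where q: "lin_map R B T q" "\<And>b. b \<in> carrier (PB 0) \<Longrightarrow> q (eB b) = ?h b"
    using lin_map_factor[OF B.module_P B.module_M T B.lin_aug B.aug_surj lin_h] by metis
  have "q (f x) = k x" if "x \<in> carrier A" for x
  proof -
    obtain a where "a \<in> carrier (PA 0)" "x = eA a" using \<open>x \<in> _\<close> A.aug_surj by blast
    then show ?thesis using q(2)[of "\<alpha> 0 a"] h_\<alpha>[of a] lin_mapD(1)[OF lin_\<alpha>] by (simp add: aug_\<alpha>)
  qed
  with q(1) show ?thesis by blast
qed

text \<open>The lowest case of \<open>cohom_vanish_right\<close>, with extendability of maps from
  \<open>A\<close> to \<open>T\<close> in place of vanishing for \<open>A\<close>: the difference
  \<open>?l\<close> now lives on \<open>PA 0\<close>, descends to \<open>A\<close> and is extended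
  to \<open>B\<close>.\<close>

lemma cohom_vanish_right_0:
  assumes ext: "\<And>k. lin_map R A T k \<Longrightarrow> \<exists>q. lin_map R B T q \<and> (\<forall>x\<in>carrier A. q (f x) = k x)"
    and vB: "cohom_vanish R PB dB T 0"
  shows "cohom_vanish R cone cone_d T 0"
  unfolding cohom_vanish_def
proof (intro allI impI)
  fix H assume "lin_map R (cone (Suc 0)) T H \<and>
    (\<forall>x\<in>carrier (cone (Suc (Suc 0))). H (cone_d (Suc 0) x) = \<zero>\<^bsub>T\<^esub>)"
  then have H: "lin_map R (cone (Suc 0)) T H"
    "\<And>x. x \<in> carrier (cone (Suc (Suc 0))) \<Longrightarrow> H (cone_d (Suc 0) x) = \<zero>\<^bsub>T\<^esub>" by auto
  interpret A0: module R "PA 0" by (rule A.module_P)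
  interpret A1: module R "PA (Suc 0)" by (rule A.module_P)
  interpret B0: module R "PB 0" by (rule B.module_P)
  interpret B1: module R "PB (Suc 0)" by (rule B.module_P)
  interpret B2: module R "PB (Suc (Suc 0))" by (rule B.module_P)
  let ?h = "\<lambda>b. H (b, \<zero>\<^bsub>PA 0\<^esub>)" and ?k = "\<lambda>a. H (\<zero>\<^bsub>PB (Suc 0)\<^esub>, a)"
  have lin_h: "lin_map R (PB (Suc 0)) T ?h"
    using lin_map_comp[OF lin_cone_inl[of "Suc 0"] H(1)] by simp
  have lin_k: "lin_map R (PA 0) T ?k" by (rule lin_map_comp[OF lin_cone_inr H(1)])
  have split: "H (b, a) = ?h b \<oplus>\<^bsub>T\<^esub> ?k a" if "b \<in> carrier (PB (Suc 0))" "a \<in> carrier (PA 0)" for b a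
    by (rule lin_map_split[OF B.module_P A.module_P H(1)[unfolded cone_def shift_simps] that])
  have "?h (dB (Suc 0) b) = \<zero>\<^bsub>T\<^esub>" if b: "b \<in> carrier (PB (Suc (Suc 0)))" for b
    using H(2)[of "(b, \<zero>\<^bsub>PA (Suc 0)\<^esub>)"] b B.d_closed[OF b]
    by (simp add: carrier_cone cone_d_simps A.d_zero lin_map_zero[OF A.module_P B.module_P lin_\<alpha>])
  then obtain m where m: "lin_map R (PB 0) T m" "\<And>b. b \<in> carrier (PB (Suc 0)) \<Longrightarrow> ?h b = m (dB 0 b)"
    using cohom_vanishE[OF vB lin_h] by metis
  \<comment> \<open>The sign is opposite to the one in \<open>cohom_vanish_right\<close>: in degree
    zero the correction enters through the first component of the cone, by way of \<open>q\<close>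
    and \<open>eB\<close>, and does not meet the sign of \<open>dA\<close>.\<close>
  let ?l = "\<lambda>a. ?k a \<ominus>\<^bsub>T\<^esub> m (\<alpha> 0 a)"
  have lin_l: "lin_map R (PA 0) T ?l"
    by (rule lin_map_diff[OF A.module_P T lin_k lin_map_comp[OF lin_\<alpha> m(1)]])
  have l_d: "?l (dA 0 a) = \<zero>\<^bsub>T\<^esub>" if a: "a \<in> carrier (PA (Suc 0))" for a
  proof -
    have c: "\<alpha> (Suc 0) a \<in> carrier (PB (Suc 0))" "dA 0 a \<in> carrier (PA 0)"
      by (rule lin_mapD(1)[OF lin_\<alpha> a]) (rule A.d_closed[OF a])
    have kc: "?k (dA 0 a) \<in> carrier T" "m (\<alpha> 0 (dA 0 a)) \<in> carrier T"
      using lin_mapD(1)[OF lin_k c(2)] lin_mapD(1)[OF m(1) lin_mapD(1)[OF lin_\<alpha> c(2)]] .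
    have "H (\<alpha> (Suc 0) a, \<ominus>\<^bsub>PA 0\<^esub> dA 0 a) = \<zero>\<^bsub>T\<^esub>"
      using H(2)[of "(\<zero>\<^bsub>PB (Suc (Suc 0))\<^esub>, a)"] a c by (simp add: carrier_cone cone_d_simps B.d_zero)
    then have "m (\<alpha> 0 (dA 0 a)) \<ominus>\<^bsub>T\<^esub> ?k (dA 0 a) = \<zero>\<^bsub>T\<^esub>"
      using c a by (simp add: split[OF c(1) A0.a_inv_closed[OF c(2)]] m(2) d_\<alpha> lin_map_neg[OF A.module_P T lin_k] a_minus_def)
    then show ?thesis using kc by (simp add: T.minus_eq_zero_iff)
  qed
  have "?l a = \<zero>\<^bsub>T\<^esub>" if "a \<in> carrier (PA 0)" "eA a = \<zero>\<^bsub>A\<^esub>" for a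
    using that l_d A.exact_0[of a] by auto
  then obtain l where l: "lin_map R A T l" "\<And>a. a \<in> carrier (PA 0) \<Longrightarrow> l (eA a) = ?l a"
    using lin_map_factor[OF A.module_P A.module_M T A.lin_aug A.aug_surj lin_l] by metis
  then obtain q where q: "lin_map R B T q" "\<And>x. x \<in> carrier A \<Longrightarrow> q (f x) = l x" using ext by blast
  let ?K = "\<lambda>p. m (fst p) \<oplus>\<^bsub>T\<^esub> q (eB (fst p))"
  have "lin_map R (cone 0) T ?K"
    unfolding cone_def
    by (rule lin_map_comp[OF lin_map_fst lin_map_add[OF B.module_P T m(1) lin_map_comp[OF B.lin_aug q(1)]]])
  moreover have "H p = ?K (cone_d 0 p)" if "p \<in> carrier (cone (Suc 0))" for p
  proof -
    obtain b a where p: "p = (b, a)" "b \<in> carrier (PB (Suc 0))" "a \<in> carrier (PA 0)"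
      using \<open>p \<in> _\<close> by (auto simp: carrier_cone)
    have c: "\<alpha> 0 a \<in> carrier (PB 0)" by (rule lin_mapD(1)[OF lin_\<alpha> p(3)])
    have mc: "m (\<alpha> 0 a) \<in> carrier T" "?k a \<in> carrier T" "m (dB 0 b) \<in> carrier T"
      using lin_mapD(1)[OF m(1)] lin_mapD(1)[OF lin_k] c p B.d_closed by auto
    have "eB (dB 0 b \<oplus>\<^bsub>PB 0\<^esub> \<alpha> 0 a) = f (eA a)"
    proof -
      interpret B: module R B by (rule B.module_M)
      show ?thesis using p c lin_mapD(1)[OF short_exactD(1)[OF ses] lin_mapD(1)[OF A.lin_aug p(3)]]
        by (simp add: lin_mapD(2)[OF B.lin_aug] B.d_closed B.aug_d aug_\<alpha>)
    qed
    then have "?K (cone_d 0 p) = m (dB 0 b) \<oplus>\<^bsub>T\<^esub> m (\<alpha> 0 a) \<oplus>\<^bsub>T\<^esub> (?k a \<ominus>\<^bsub>T\<^esub> m (\<alpha> 0 a))"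
      using p c lin_mapD(1)[OF A.lin_aug] by (simp add: cone_d_simps lin_mapD(2)[OF m(1)] B.d_closed q(2) l(2))
    also have "\<dots> = m (dB 0 b) \<oplus>\<^bsub>T\<^esub> ?k a"
      using mc by (simp add: a_minus_def T.a_assoc T.a_comm[of "?k a" "\<ominus>\<^bsub>T\<^esub> m (\<alpha> 0 a)"] T.r_neg2)
    finally show ?thesis using split[OF p(2,3)] m(2)[OF p(2)] by (simp add: p(1))
  qed
  ultimately show "\<exists>K. lin_map R (cone 0) T K \<and> (\<forall>x\<in>carrier (cone (Suc 0)). H x = K (cone_d 0 x))" by blast
qed

end

end

subsection \<open>Two-of-three for the vanishing of Ext\<close>

locale ext_ses = mapping_cone R A "res_mod R A" "res_diff R A" "res_aug R A"
    B "res_mod R B" "res_diff R B" "res_aug R B" C f g \<alpha>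
  for R :: "('r, 'e) ring_scheme" and A :: "('r, 'a, 'f) module_scheme"
    and B :: "('r, 'b, 'g) module_scheme" and C :: "('r, 'c, 'h) module_scheme" and f g \<alpha> +
  fixes T :: "('r, 't, 'i) module_scheme"
  assumes T: "module R T"
begin

lemma lifts_res:
  assumes "module R X" "module R Y" "lin_map R X Y d"
  shows "lifts R (res_mod R M n) X Y d"
  unfolding res_mod_def by (rule free_lifts[OF assms])

text \<open>Both the cone and the standard resolution of \<open>C\<close> satisfy the lifting
  properties, so \<open>cohom_vanish_transfer\<close> applies in either direction. This trades Ext
  of \<open>C\<close> for the cone, on which cochains split into parts belonging to \<open>B\<close>
  and to \<open>A\<close>.\<close>

lemma cohom_vanish_cone_iff: "cohom_vanish R cone cone_d T n \<longleftrightarrow> zero_mod (Ext_mod R (Suc n) C T)"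
proof -
  interpret C: resolution R C "res_mod R C" "res_diff R C" "res_aug R C"
    by (rule module.resolution_res[OF module_C])
  have l: "lifts R (cone m) X Y d" if "module R X" "module R Y" "lin_map R X Y d"
    for m d and X :: "('r, 'x, 'k) module_scheme" and Y :: "('r, 'y, 'l) module_scheme"
    by (rule lifts_cone[OF that lifts_res[OF that] lifts_res[OF that]])
  have "cohom_vanish R cone cone_d T n \<longleftrightarrow> cohom_vanish R (res_mod R C) (res_diff R C) T n"
  proof
    assume "cohom_vanish R cone cone_d T n"
    then show "cohom_vanish R (res_mod R C) (res_diff R C) T n"
      by (rule cohom_vanish_transfer[OF C.resolution_axioms cone.resolution_axioms T
          lifts_res[OF module_cone module_C lin_cone_aug] lifts_res[OF module_cone module_cone lin_cone_d]
          l[OF C.module_P module_C C.lin_aug] l[OF C.module_P C.module_P C.lin_d]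
          lifts_res[OF C.module_P C.module_P C.lin_d]])
  next
    assume "cohom_vanish R (res_mod R C) (res_diff R C) T n"
    then show "cohom_vanish R cone cone_d T n"
      by (rule cohom_vanish_transfer[OF cone.resolution_axioms C.resolution_axioms T
          l[OF C.module_P module_C C.lin_aug] l[OF C.module_P C.module_P C.lin_d]
          lifts_res[OF module_cone module_C lin_cone_aug] lifts_res[OF module_cone module_cone lin_cone_d]
          l[OF module_cone module_cone lin_cone_d]])
  qed
  then show ?thesis by (simp add: module.zero_mod_Ext_iff[OF module_C T])
qed

lemmas Ext_iff = module.zero_mod_Ext_iff[OF A.module_M T] module.zero_mod_Ext_iff[OF B.module_M T]
  cohom_vanish_cone_iff[symmetric]

end

lemma ext_ses_exists:
  assumes A: "module R A" and B: "module R B" and C: "module R C" and T: "module R T"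
    and ses: "short_exact R A f B g C"
  obtains \<alpha> where "ext_ses R A B C f g \<alpha> T"
proof -
  interpret A: resolution R A "res_mod R A" "res_diff R A" "res_aug R A"
    by (rule module.resolution_res[OF A])
  interpret B: resolution R B "res_mod R B" "res_diff R B" "res_aug R B"
    by (rule module.resolution_res[OF B])
  show ?thesis
  proof (rule chain_map_exists[OF A.resolution_axioms B.resolution_axioms short_exactD(1)[OF ses]])
    show "lifts R (res_mod R A 0) (res_mod R B 0) B (res_aug R B)"
      unfolding res_mod_def[of R A] by (rule free_lifts[OF B.module_P B B.lin_aug])
    show "lifts R (res_mod R A (Suc n)) (res_mod R B (Suc n)) (res_mod R B n) (res_diff R B n)" for n
      unfolding res_mod_def[of R A] by (rule free_lifts[OF B.module_P B.module_P B.lin_d])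
  next
    fix \<alpha>
    assume "\<And>n. lin_map R (res_mod R A n) (res_mod R B n) (\<alpha> n)"
      "\<And>x. x \<in> carrier (res_mod R A 0) \<Longrightarrow> res_aug R B (\<alpha> 0 x) = f (res_aug R A x)"
      "\<And>n x. x \<in> carrier (res_mod R A (Suc n)) \<Longrightarrow> res_diff R B n (\<alpha> (Suc n) x) = \<alpha> n (res_diff R A n x)"
    then have "ext_ses R A B C f g \<alpha> T"
      by (intro ext_ses.intro mapping_cone.intro ext_ses_axioms.intro mapping_cone_axioms.intro
          A.resolution_axioms B.resolution_axioms T C ses)
    then show thesis by (rule that)
  qed
qed

context
  fixes R :: "('r, 'e) ring_scheme" and A :: "('r, 'a, 'f) module_scheme"
    and B :: "('r, 'b, 'g) module_scheme" and C :: "('r, 'c, 'h) module_scheme" and f g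
    and T :: "('r, 't, 'i) module_scheme"
  assumes A: "module R A" and B: "module R B" and C: "module R C" and T: "module R T"
    and ses: "short_exact R A f B g C"
begin

lemma Ext_zero_middle:
  assumes "zero_mod (Ext_mod R (Suc n) A T)" "zero_mod (Ext_mod R (Suc n) C T)"
  shows "zero_mod (Ext_mod R (Suc n) B T)"
proof -
  obtain \<alpha> where "ext_ses R A B C f g \<alpha> T" by (rule ext_ses_exists[OF A B C T ses])
  then interpret ext_ses R A B C f g \<alpha> T .
  show ?thesis using assms cohom_vanish_middle[OF T, of n] by (simp add: Ext_iff)
qed

lemma Ext_zero_left:
  assumes "zero_mod (Ext_mod R (Suc n) B T)" "zero_mod (Ext_mod R (Suc (Suc n)) C T)"
  shows "zero_mod (Ext_mod R (Suc n) A T)"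
proof -
  obtain \<alpha> where "ext_ses R A B C f g \<alpha> T" by (rule ext_ses_exists[OF A B C T ses])
  then interpret ext_ses R A B C f g \<alpha> T .
  show ?thesis using assms cohom_vanish_left[OF T, of n] by (simp add: Ext_iff)
qed

lemma Ext_zero_right:
  assumes "zero_mod (Ext_mod R (Suc n) A T)" "zero_mod (Ext_mod R (Suc (Suc n)) B T)"
  shows "zero_mod (Ext_mod R (Suc (Suc n)) C T)"
proof -
  obtain \<alpha> where "ext_ses R A B C f g \<alpha> T" by (rule ext_ses_exists[OF A B C T ses])
  then interpret ext_ses R A B C f g \<alpha> T .
  show ?thesis using assms cohom_vanish_right[OF T, of n] by (simp add: Ext_iff)
qed

lemma Ext_zero_hom_extends:
  assumes "zero_mod (Ext_mod R (Suc 0) C T)" "lin_map R A T k"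
  shows "\<exists>q. lin_map R B T q \<and> (\<forall>x\<in>carrier A. q (f x) = k x)"
proof -
  obtain \<alpha> where "ext_ses R A B C f g \<alpha> T" by (rule ext_ses_exists[OF A B C T ses])
  then interpret ext_ses R A B C f g \<alpha> T .
  show ?thesis using hom_extends[OF T _ assms(2)] assms(1) by (simp add: Ext_iff)
qed

lemma hom_extends_Ext_zero:
  assumes "\<And>k. lin_map R A T k \<Longrightarrow> \<exists>q. lin_map R B T q \<and> (\<forall>x\<in>carrier A. q (f x) = k x)"
    and "zero_mod (Ext_mod R (Suc 0) B T)"
  shows "zero_mod (Ext_mod R (Suc 0) C T)"
proof -
  obtain \<alpha> where "ext_ses R A B C f g \<alpha> T" by (rule ext_ses_exists[OF A B C T ses])
  then interpret ext_ses R A B C f g \<alpha> T .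
  show ?thesis using assms(2) cohom_vanish_right_0[OF T assms(1)] by (simp add: Ext_iff)
qed

end


subsection \<open>Duality and the short five lemma\<close>

definition dual_map :: "('r, 'a, 'f) module_scheme \<Rightarrow> ('a \<Rightarrow> 'b) \<Rightarrow> ('b \<Rightarrow> 't) \<Rightarrow> 'a \<Rightarrow> 't"
  where "dual_map A f \<phi> = (\<lambda>x\<in>carrier A. \<phi> (f x))"

lemma dual_map_lin:
  assumes "module R A" "lin_map R A B f"
  shows "lin_map R (Hom_mod R B T) (Hom_mod R A T) (dual_map A f)"
proof (rule lin_mapI)
  fix \<phi> assume "\<phi> \<in> carrier (Hom_mod R B T)"
  then show "dual_map A f \<phi> \<in> carrier (Hom_mod R A T)"
    unfolding dual_map_def by (intro restrict_in_Hom assms(1) lin_map_comp[OF assms(2)] Hom_modD)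
qed (auto simp: dual_map_def Hom_mod_simps(3,4) fun_eq_iff lin_mapD(1)[OF assms(2)])

text \<open>Left exactness of Hom into \<open>T\<close> is automatic: a map killing the image of
  \<open>f\<close> descends along \<open>g\<close> by \<open>lin_map_factor\<close>. Only
  surjectivity onto \<open>Hom_mod R A T\<close> is an extra demand, and \<open>ext\<close> states
  it.\<close>

lemma dual_short_exact:
  assumes A: "module R A" and B: "module R B" and C: "module R C" and T: "module R T"
    and ses: "short_exact R A f B g C"
    and ext: "\<And>k. lin_map R A T k \<Longrightarrow> \<exists>q. lin_map R B T q \<and> (\<forall>x\<in>carrier A. q (f x) = k x)"
  shows "short_exact R (Hom_mod R C T) (dual_map B g) (Hom_mod R B T) (dual_map A f) (Hom_mod R A T)"
proof -
  note f = short_exactD(1)[OF ses] and g = short_exactD(2)[OF ses]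
  note D = dual_map_lin[OF B g, of T] dual_map_lin[OF A f, of T]
  have "inj_on (dual_map B g) (carrier (Hom_mod R C T))"
  proof (rule inj_onI)
    fix \<phi> \<psi> assume \<phi>: "\<phi> \<in> carrier (Hom_mod R C T)" and \<psi>: "\<psi> \<in> carrier (Hom_mod R C T)"
      and eq: "dual_map B g \<phi> = dual_map B g \<psi>"
    show "\<phi> = \<psi>"
    proof (rule Hom_mod_eqI[OF \<phi> \<psi>])
      fix z assume "z \<in> carrier C"
      then obtain y where "y \<in> carrier B" "z = g y" using short_exactD(4)[OF ses] by blast
      then show "\<phi> z = \<psi> z" using fun_cong[OF eq, of y] by (simp add: dual_map_def)
    qed
  qed
  moreover have "dual_map B g ` carrier (Hom_mod R C T) = a_kernel (Hom_mod R B T) (Hom_mod R A T) (dual_map A f)"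
  proof (intro equalityI subsetI)
    fix \<psi> assume "\<psi> \<in> dual_map B g ` carrier (Hom_mod R C T)"
    then obtain \<phi> where \<phi>: "\<phi> \<in> carrier (Hom_mod R C T)" "\<psi> = dual_map B g \<phi>" by blast
    have "\<phi> \<zero>\<^bsub>C\<^esub> = \<zero>\<^bsub>T\<^esub>" by (rule lin_map_zero[OF C T Hom_modD[OF \<phi>(1)]])
    then have "dual_map A f \<psi> = \<zero>\<^bsub>Hom_mod R A T\<^esub>"
      by (auto simp: \<phi> dual_map_def Hom_mod_simps(2) fun_eq_iff lin_mapD(1)[OF f] short_exactD(6)[OF ses])
    then show "\<psi> \<in> a_kernel (Hom_mod R B T) (Hom_mod R A T) (dual_map A f)"
      using lin_mapD(1)[OF D(1) \<phi>(1)] by (simp add: \<phi> a_kernel_def')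
  next
    fix \<psi> assume "\<psi> \<in> a_kernel (Hom_mod R B T) (Hom_mod R A T) (dual_map A f)"
    then have \<psi>: "\<psi> \<in> carrier (Hom_mod R B T)" "dual_map A f \<psi> = \<zero>\<^bsub>Hom_mod R A T\<^esub>"
      by (auto simp: a_kernel_def')
    have "\<psi> (f x) = \<zero>\<^bsub>T\<^esub>" if "x \<in> carrier A" for x
      using fun_cong[OF \<psi>(2), of x] that by (simp add: dual_map_def Hom_mod_simps(2))
    then have "\<psi> y = \<zero>\<^bsub>T\<^esub>" if "y \<in> carrier B" "g y = \<zero>\<^bsub>C\<^esub>" for y
      using that short_exactD(5)[OF ses] by auto
    then obtain q where q: "lin_map R C T q" "\<And>y. y \<in> carrier B \<Longrightarrow> q (g y) = \<psi> y"
      using lin_map_factor[OF B C T g short_exactD(4)[OF ses] Hom_modD[OF \<psi>(1)]] by metis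
    let ?q = "restrict q (carrier C)"
    have Q: "?q \<in> carrier (Hom_mod R C T)" by (rule restrict_in_Hom[OF C q(1)])
    have "\<psi> = dual_map B g ?q"
      by (rule Hom_mod_eqI[OF \<psi>(1) lin_mapD(1)[OF D(1) Q]])
         (simp add: dual_map_def q(2) lin_mapD(1)[OF g])
    then show "\<psi> \<in> dual_map B g ` carrier (Hom_mod R C T)" using Q by blast
  qed
  moreover have "dual_map A f ` carrier (Hom_mod R B T) = carrier (Hom_mod R A T)"
  proof (intro equalityI subsetI)
    fix k assume k: "k \<in> carrier (Hom_mod R A T)"
    then obtain q where q: "lin_map R B T q" "\<And>x. x \<in> carrier A \<Longrightarrow> q (f x) = k x"
      using ext[OF Hom_modD] by blast
    have Q: "restrict q (carrier B) \<in> carrier (Hom_mod R B T)" by (rule restrict_in_Hom[OF B q(1)])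
    have "k = dual_map A f (restrict q (carrier B))"
      by (rule Hom_mod_eqI[OF k lin_mapD(1)[OF D(2) Q]])
         (simp add: dual_map_def q(2) lin_mapD(1)[OF f])
    then show "k \<in> dual_map A f ` carrier (Hom_mod R B T)" using Q by blast
  qed (use lin_mapD(1)[OF D(2)] in blast)
  ultimately show ?thesis using D by (simp add: short_exact_def)
qed

lemma biduality_lin:
  assumes "module R L" "module R T"
  shows "lin_map R L (Hom_mod R (Hom_mod R L T) T) (biduality R L T)"
proof (rule lin_mapI)
  fix x assume x: "x \<in> carrier L"
  have "lin_map R (Hom_mod R L T) T (\<lambda>\<phi>. \<phi> x)"
    using x by (intro lin_mapI) (auto simp: Hom_mod_simps lin_mapD)
  then show "biduality R L T x \<in> carrier (Hom_mod R (Hom_mod R L T) T)"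
    unfolding biduality_def by (rule restrict_in_Hom[OF Hom_module[OF assms]])
qed (auto simp: biduality_def Hom_mod_simps(3,4) fun_eq_iff lin_mapD(2,3)[OF Hom_modD])

text \<open>Supplies the commuting squares that the short five lemma needs between a sequence and
  its double dual.\<close>

lemma biduality_natural:
  assumes "module R A" "lin_map R A B f" "x \<in> carrier A"
  shows "biduality R B T (f x) = dual_map (Hom_mod R B T) (dual_map A f) (biduality R A T x)"
  using assms lin_mapD(1)[OF dual_map_lin[OF assms(1,2), of T]]
  by (auto simp: biduality_def dual_map_def[of "Hom_mod R B T"] fun_eq_iff) (simp add: dual_map_def)

lemma lin_map_inj_zero:
  assumes "module R M" "module R N" "lin_map R M N h" "inj_on h (carrier M)"
    and "x \<in> carrier M" "h x = \<zero>\<^bsub>N\<^esub>"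
  shows "x = \<zero>\<^bsub>M\<^esub>"
proof -
  interpret M: module R M by fact
  show ?thesis
    using inj_onD[OF assms(4) _ assms(5) M.zero_closed] assms(6) lin_map_zero[OF assms(1-3)] by simp
qed

section \<open>The short five lemma in all three positions\<close>

locale ses_morphism =
  fixes R :: "('r, 'e) ring_scheme"
    and A :: "('r, 'a1, 'f1) module_scheme" and f and B :: "('r, 'b1, 'g1) module_scheme"
    and g and C :: "('r, 'c1, 'h1) module_scheme"
    and A' :: "('r, 'a2, 'f2) module_scheme" and f' and B' :: "('r, 'b2, 'g2) module_scheme"
    and g' and C' :: "('r, 'c2, 'h2) module_scheme" and a b c
  assumes modules: "module R A" "module R B" "module R C" "module R A'" "module R B'" "module R C'"
    and ses: "short_exact R A f B g C" and ses': "short_exact R A' f' B' g' C'"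
    and lin: "lin_map R A A' a" "lin_map R B B' b" "lin_map R C C' c"
    and comm_f: "\<And>x. x \<in> carrier A \<Longrightarrow> b (f x) = f' (a x)"
    and comm_g: "\<And>y. y \<in> carrier B \<Longrightarrow> c (g y) = g' (b y)"
begin

sublocale A: module R A by (rule modules)
sublocale B: module R B by (rule modules)
sublocale C: module R C by (rule modules)
sublocale A': module R A' by (rule modules)
sublocale B': module R B' by (rule modules)
sublocale C': module R C' by (rule modules)

lemmas f = short_exactD(1)[OF ses] and g = short_exactD(2)[OF ses]
lemmas f' = short_exactD(1)[OF ses'] and g' = short_exactD(2)[OF ses']

lemma inj_if_kernel_zero:
  assumes "module R M" "module R N" "lin_map R M N h" "\<And>x. x \<in> carrier M \<Longrightarrow> h x = \<zero>\<^bsub>N\<^esub> \<Longrightarrow> x = \<zero>\<^bsub>M\<^esub>"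
  shows "inj_on h (carrier M)"
proof (rule inj_onI)
  interpret M: module R M by fact
  interpret N: module R N by fact
  fix x y assume xy: "x \<in> carrier M" "y \<in> carrier M" "h x = h y"
  then have "h (x \<ominus>\<^bsub>M\<^esub> y) = \<zero>\<^bsub>N\<^esub>"
    using lin_mapD(1)[OF assms(3)] by (simp add: lin_map_minus[OF assms(1-3)] N.minus_eq_zero_iff)
  then show "x = y" using xy assms(4)[of "x \<ominus>\<^bsub>M\<^esub> y"] by (simp add: M.minus_eq_zero_iff)
qed

lemma short_five_middle:
  assumes a: "bij_betw a (carrier A) (carrier A')" and c: "bij_betw c (carrier C) (carrier C')"
  shows "bij_betw b (carrier B) (carrier B')"
  unfolding bij_betw_def
proof
  show "inj_on b (carrier B)"
  proof (rule inj_if_kernel_zero[OF modules(2,5) lin(2)])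
    fix y assume y: "y \<in> carrier B" "b y = \<zero>\<^bsub>B'\<^esub>"
    have "c (g y) = \<zero>\<^bsub>C'\<^esub>" using y by (simp add: comm_g lin_map_zero[OF modules(5,6) g'])
    then have "g y = \<zero>\<^bsub>C\<^esub>"
      using lin_map_inj_zero[OF modules(3,6) lin(3) bij_betw_imp_inj_on[OF c]] y lin_mapD(1)[OF g] by blast
    then obtain x where x: "x \<in> carrier A" "y = f x" using y short_exactD(5)[OF ses] by auto
    then have "a x = \<zero>\<^bsub>A'\<^esub>"
      using y lin_map_inj_zero[OF modules(4,5) f' short_exactD(3)[OF ses']] lin_mapD(1)[OF lin(1)]
      by (simp add: comm_f)
    then have "x = \<zero>\<^bsub>A\<^esub>"
      using lin_map_inj_zero[OF modules(1,4) lin(1) bij_betw_imp_inj_on[OF a]] x by blast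
    then show "y = \<zero>\<^bsub>B\<^esub>" using x by (simp add: lin_map_zero[OF modules(1,2) f])
  qed
  show "b ` carrier B = carrier B'"
  proof (intro equalityI subsetI)
    fix y' assume y': "y' \<in> carrier B'"
    then have "g' y' \<in> c ` carrier C" using c lin_mapD(1)[OF g'] by (simp add: bij_betw_def)
    then obtain y where y: "y \<in> carrier B" "g' y' = c (g y)" using short_exactD(4)[OF ses] by (metis imageE)
    have by_in: "b y \<in> carrier B'" by (rule lin_mapD(1)[OF lin(2) y(1)])
    have "g' (y' \<ominus>\<^bsub>B'\<^esub> b y) = \<zero>\<^bsub>C'\<^esub>"
      using y y' by_in lin_mapD(1)[OF g']
      by (simp add: lin_map_minus[OF modules(5,6) g'] comm_g C'.minus_eq_zero_iff)
    then obtain x' where x': "x' \<in> carrier A'" "y' \<ominus>\<^bsub>B'\<^esub> b y = f' x'"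
      using y' by_in short_exactD(5)[OF ses'] by auto
    then obtain x where x: "x \<in> carrier A" "x' = a x" using a by (auto simp: bij_betw_def)
    have "b (f x \<oplus>\<^bsub>B\<^esub> y) = (y' \<ominus>\<^bsub>B'\<^esub> b y) \<oplus>\<^bsub>B'\<^esub> b y"
      using x y x' lin_mapD(1)[OF f] by (simp add: lin_mapD(2)[OF lin(2)] comm_f)
    also have "\<dots> = y'" using y' by_in by (simp add: a_minus_def B'.a_assoc B'.l_neg)
    finally show "y' \<in> b ` carrier B" using x y lin_mapD(1)[OF f] by (metis B.a_closed image_eqI)
  qed (use lin_mapD(1)[OF lin(2)] in blast)
qed

lemma short_five_left:
  assumes b: "bij_betw b (carrier B) (carrier B')" and c: "bij_betw c (carrier C) (carrier C')"
  shows "bij_betw a (carrier A) (carrier A')"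
  unfolding bij_betw_def
proof
  show "inj_on a (carrier A)"
  proof (rule inj_if_kernel_zero[OF modules(1,4) lin(1)])
    fix x assume x: "x \<in> carrier A" "a x = \<zero>\<^bsub>A'\<^esub>"
    then have "b (f x) = \<zero>\<^bsub>B'\<^esub>" by (simp add: comm_f lin_map_zero[OF modules(4,5) f'])
    then have "f x = \<zero>\<^bsub>B\<^esub>"
      using lin_map_inj_zero[OF modules(2,5) lin(2) bij_betw_imp_inj_on[OF b]] x lin_mapD(1)[OF f] by blast
    then show "x = \<zero>\<^bsub>A\<^esub>"
      by (rule lin_map_inj_zero[OF modules(1,2) f short_exactD(3)[OF ses] x(1)])
  qed
  show "a ` carrier A = carrier A'"
  proof (intro equalityI subsetI)
    fix x' assume x': "x' \<in> carrier A'"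
    then have "f' x' \<in> b ` carrier B" using b lin_mapD(1)[OF f'] by (simp add: bij_betw_def)
    then obtain y where y: "y \<in> carrier B" "f' x' = b y" by blast
    have "c (g y) = \<zero>\<^bsub>C'\<^esub>"
      unfolding comm_g[OF y(1)] y(2)[symmetric] by (rule short_exactD(6)[OF ses' x'])
    then have "g y = \<zero>\<^bsub>C\<^esub>"
      using lin_map_inj_zero[OF modules(3,6) lin(3) bij_betw_imp_inj_on[OF c]] y lin_mapD(1)[OF g] by blast
    then obtain x where x: "x \<in> carrier A" "y = f x" using y short_exactD(5)[OF ses] by auto
    then have "f' (a x) = f' x'" using y by (simp add: comm_f)
    then have "a x = x'" using x' x lin_mapD(1)[OF lin(1)] inj_onD[OF short_exactD(3)[OF ses']] by blast
    then show "x' \<in> a ` carrier A" using x by blast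
  qed (use lin_mapD(1)[OF lin(1)] in blast)
qed

lemma short_five_right:
  assumes a: "bij_betw a (carrier A) (carrier A')" and b: "bij_betw b (carrier B) (carrier B')"
  shows "bij_betw c (carrier C) (carrier C')"
  unfolding bij_betw_def
proof
  show "inj_on c (carrier C)"
  proof (rule inj_if_kernel_zero[OF modules(3,6) lin(3)])
    fix z assume z: "z \<in> carrier C" "c z = \<zero>\<^bsub>C'\<^esub>"
    then obtain y where y: "y \<in> carrier B" "z = g y" using short_exactD(4)[OF ses] by blast
    then have "b y \<in> f' ` carrier A'"
      using z short_exactD(5)[OF ses' lin_mapD(1)[OF lin(2)]] by (simp add: comm_g)
    then obtain x where x: "x \<in> carrier A" "b y = f' (a x)" using a by (metis bij_betw_def imageE)
    then have "y = f x"
      using b y lin_mapD(1)[OF f] by (metis bij_betw_def comm_f inj_onD)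
    then show "z = \<zero>\<^bsub>C\<^esub>" using x y short_exactD(6)[OF ses] by simp
  qed
  show "c ` carrier C = carrier C'"
  proof (intro equalityI subsetI)
    fix z' assume "z' \<in> carrier C'"
    then obtain y' where "y' \<in> carrier B'" "z' = g' y'" using short_exactD(4)[OF ses'] by blast
    moreover from this obtain y where "y \<in> carrier B" "y' = b y" using b by (auto simp: bij_betw_def)
    ultimately show "z' \<in> c ` carrier C" using lin_mapD(1)[OF g] by (metis comm_g image_eqI)
  qed (use lin_mapD(1)[OF lin(3)] in blast)
qed

end

subsection \<open>Noetherian local rings\<close>

context noetherian_local_ring begin

lemma max_ideal_maximal: "maximalideal (max_ideal R) R"
  unfolding max_ideal_def by (rule theI'[OF unique_maximal])

lemma max_ideal_ideal: "ideal (max_ideal R) R"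
  using max_ideal_maximal by (rule maximalideal.axioms(1))

lemma max_ideal_carrier: "r \<in> max_ideal R \<Longrightarrow> r \<in> carrier R"
  using ideal.Icarr[OF max_ideal_ideal] .

lemma one_not_in_max_ideal: "\<one> \<notin> max_ideal R"
  using ideal.one_imp_carrier[OF max_ideal_ideal] maximalideal.I_notcarr[OF max_ideal_maximal] by auto

text \<open>The maximal condition for ideals: \<open>ideal_chain_is_trivial\<close> places the union
  of a chain inside the chain, which is the upper bound that Zorn's lemma asks for.\<close>

lemma maximal_ideal_in:
  assumes "S \<noteq> {}" "\<And>I. I \<in> S \<Longrightarrow> ideal I R"
  obtains J where "J \<in> S" "\<And>I. I \<in> S \<Longrightarrow> J \<subseteq> I \<Longrightarrow> I = J"
proof -
  have "\<exists>J\<in>S. \<forall>I\<in>S. J \<subseteq> I \<longrightarrow> I = J"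
  proof (rule subset_Zorn_nonempty[OF assms(1)])
    fix C assume C: "C \<noteq> {}" "subset.chain S C"
    then have "subset.chain {I. ideal I R} C" using assms(2) by (auto simp: subset.chain_def)
    then have "\<Union>C \<in> C" using ideal_chain_is_trivial C(1) by blast
    then show "\<Union>C \<in> S" using C(2) by (auto simp: subset.chain_def)
  qed
  then show ?thesis using that by blast
qed

text \<open>Otherwise the principal ideal of \<open>x\<close> is proper. An ideal maximal among
  those containing \<open>x\<close> but not \<open>\<one>\<close> is a maximal ideal, hence equals
  \<open>max_ideal R\<close> by locality, although \<open>x\<close> lies outside the latter.\<close>

lemma unit_if_not_in_max_ideal:
  assumes x: "x \<in> carrier R" "x \<notin> max_ideal R"
  shows "\<exists>y\<in>carrier R. y \<otimes> x = \<one>"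
proof (rule ccontr)
  assume n: "\<not> ?thesis"
  let ?S = "{I. ideal I R \<and> x \<in> I \<and> \<one> \<notin> I}"
  have "PIdl x \<in> ?S"
    using x n cgenideal_ideal[OF x(1)] cgenideal_self[OF x(1)] by (auto simp: cgenideal_def)
  then obtain J where J: "J \<in> ?S" "\<And>I. I \<in> ?S \<Longrightarrow> J \<subseteq> I \<Longrightarrow> I = J"
    using maximal_ideal_in[of ?S] by blast
  have "maximalideal J R"
  proof (rule maximalidealI)
    show "ideal J R" "carrier R \<noteq> J" using J by auto
    show "I = J \<or> I = carrier R" if "ideal I R" "J \<subseteq> I" for I
      using that J ideal.one_imp_carrier[OF that(1)] by auto
  qed
  then have "J = max_ideal R" using unique_maximal max_ideal_maximal by blast
  then show False using J x by blast
qed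

lemma one_minus_not_in_max_ideal:
  assumes "r \<in> max_ideal R" shows "\<one> \<ominus> r \<notin> max_ideal R"
proof
  interpret m: ideal "max_ideal R" R by (rule max_ideal_ideal)
  assume "\<one> \<ominus> r \<in> max_ideal R"
  then have "(\<one> \<ominus> r) \<oplus> r \<in> max_ideal R" using assms by (rule m.a_closed)
  moreover have "(\<one> \<ominus> r) \<oplus> r = \<one>" using max_ideal_carrier[OF assms] by (simp add: a_minus_def a_assoc l_neg)
  ultimately show False using one_not_in_max_ideal by simp
qed

end


subsection \<open>Submodules and powers of an ideal\<close>

lemma submoduleD:
  assumes "module R M" "submodule H R M"
  shows "x \<in> H \<Longrightarrow> x \<in> carrier M" "\<zero>\<^bsub>M\<^esub> \<in> H"
    and "x \<in> H \<Longrightarrow> y \<in> H \<Longrightarrow> x \<oplus>\<^bsub>M\<^esub> y \<in> H" "x \<in> H \<Longrightarrow> \<ominus>\<^bsub>M\<^esub> x \<in> H" "x \<in> H \<Longrightarrow> y \<in> H \<Longrightarrow> x \<ominus>\<^bsub>M\<^esub> y \<in> H"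
    and "r \<in> carrier R \<Longrightarrow> x \<in> H \<Longrightarrow> r \<odot>\<^bsub>M\<^esub> x \<in> H"
proof -
  interpret M: module R M by fact
  note E = M.submoduleE[OF assms(2)]
  show "x \<in> H \<Longrightarrow> x \<in> carrier M" "x \<in> H \<Longrightarrow> y \<in> H \<Longrightarrow> x \<oplus>\<^bsub>M\<^esub> y \<in> H" "x \<in> H \<Longrightarrow> \<ominus>\<^bsub>M\<^esub> x \<in> H"
    "x \<in> H \<Longrightarrow> y \<in> H \<Longrightarrow> x \<ominus>\<^bsub>M\<^esub> y \<in> H" "r \<in> carrier R \<Longrightarrow> x \<in> H \<Longrightarrow> r \<odot>\<^bsub>M\<^esub> x \<in> H"
    using E by (auto simp: a_minus_def)
  obtain y where "y \<in> H" using E(2) by blast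
  then show "\<zero>\<^bsub>M\<^esub> \<in> H" using E(1,3,5) M.r_neg by (metis subsetD)
qed

lemma image_submodule:
  assumes "module R M" "module R N" "lin_map R M N f" "submodule H R M"
  shows "submodule (f ` H) R N"
proof -
  interpret N: module R N by fact
  note D = submoduleD[OF assms(1,4)]
  show ?thesis
  proof (rule N.submoduleI)
    show "f ` H \<subseteq> carrier N" using lin_mapD(1)[OF assms(3)] D(1) by blast
    show "\<zero>\<^bsub>N\<^esub> \<in> f ` H" using lin_map_zero[OF assms(1-3)] D(2) by (metis image_eqI)
    show "\<ominus>\<^bsub>N\<^esub> y \<in> f ` H" if "y \<in> f ` H" for y
      using that by (auto simp: D(1) simp flip: lin_map_neg[OF assms(1-3)] intro!: imageI D(4))
    show "y \<oplus>\<^bsub>N\<^esub> z \<in> f ` H" if "y \<in> f ` H" "z \<in> f ` H" for y z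
      using that by (auto simp: D(1) simp flip: lin_mapD(2)[OF assms(3)] intro!: imageI D(3))
    show "r \<odot>\<^bsub>N\<^esub> y \<in> f ` H" if "r \<in> carrier R" "y \<in> f ` H" for r y
      using that by (auto simp: D(1) simp flip: lin_mapD(3)[OF assms(3)] intro!: imageI D(6))
  qed
qed

lemma vimage_submodule:
  assumes "module R M" "module R N" "lin_map R M N f" "submodule H R N"
  shows "submodule {x \<in> carrier M. f x \<in> H} R M"
proof -
  interpret M: module R M by fact
  note D = submoduleD[OF assms(2,4)]
  show ?thesis
    by (rule M.submoduleI)
       (auto simp: lin_mapD[OF assms(3)] lin_map_zero[OF assms(1-3)] lin_map_neg[OF assms(1-3)] intro: D)
qed

lemma zero_submodule:
  assumes "module R M" shows "submodule {\<zero>\<^bsub>M\<^esub>} R M"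
proof -
  interpret M: module R M by fact
  show ?thesis by (rule M.submoduleI) auto
qed

context module begin

text \<open>The coefficient ideal is a parameter because two cases occur: all of
  \<open>carrier R\<close>, to adjoin \<open>b\<close> to \<open>N\<close>, and
  \<open>max_ideal R\<close>, to contain the multiple of such a sum in Nakayama's argument.\<close>

lemma submodule_add_cyclic:
  assumes N: "submodule N R M" and I: "ideal I R" and b: "b \<in> carrier M"
  shows "submodule {n \<oplus>\<^bsub>M\<^esub> r \<odot>\<^bsub>M\<^esub> b | n r. n \<in> N \<and> r \<in> I} R M"
proof -
  interpret I: ideal I R by fact
  note D = submoduleD[OF module_axioms N]
  show ?thesis
  proof (rule submoduleI)
    show "{n \<oplus>\<^bsub>M\<^esub> r \<odot>\<^bsub>M\<^esub> b | n r. n \<in> N \<and> r \<in> I} \<subseteq> carrier M" using b D(1) by auto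
    show "\<zero>\<^bsub>M\<^esub> \<in> {n \<oplus>\<^bsub>M\<^esub> r \<odot>\<^bsub>M\<^esub> b | n r. n \<in> N \<and> r \<in> I}"
      using b D(2) I.zero_closed by (intro CollectI exI[of _ "\<zero>\<^bsub>M\<^esub>"] exI[of _ "\<zero>"]) simp
    show "\<ominus>\<^bsub>M\<^esub> x \<in> {n \<oplus>\<^bsub>M\<^esub> r \<odot>\<^bsub>M\<^esub> b | n r. n \<in> N \<and> r \<in> I}"
      if xS: "x \<in> {n \<oplus>\<^bsub>M\<^esub> r \<odot>\<^bsub>M\<^esub> b | n r. n \<in> N \<and> r \<in> I}" for x
    proof -
      obtain n r where "x = n \<oplus>\<^bsub>M\<^esub> r \<odot>\<^bsub>M\<^esub> b" "n \<in> N" "r \<in> I" using xS by blast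
      then show ?thesis using b D(1,4)
        by (intro CollectI exI[of _ "\<ominus>\<^bsub>M\<^esub> n"] exI[of _ "\<ominus> r"])
           (simp add: M.minus_add smult_l_minus I.a_inv_closed I.Icarr)
    qed
    show "x \<oplus>\<^bsub>M\<^esub> y \<in> {n \<oplus>\<^bsub>M\<^esub> r \<odot>\<^bsub>M\<^esub> b | n r. n \<in> N \<and> r \<in> I}"
      if xS: "x \<in> {n \<oplus>\<^bsub>M\<^esub> r \<odot>\<^bsub>M\<^esub> b | n r. n \<in> N \<and> r \<in> I}" and yS: "y \<in> {n \<oplus>\<^bsub>M\<^esub> r \<odot>\<^bsub>M\<^esub> b | n r. n \<in> N \<and> r \<in> I}" for x y
    proof -
      obtain n r where x: "x = n \<oplus>\<^bsub>M\<^esub> r \<odot>\<^bsub>M\<^esub> b" "n \<in> N" "r \<in> I" using xS by blast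
      obtain n' r' where y: "y = n' \<oplus>\<^bsub>M\<^esub> r' \<odot>\<^bsub>M\<^esub> b" "n' \<in> N" "r' \<in> I" using yS by blast
      have "n \<in> carrier M" "n' \<in> carrier M" "r \<in> carrier R" "r' \<in> carrier R" "r \<odot>\<^bsub>M\<^esub> b \<in> carrier M" "r' \<odot>\<^bsub>M\<^esub> b \<in> carrier M"
        using x y D(1) I.Icarr b by auto
      then have "x \<oplus>\<^bsub>M\<^esub> y = (n \<oplus>\<^bsub>M\<^esub> n') \<oplus>\<^bsub>M\<^esub> (r \<oplus> r') \<odot>\<^bsub>M\<^esub> b"
        unfolding x(1) y(1) using b by (simp add: smult_l_distr M.a_assoc M.a_lcomm)
      then show ?thesis using x y D(3) I.a_closed by blast
    qed
    show "s \<odot>\<^bsub>M\<^esub> x \<in> {n \<oplus>\<^bsub>M\<^esub> r \<odot>\<^bsub>M\<^esub> b | n r. n \<in> N \<and> r \<in> I}"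
      if s: "s \<in> carrier R" and xS: "x \<in> {n \<oplus>\<^bsub>M\<^esub> r \<odot>\<^bsub>M\<^esub> b | n r. n \<in> N \<and> r \<in> I}" for s x
    proof -
      obtain n r where x: "x = n \<oplus>\<^bsub>M\<^esub> r \<odot>\<^bsub>M\<^esub> b" "n \<in> N" "r \<in> I" using xS by blast
      then show ?thesis using s b D(1,6)
        by (intro CollectI exI[of _ "s \<odot>\<^bsub>M\<^esub> n"] exI[of _ "s \<otimes> r"])
           (simp add: smult_r_distr smult_assoc1 I.I_l_closed I.Icarr)
    qed
  qed
qed

end

lemma (in module) submodule_sum:
  assumes H: "submodule H R M" and K: "submodule K R M"
  shows "submodule {x \<oplus>\<^bsub>M\<^esub> y | x y. x \<in> H \<and> y \<in> K} R M" (is "submodule ?S R M")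
proof (rule submoduleI)
  note HD = submoduleD[OF module_axioms H] and KD = submoduleD[OF module_axioms K]
  show "?S \<subseteq> carrier M" using HD(1) KD(1) by auto
  show "\<zero>\<^bsub>M\<^esub> \<in> ?S" using HD(2) KD(2) by (intro CollectI exI[of _ "\<zero>\<^bsub>M\<^esub>"]) simp
  fix a assume "a \<in> ?S"
  then obtain x y where a: "a = x \<oplus>\<^bsub>M\<^esub> y" "x \<in> H" "y \<in> K" by blast
  have c: "x \<in> carrier M" "y \<in> carrier M" using a HD(1) KD(1) by auto
  have "\<ominus>\<^bsub>M\<^esub> a = \<ominus>\<^bsub>M\<^esub> x \<oplus>\<^bsub>M\<^esub> \<ominus>\<^bsub>M\<^esub> y" using c by (simp add: a M.minus_add)
  then show "\<ominus>\<^bsub>M\<^esub> a \<in> ?S" using a HD(4) KD(4) by blast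
  {
    fix b assume "b \<in> ?S"
    then obtain x' y' where b: "b = x' \<oplus>\<^bsub>M\<^esub> y'" "x' \<in> H" "y' \<in> K" by blast
    have "x' \<in> carrier M" "y' \<in> carrier M" using b HD(1) KD(1) by auto
    then have "a \<oplus>\<^bsub>M\<^esub> b = (x \<oplus>\<^bsub>M\<^esub> x') \<oplus>\<^bsub>M\<^esub> (y \<oplus>\<^bsub>M\<^esub> y')" using c by (simp add: a b M.a_ac)
    then show "a \<oplus>\<^bsub>M\<^esub> b \<in> ?S" using a b HD(3) KD(3) by blast
  }
  fix r assume r: "r \<in> carrier R"
  then have "r \<odot>\<^bsub>M\<^esub> a = r \<odot>\<^bsub>M\<^esub> x \<oplus>\<^bsub>M\<^esub> r \<odot>\<^bsub>M\<^esub> y" using c by (simp add: a smult_r_distr)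
  then show "r \<odot>\<^bsub>M\<^esub> a \<in> ?S" using a r HD(6) KD(6) by blast
qed

text \<open>Taken as the least submodule containing the products, instead of as finite sums of them,
  so that an inclusion is checked on single products only.\<close>

definition ideal_smult :: "('r, 'e) ring_scheme \<Rightarrow> ('r, 'a, 'f) module_scheme \<Rightarrow> 'r set \<Rightarrow> 'a set \<Rightarrow> 'a set"
  where "ideal_smult R M I N = \<Inter>{H. submodule H R M \<and> (\<forall>r\<in>I. \<forall>x\<in>N. r \<odot>\<^bsub>M\<^esub> x \<in> H)}"

lemma ideal_smult_in: "r \<in> I \<Longrightarrow> x \<in> N \<Longrightarrow> r \<odot>\<^bsub>M\<^esub> x \<in> ideal_smult R M I N"
  by (auto simp: ideal_smult_def)

lemma ideal_smult_least:
  assumes "submodule H R M" "\<And>r x. r \<in> I \<Longrightarrow> x \<in> N \<Longrightarrow> r \<odot>\<^bsub>M\<^esub> x \<in> H"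
  shows "ideal_smult R M I N \<subseteq> H"
  using assms by (auto simp: ideal_smult_def)

lemma ideal_smult_submodule:
  assumes M: "module R M" and "I \<subseteq> carrier R" "N \<subseteq> carrier M"
  shows "submodule (ideal_smult R M I N) R M"
proof -
  interpret M: module R M by fact
  have "carrier M \<in> {H. submodule H R M \<and> (\<forall>r\<in>I. \<forall>x\<in>N. r \<odot>\<^bsub>M\<^esub> x \<in> H)}"
    using assms M.carrier_is_submodule by auto
  then show ?thesis
    unfolding ideal_smult_def
    by (intro M.submoduleI) (auto simp: submoduleD[OF M])
qed

primrec ideal_pow_smult :: "('r, 'e) ring_scheme \<Rightarrow> ('r, 'a, 'f) module_scheme \<Rightarrow> 'r set \<Rightarrow> nat \<Rightarrow> 'a set"
  where
    "ideal_pow_smult R M I 0 = carrier M"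
  | "ideal_pow_smult R M I (Suc n) = ideal_smult R M I (ideal_pow_smult R M I n)"

text \<open>The elements killed by \<open>I^n\<close>, without forming powers of \<open>I\<close>;
  the recursion runs parallel to \<open>ideal_pow_smult\<close>, with which it is paired by
  induction.\<close>

primrec ideal_torsion :: "('r, 'a, 'f) module_scheme \<Rightarrow> 'r set \<Rightarrow> nat \<Rightarrow> 'a set"
  where
    "ideal_torsion M I 0 = {\<zero>\<^bsub>M\<^esub>}"
  | "ideal_torsion M I (Suc n) = {x \<in> carrier M. \<forall>r\<in>I. r \<odot>\<^bsub>M\<^esub> x \<in> ideal_torsion M I n}"

lemma ideal_pow_smult_submodule:
  assumes M: "module R M" and I: "I \<subseteq> carrier R"
  shows "submodule (ideal_pow_smult R M I n) R M"
proof (induction n)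
  case 0
  interpret M: module R M by fact
  show ?case using M.carrier_is_submodule by simp
next
  case (Suc n)
  then show ?case using submoduleD(1)[OF M Suc] by (auto intro: ideal_smult_submodule[OF M I])
qed

lemma ideal_torsion_carrier:
  assumes "module R M" shows "ideal_torsion M I n \<subseteq> carrier M"
proof -
  interpret M: module R M by fact
  show ?thesis by (cases n) auto
qed

lemma ideal_torsion_Suc:
  assumes M: "module R M" and I: "I \<subseteq> carrier R"
  shows "ideal_torsion M I n \<subseteq> ideal_torsion M I (Suc n)"
proof (induction n)
  case 0
  interpret M: module R M by fact
  show ?case using I by auto
next
  case (Suc n)
  then show ?case by auto
qed

lemma ideal_torsion_mono:
  assumes "module R M" "I \<subseteq> carrier R" "n \<le> k"
  shows "ideal_torsion M I n \<subseteq> ideal_torsion M I k"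
  using assms(3) ideal_torsion_Suc[OF assms(1,2)] by (rule lift_Suc_mono_le[rotated])

text \<open>This bounds the torsion order of \<open>x\<close> by that of \<open>f x\<close>, so that
  an approximation of maps fine enough at \<open>f x\<close> is fine enough at
  \<open>x\<close>.\<close>

lemma ideal_torsion_inj:
  assumes "module R A" "module R B" "lin_map R A B f" "inj_on f (carrier A)" "I \<subseteq> carrier R"
  shows "x \<in> carrier A \<Longrightarrow> f x \<in> ideal_torsion B I n \<Longrightarrow> x \<in> ideal_torsion A I n"
proof (induction n arbitrary: x)
  case 0
  then show ?case using lin_map_inj_zero[OF assms(1-4)] by auto
next
  case (Suc n)
  interpret A: module R A by fact
  show ?case using Suc assms(5) by (auto simp: lin_mapD(3)[OF assms(3)] subset_iff simp flip: lin_mapD(3)[OF assms(3)])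
qed

text \<open>Scalars move across, \<open>(r \<phi>) x = \<phi> (r x)\<close>, so
  \<open>I^n Hom(L, T)\<close> vanishes on what \<open>I^n\<close> kills. For fixed \<open>x\<close>
  the maps vanishing there form a submodule, which reduces each step to single products. Corrections
  from deep layers thus have no effect at a given torsion element.\<close>

lemma ideal_pow_smult_Hom_torsion:
  assumes L: "module R L" and T: "module R T" and I: "I \<subseteq> carrier R"
  shows "\<phi> \<in> ideal_pow_smult R (Hom_mod R L T) I n \<Longrightarrow> x \<in> ideal_torsion L I n \<Longrightarrow> \<phi> x = \<zero>\<^bsub>T\<^esub>"
proof (induction n arbitrary: \<phi> x)
  case 0
  then show ?case using lin_map_zero[OF L T Hom_modD] by auto
next
  case (Suc n)
  let ?M = "Hom_mod R L T"
  interpret T: module R T by fact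
  interpret M: module R ?M by (rule Hom_module[OF L T])
  have xL: "x \<in> carrier L" using Suc.prems(2) by simp
  have ev: "lin_map R ?M T (\<lambda>\<phi>. \<phi> x)"
    using xL by (intro lin_mapI) (auto simp: Hom_mod_simps lin_mapD)
  have "ideal_smult R ?M I (ideal_pow_smult R ?M I n) \<subseteq> {\<phi> \<in> carrier ?M. \<phi> x \<in> {\<zero>\<^bsub>T\<^esub>}}"
  proof (rule ideal_smult_least)
    show "submodule {\<phi> \<in> carrier ?M. \<phi> x \<in> {\<zero>\<^bsub>T\<^esub>}} R ?M"
      by (rule vimage_submodule[OF M.module_axioms T ev zero_submodule[OF T]])
    fix r \<psi> assume r: "r \<in> I" and \<psi>: "\<psi> \<in> ideal_pow_smult R ?M I n"
    have \<psi>M: "\<psi> \<in> carrier ?M" by (rule submoduleD(1)[OF M.module_axioms ideal_pow_smult_submodule[OF M.module_axioms I] \<psi>])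
    have rR: "r \<in> carrier R" using r I by blast
    have "(r \<odot>\<^bsub>?M\<^esub> \<psi>) x = \<psi> (r \<odot>\<^bsub>L\<^esub> x)"
      using xL by (simp add: Hom_mod_simps(4) lin_mapD(3)[OF Hom_modD[OF \<psi>M] rR])
    also have "\<dots> = \<zero>\<^bsub>T\<^esub>" using Suc.IH[OF \<psi>] Suc.prems(2) r by simp
    finally show "r \<odot>\<^bsub>?M\<^esub> \<psi> \<in> {\<phi> \<in> carrier ?M. \<phi> x \<in> {\<zero>\<^bsub>T\<^esub>}}" using rR \<psi>M by simp
  qed
  then show ?case using Suc.prems(1) by auto
qed


subsection \<open>Artinian modules\<close>

lemma artinian_moduleD:
  assumes "artinian_module R M" "\<And>n. submodule (N n) R M" "\<And>n. N (Suc n) \<subseteq> N n"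
  shows "\<exists>k. \<forall>n\<ge>k. N n = N k"
  using assms unfolding artinian_module_def by blast

lemma artinian_submodule:
  assumes B: "artinian_module R B" and A: "module R A" and f: "lin_map R A B f" "inj_on f (carrier A)"
  shows "artinian_module R A"
  unfolding artinian_module_def
proof (intro conjI A allI impI)
  fix N assume N: "(\<forall>n. submodule (N n) R A) \<and> (\<forall>n. N (Suc n) \<subseteq> N n)"
  have Bm: "module R B" using B by (simp add: artinian_module_def)
  have "\<exists>k. \<forall>n\<ge>k. f ` N n = f ` N k"
    using N by (intro artinian_moduleD[OF B] image_submodule[OF A Bm f(1)] image_mono) auto
  then obtain k where k: "\<And>n. n \<ge> k \<Longrightarrow> f ` N n = f ` N k" by blast
  have "N n \<subseteq> carrier A" for n using N submoduleD(1)[OF A] by blast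
  then show "\<exists>k. \<forall>n\<ge>k. N n = N k" using k inj_on_image_eq_iff[OF f(2)] by metis
qed

lemma artinian_quotient:
  assumes B: "artinian_module R B" and C: "module R C" and g: "lin_map R B C g" "g ` carrier B = carrier C"
  shows "artinian_module R C"
  unfolding artinian_module_def
proof (intro conjI C allI impI)
  fix N assume N: "(\<forall>n. submodule (N n) R C) \<and> (\<forall>n. N (Suc n) \<subseteq> N n)"
  have Bm: "module R B" using B by (simp add: artinian_module_def)
  let ?P = "\<lambda>n. {x \<in> carrier B. g x \<in> N n}"
  have "\<And>n. submodule (?P n) R B" using N vimage_submodule[OF Bm C g(1)] by blast
  moreover have "\<And>n. ?P (Suc n) \<subseteq> ?P n" using N by blast
  ultimately have "\<exists>k. \<forall>n\<ge>k. ?P n = ?P k" by (rule artinian_moduleD[OF B])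
  then obtain k where k: "\<And>n. n \<ge> k \<Longrightarrow> ?P n = ?P k" by blast
  have "N n = g ` ?P n" for n
  proof (intro equalityI subsetI)
    fix y assume y: "y \<in> N n"
    then have "y \<in> carrier C" using N submoduleD(1)[OF C] by blast
    then obtain x where "x \<in> carrier B" "y = g x" using g(2) by blast
    then show "y \<in> g ` ?P n" using y by blast
  qed auto
  then show "\<exists>k. \<forall>n\<ge>k. N n = N k" using k by metis
qed

text \<open>A chain is controlled by its preimages in \<open>A\<close> and its images in
  \<open>C\<close>. Once both are stationary, an element \<open>y\<close> of an earlier member
  differs from some \<open>z\<close> of a later one by an \<open>f x\<close> that already lies in
  the later one.\<close>

lemma artinian_extension:
  assumes A: "artinian_module R A" and C: "artinian_module R C" and B: "module R B"
    and ses: "short_exact R A f B g C"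
  shows "artinian_module R B"
  unfolding artinian_module_def
proof (intro conjI B allI impI)
  fix N assume N: "(\<forall>n. submodule (N n) R B) \<and> (\<forall>n. N (Suc n) \<subseteq> N n)"
  have Am: "module R A" and Cm: "module R C" using A C by (simp_all add: artinian_module_def)
  interpret B: module R B by fact
  interpret C: module R C by fact
  note f = short_exactD(1)[OF ses] and g = short_exactD(2)[OF ses]
  let ?P = "\<lambda>n. {x \<in> carrier A. f x \<in> N n}" and ?Q = "\<lambda>n. g ` N n"
  have "\<And>n. submodule (?P n) R A" using N vimage_submodule[OF Am B f] by blast
  moreover have "\<And>n. ?P (Suc n) \<subseteq> ?P n" using N by blast
  ultimately have "\<exists>k. \<forall>n\<ge>k. ?P n = ?P k" by (rule artinian_moduleD[OF A])
  then obtain k where k: "\<And>n. n \<ge> k \<Longrightarrow> ?P n = ?P k" by blast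
  have "\<And>n. submodule (?Q n) R C" using N image_submodule[OF B Cm g] by blast
  moreover have "\<And>n. ?Q (Suc n) \<subseteq> ?Q n" using N by blast
  ultimately have "\<exists>k. \<forall>n\<ge>k. ?Q n = ?Q k" by (rule artinian_moduleD[OF C])
  then obtain l where l: "\<And>n. n \<ge> l \<Longrightarrow> ?Q n = ?Q l" by blast
  let ?m = "max k l"
  have "N n = N ?m" if n: "n \<ge> ?m" for n
  proof
    show sub: "N n \<subseteq> N ?m" using lift_Suc_antimono_le[of N] N n by blast
    have sN: "submodule (N n) R B" "submodule (N ?m) R B" using N by auto
    show "N ?m \<subseteq> N n"
    proof
      fix y assume y: "y \<in> N ?m"
      have "?Q ?m = ?Q n" by (rule trans[OF l l[symmetric]]) (use n in auto)
      then obtain z where z: "z \<in> N n" "g y = g z" using y by (metis imageE imageI)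
      have c: "y \<in> carrier B" "z \<in> carrier B" using y z submoduleD(1)[OF B] sN by auto
      have d: "y \<ominus>\<^bsub>B\<^esub> z \<in> N ?m" using y z sub submoduleD(5)[OF B sN(2)] by blast
      have "g (y \<ominus>\<^bsub>B\<^esub> z) = \<zero>\<^bsub>C\<^esub>"
        using c z(2) lin_mapD(1)[OF g] by (simp add: lin_map_minus[OF B Cm g] C.minus_eq_zero_iff)
      then obtain x where x: "x \<in> carrier A" "y \<ominus>\<^bsub>B\<^esub> z = f x" using c short_exactD(5)[OF ses] by auto
      have "?P ?m = ?P n" by (rule trans[OF k k[symmetric]]) (use n in auto)
      moreover have "x \<in> ?P ?m" using x d by simp
      ultimately have "f x \<in> N n" by blast
      then have "f x \<oplus>\<^bsub>B\<^esub> z \<in> N n" using z submoduleD(3)[OF B sN(1)] by blast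
      then show "y \<in> N n" using c by (simp add: a_minus_def B.a_assoc B.l_neg flip: x(2))
    qed
  qed
  then show "\<exists>k. \<forall>n\<ge>k. N n = N k" by blast
qed

subsection \<open>Nakayama and the extension of homomorphisms\<close>

context noetherian_local_ring begin

text \<open>Submodules \<open>N\<close> of \<open>R x\<close> are determined by the ideals
  \<open>J N\<close>, so the noetherian ring provides a maximal proper submodule \<open>N\<close> of
  \<open>D\<close>; this replaces a finite generating set. Then \<open>D\<close> is generated by
  \<open>N\<close> and one element \<open>b\<close>, and \<open>D\<close> being its own multiple by
  \<open>max_ideal R\<close> forces \<open>b = n + r b\<close> with \<open>1 - r\<close> invertible,
  hence \<open>b\<close> in \<open>N\<close>.\<close>

lemma cyclic_nakayama:
  assumes M: "module R M" and x: "x \<in> carrier M" and D: "submodule D R M" "D \<subseteq> (\<lambda>r. r \<odot>\<^bsub>M\<^esub> x) ` carrier R"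
    and eq: "ideal_smult R M (max_ideal R) D = D"
  shows "D = {\<zero>\<^bsub>M\<^esub>}"
proof (rule ccontr)
  assume ne: "D \<noteq> {\<zero>\<^bsub>M\<^esub>}"
  interpret M: module R M by fact
  note DD = submoduleD[OF M D(1)]
  define J where "J N = {r \<in> carrier R. r \<odot>\<^bsub>M\<^esub> x \<in> N}" for N
  have J: "ideal (J N) R" if N: "submodule N R M" for N
  proof (rule idealI[OF ring_axioms])
    note ND = submoduleD[OF M N]
    show "subgroup (J N) (add_monoid R)"
    proof (rule add.subgroupI)
      show "J N \<noteq> {}" using ND(2) x by (auto simp: J_def intro!: exI[of _ \<zero>])
    qed (auto simp: J_def M.smult_l_minus M.smult_l_distr x ND simp flip: a_inv_def)
    show "r \<otimes> a \<in> J N" if "a \<in> J N" "r \<in> carrier R" for a r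
      using that ND(6) x by (auto simp: J_def M.smult_assoc1)
    then show "a \<otimes> r \<in> J N" if "a \<in> J N" "r \<in> carrier R" for a r
      using that m_comm[of a r] by (auto simp: J_def)
  qed
  let ?S = "{J N | N. submodule N R M \<and> N \<subset> D}"
  have "J {\<zero>\<^bsub>M\<^esub>} \<in> ?S" using zero_submodule[OF M] DD(2) ne by blast
  then obtain I where I: "I \<in> ?S" "\<And>I'. I' \<in> ?S \<Longrightarrow> I \<subseteq> I' \<Longrightarrow> I' = I"
    using maximal_ideal_in[of ?S] J by (smt (verit) empty_iff mem_Collect_eq)
  then obtain N where N: "submodule N R M" "N \<subset> D" "I = J N" by blast
  note ND = submoduleD[OF M N(1)]
  obtain b where b: "b \<in> D" "b \<notin> N" using N(2) by blast
  then obtain s where s: "s \<in> carrier R" "b = s \<odot>\<^bsub>M\<^esub> x" using D(2) by blast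
  have bM: "b \<in> carrier M" using b DD(1) by blast
  define N' where "N' = {n \<oplus>\<^bsub>M\<^esub> r \<odot>\<^bsub>M\<^esub> b | n r. n \<in> N \<and> r \<in> carrier R}"
  have N': "submodule N' R M" unfolding N'_def by (rule M.submodule_add_cyclic[OF N(1) oneideal bM])
  have sub: "N \<subseteq> N'"
  proof
    fix n assume "n \<in> N"
    then show "n \<in> N'" unfolding N'_def using bM ND(1) by (intro CollectI exI[of _ n] exI[of _ \<zero>]) simp
  qed
  have bN': "b \<in> N'"
    unfolding N'_def using bM ND(2) by (intro CollectI exI[of _ "\<zero>\<^bsub>M\<^esub>"] exI[of _ \<one>]) simp
  have "N' \<subseteq> D" unfolding N'_def using N(2) b DD(3,6) by auto
  \<comment> \<open>Writing \<open>b = s x\<close> shows that \<open>s\<close> lies in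
    \<open>J N'\<close> but not in \<open>J N\<close>, against maximality.\<close>
  moreover have "\<not> N' \<subset> D"
  proof
    assume "N' \<subset> D"
    then have "J N' = I" using I(2)[of "J N'"] N' sub N(3) by (auto simp: J_def)
    then show False using s bN' b(2) N(3) by (auto simp: J_def)
  qed
  ultimately have D_eq: "D = N'" by blast
  let ?H = "{n \<oplus>\<^bsub>M\<^esub> r \<odot>\<^bsub>M\<^esub> b | n r. n \<in> N \<and> r \<in> max_ideal R}"
  have "ideal_smult R M (max_ideal R) D \<subseteq> ?H"
  proof (rule ideal_smult_least)
    show "submodule ?H R M" by (rule M.submodule_add_cyclic[OF N(1) max_ideal_ideal bM])
    fix r y assume r: "r \<in> max_ideal R" and "y \<in> D"
    then obtain n t where y: "y = n \<oplus>\<^bsub>M\<^esub> t \<odot>\<^bsub>M\<^esub> b" "n \<in> N" "t \<in> carrier R" by (auto simp: D_eq N'_def)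
    have "r \<odot>\<^bsub>M\<^esub> y = r \<odot>\<^bsub>M\<^esub> n \<oplus>\<^bsub>M\<^esub> (r \<otimes> t) \<odot>\<^bsub>M\<^esub> b"
      using y bM ND(1) max_ideal_carrier[OF r] by (simp add: M.smult_r_distr M.smult_assoc1)
    moreover have "r \<otimes> t \<in> max_ideal R" by (rule ideal.I_r_closed[OF max_ideal_ideal r y(3)])
    moreover have "r \<odot>\<^bsub>M\<^esub> n \<in> N" by (rule ND(6)[OF max_ideal_carrier[OF r] y(2)])
    ultimately show "r \<odot>\<^bsub>M\<^esub> y \<in> ?H" by blast
  qed
  then obtain n r where nr: "b = n \<oplus>\<^bsub>M\<^esub> r \<odot>\<^bsub>M\<^esub> b" "n \<in> N" "r \<in> max_ideal R" using b(1) eq by blast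
  have rR: "r \<in> carrier R" by (rule max_ideal_carrier[OF nr(3)])
  obtain u where u: "u \<in> carrier R" "u \<otimes> (\<one> \<ominus> r) = \<one>"
    using unit_if_not_in_max_ideal[OF _ one_minus_not_in_max_ideal[OF nr(3)]] rR by auto
  have nM: "n \<in> carrier M" by (rule ND(1)[OF nr(2)])
  have "(\<one> \<ominus> r) \<odot>\<^bsub>M\<^esub> b = b \<ominus>\<^bsub>M\<^esub> r \<odot>\<^bsub>M\<^esub> b"
    using rR bM by (simp add: a_minus_def M.smult_l_distr M.smult_l_minus)
  also have "\<dots> = (n \<oplus>\<^bsub>M\<^esub> r \<odot>\<^bsub>M\<^esub> b) \<ominus>\<^bsub>M\<^esub> r \<odot>\<^bsub>M\<^esub> b" using nr(1) by simp
  also have "\<dots> = n" using nM rR bM by (simp add: a_minus_def M.a_assoc M.r_neg)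
  finally have "b = u \<odot>\<^bsub>M\<^esub> n"
    using u rR bM M.smult_assoc1[of u "\<one> \<ominus> r" b] by simp
  then show False using ND(6)[OF u(1) nr(2)] b(2) by simp
qed

text \<open>The submodules \<open>m^n R x\<close>, with \<open>m\<close> the maximal ideal, become
  stationary because \<open>M\<close> is artinian, and \<open>cyclic_nakayama\<close> makes the
  final one zero.\<close>

lemma artinian_torsion:
  assumes art: "artinian_module R M" and x: "x \<in> carrier M"
  shows "\<exists>n. x \<in> ideal_torsion M (max_ideal R) n"
proof -
  let ?m = "max_ideal R"
  have M: "module R M" using art by (simp add: artinian_module_def)
  interpret M: module R M by (rule M)
  have mR: "?m \<subseteq> carrier R" using max_ideal_carrier by blast
  \<comment> \<open>The recursion starts at \<open>R x\<close>, unlike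
    \<open>ideal_pow_smult\<close>, which starts at the whole module: all stages must lie in a
    cyclic module for \<open>cyclic_nakayama\<close>.\<close>
  define D where "D = rec_nat ((\<lambda>r. r \<odot>\<^bsub>M\<^esub> x) ` carrier R) (\<lambda>_. ideal_smult R M ?m)"
  have D0: "D 0 = (\<lambda>r. r \<odot>\<^bsub>M\<^esub> x) ` carrier R" and DS: "D (Suc n) = ideal_smult R M ?m (D n)" for n
    by (simp_all add: D_def)
  have sub: "submodule (D n) R M" for n
  proof (induction n)
    case 0
    have "submodule {n \<oplus>\<^bsub>M\<^esub> r \<odot>\<^bsub>M\<^esub> x | n r. n \<in> {\<zero>\<^bsub>M\<^esub>} \<and> r \<in> carrier R} R M"
      by (rule M.submodule_add_cyclic[OF zero_submodule[OF M] oneideal x])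
    moreover have "{n \<oplus>\<^bsub>M\<^esub> r \<odot>\<^bsub>M\<^esub> x | n r. n \<in> {\<zero>\<^bsub>M\<^esub>} \<and> r \<in> carrier R} = D 0"
    proof (intro equalityI subsetI)
      fix y assume "y \<in> D 0"
      then obtain r where "r \<in> carrier R" "y = r \<odot>\<^bsub>M\<^esub> x" by (auto simp: D0)
      then show "y \<in> {n \<oplus>\<^bsub>M\<^esub> r \<odot>\<^bsub>M\<^esub> x | n r. n \<in> {\<zero>\<^bsub>M\<^esub>} \<and> r \<in> carrier R}"
        using x by (intro CollectI exI[of _ "\<zero>\<^bsub>M\<^esub>"] exI[of _ r]) simp
    qed (use x in \<open>auto simp: D0\<close>)
    ultimately show ?case by simp
  next
    case (Suc n)
    show ?case unfolding DS using submoduleD(1)[OF M Suc] by (intro ideal_smult_submodule[OF M mR]) blast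
  qed
  have desc: "D (Suc n) \<subseteq> D n" for n
    unfolding DS by (rule ideal_smult_least[OF sub]) (use submoduleD(6)[OF M sub] mR in blast)
  obtain k where k: "\<And>n. n \<ge> k \<Longrightarrow> D n = D k" using artinian_moduleD[OF art, of D, OF sub desc] by blast
  have "D k \<subseteq> D 0" using lift_Suc_antimono_le[of D 0 k, OF desc] by simp
  moreover have "ideal_smult R M ?m (D k) = D k" using k[of "Suc k"] DS[of k] by simp
  ultimately have Dk: "D k = {\<zero>\<^bsub>M\<^esub>}" unfolding D0 by (rule cyclic_nakayama[OF M x sub])
  \<comment> \<open>Induction backwards from the zero stage \<open>k\<close>; the guard
    \<open>i \<le> k\<close> keeps the subtraction from being truncated, and \<open>i = k\<close>
    reaches \<open>D 0\<close>, which contains \<open>x\<close>.\<close>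
  have "i \<le> k \<Longrightarrow> D (k - i) \<subseteq> ideal_torsion M ?m i" for i
  proof (induction i)
    case 0
    then show ?case using Dk by simp
  next
    case (Suc i)
    then have "D (Suc (k - Suc i)) \<subseteq> ideal_torsion M ?m i" by (simp add: Suc_diff_Suc)
    then show ?case
      unfolding DS using submoduleD(1)[OF M sub] by (auto intro: ideal_smult_in subsetD)
  qed
  from this[of k] have "D 0 \<subseteq> ideal_torsion M ?m k" by simp
  moreover have "x \<in> D 0" using x by (auto simp: D0 image_def intro!: bexI[of _ \<one>])
  ultimately show ?thesis by blast
qed

text \<open>As long as some element of the maximal ideal has a nonzero product with
  \<open>t\<close>, that product replaces \<open>t\<close>; the torsion order drops, so this ends in
  the socle.\<close>

lemma socle_element:
  assumes "module R T"
  shows "t \<in> ideal_torsion T (max_ideal R) n \<Longrightarrow> t \<noteq> \<zero>\<^bsub>T\<^esub> \<Longrightarrow>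
    \<exists>s\<in>carrier T. s \<noteq> \<zero>\<^bsub>T\<^esub> \<and> (\<forall>r\<in>max_ideal R. r \<odot>\<^bsub>T\<^esub> s = \<zero>\<^bsub>T\<^esub>)"
proof (induction n arbitrary: t)
  case (Suc n)
  show ?case
  proof (cases "\<forall>r\<in>max_ideal R. r \<odot>\<^bsub>T\<^esub> t = \<zero>\<^bsub>T\<^esub>")
    case True
    then show ?thesis using Suc.prems by auto
  next
    case False
    then show ?thesis using Suc by auto
  qed
qed auto

text \<open>Modulo \<open>W\<close> the module is a vector space over the residue field, and
  \<open>h\<close> reads off a coordinate in direction \<open>v\<close>. No quotient is formed: a
  submodule \<open>U\<close> maximal among those containing \<open>W\<close> and missing
  \<open>v\<close> plays the hyperplane, the coefficient of \<open>v\<close> is unique modulo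
  \<open>max_ideal R\<close>, and \<open>t\<close> is killed by that ambiguity.\<close>

lemma functional_exists:
  assumes M: "module R M" and T: "module R T" and W: "submodule W R M"
    and mW: "\<And>r y. r \<in> max_ideal R \<Longrightarrow> y \<in> carrier M \<Longrightarrow> r \<odot>\<^bsub>M\<^esub> y \<in> W"
    and v: "v \<in> carrier M" "v \<notin> W" and t: "t \<in> carrier T" "\<And>r. r \<in> max_ideal R \<Longrightarrow> r \<odot>\<^bsub>T\<^esub> t = \<zero>\<^bsub>T\<^esub>"
  shows "\<exists>h. lin_map R M T h \<and> (\<forall>y\<in>W. h y = \<zero>\<^bsub>T\<^esub>) \<and> h v = t"
proof -
  interpret M: module R M by fact
  interpret T: module R T by fact
  let ?S = "{U. submodule U R M \<and> W \<subseteq> U \<and> v \<notin> U}"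
  have "\<exists>U\<in>?S. \<forall>U'\<in>?S. U \<subseteq> U' \<longrightarrow> U' = U"
  proof (rule subset_Zorn_nonempty)
    show "?S \<noteq> {}" using W v by blast
    fix C assume C: "C \<noteq> {}" "subset.chain ?S C"
    have CS: "submodule U R M" "W \<subseteq> U" "v \<notin> U" if "U \<in> C" for U using C(2) that by (auto simp: subset.chain_def)
    have common: "\<exists>U\<in>C. y \<in> U \<and> z \<in> U" if yz: "y \<in> \<Union>C" "z \<in> \<Union>C" for y z
    proof -
      obtain Y Z where YZ: "Y \<in> C" "Z \<in> C" "y \<in> Y" "z \<in> Z" using yz by blast
      then have "Y \<subseteq> Z \<or> Z \<subseteq> Y" using C(2) by (auto simp: subset.chain_def)
      then show ?thesis using YZ by blast
    qed
    have "submodule (\<Union>C) R M"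
    proof (rule M.submoduleI)
      fix y z assume "y \<in> \<Union>C" "z \<in> \<Union>C"
      then obtain U where "U \<in> C" "y \<in> U" "z \<in> U" using common by blast
      then show "y \<oplus>\<^bsub>M\<^esub> z \<in> \<Union>C" using submoduleD(3)[OF M CS(1)] by blast
    qed (use C(1) submoduleD(1,2,4,6)[OF M CS(1)] in blast)+
    then show "\<Union>C \<in> ?S" using CS C(1) by blast
  qed
  then obtain U where U: "submodule U R M" "W \<subseteq> U" "v \<notin> U"
    and max: "\<And>U'. submodule U' R M \<Longrightarrow> U \<subseteq> U' \<Longrightarrow> v \<notin> U' \<Longrightarrow> U' = U"
    by auto
  note UD = submoduleD[OF M U(1)]
  have in_m: "r \<in> max_ideal R" if r: "r \<in> carrier R" "r \<odot>\<^bsub>M\<^esub> v \<in> U" for r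
  proof (rule ccontr)
    assume "r \<notin> max_ideal R"
    then obtain s where s: "s \<in> carrier R" "s \<otimes> r = \<one>" using unit_if_not_in_max_ideal[OF r(1)] by blast
    have "s \<odot>\<^bsub>M\<^esub> (r \<odot>\<^bsub>M\<^esub> v) = v" using s r(1) v(1) by (simp flip: M.smult_assoc1)
    then show False using UD(6)[OF s(1) r(2)] U(3) by simp
  qed
  \<comment> \<open>If \<open>w\<close> is not in \<open>U\<close>, maximality puts \<open>v\<close>
    in \<open>U + R w\<close>. The coefficient of \<open>w\<close> is a unit, since otherwise its
    product with \<open>w\<close> would lie in \<open>W\<close> and so \<open>v\<close> in
    \<open>U\<close>; hence the relation can be solved for \<open>w\<close>.\<close>
  have rep: "\<exists>u r. u \<in> U \<and> r \<in> carrier R \<and> w = u \<oplus>\<^bsub>M\<^esub> r \<odot>\<^bsub>M\<^esub> v" if w: "w \<in> carrier M" for w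
  proof (cases "w \<in> U")
    case True
    then show ?thesis using w v by (intro exI[of _ w] exI[of _ \<zero>]) simp
  next
    case False
    let ?U = "{n \<oplus>\<^bsub>M\<^esub> r \<odot>\<^bsub>M\<^esub> w | n r. n \<in> U \<and> r \<in> carrier R}"
    have sub: "submodule ?U R M" by (rule M.submodule_add_cyclic[OF U(1) oneideal w])
    have "w \<in> ?U" using w UD(2) by (intro CollectI exI[of _ "\<zero>\<^bsub>M\<^esub>"] exI[of _ \<one>]) simp
    moreover have "U \<subseteq> ?U"
    proof
      fix u assume "u \<in> U"
      then show "u \<in> ?U" using w UD(1) by (intro CollectI exI[of _ u] exI[of _ \<zero>]) simp
    qed
    ultimately have "v \<in> ?U" using max[OF sub] False by blast
    then obtain u r where ur: "v = u \<oplus>\<^bsub>M\<^esub> r \<odot>\<^bsub>M\<^esub> w" "u \<in> U" "r \<in> carrier R" by blast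
    have "r \<notin> max_ideal R"
    proof
      assume "r \<in> max_ideal R"
      then have "r \<odot>\<^bsub>M\<^esub> w \<in> U" using mW w U(2) by blast
      then show False using UD(3)[OF ur(2)] ur(1) U(3) by simp
    qed
    then obtain s where s: "s \<in> carrier R" "s \<otimes> r = \<one>" using unit_if_not_in_max_ideal[OF ur(3)] by blast
    have uM: "u \<in> carrier M" by (rule UD(1)[OF ur(2)])
    have "s \<odot>\<^bsub>M\<^esub> v = s \<odot>\<^bsub>M\<^esub> u \<oplus>\<^bsub>M\<^esub> w"
      unfolding ur(1) using s ur(3) uM w by (simp add: M.smult_r_distr flip: M.smult_assoc1)
    then have "w = \<ominus>\<^bsub>M\<^esub> (s \<odot>\<^bsub>M\<^esub> u) \<oplus>\<^bsub>M\<^esub> s \<odot>\<^bsub>M\<^esub> v" using s uM w by (simp add: M.r_neg1)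
    moreover have "\<ominus>\<^bsub>M\<^esub> (s \<odot>\<^bsub>M\<^esub> u) \<in> U" by (rule UD(4)[OF UD(6)[OF s(1) ur(2)]])
    ultimately show ?thesis using s(1) by blast
  qed
  \<comment> \<open>The coefficient \<open>c w\<close> depends on the choice, but by
    \<open>uniq\<close> its product with \<open>t\<close> does not.\<close>
  define c where "c w = (SOME r. r \<in> carrier R \<and> (\<exists>u\<in>U. w = u \<oplus>\<^bsub>M\<^esub> r \<odot>\<^bsub>M\<^esub> v))" for w
  have uniq: "r' \<odot>\<^bsub>T\<^esub> t = r \<odot>\<^bsub>T\<^esub> t"
    if u: "u \<in> U" "u' \<in> U" and r: "r \<in> carrier R" "r' \<in> carrier R"
      and eq: "u \<oplus>\<^bsub>M\<^esub> r \<odot>\<^bsub>M\<^esub> v = u' \<oplus>\<^bsub>M\<^esub> r' \<odot>\<^bsub>M\<^esub> v" for u u' r r'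
  proof -
    have cl: "u \<in> carrier M" "u' \<in> carrier M" "r \<odot>\<^bsub>M\<^esub> v \<in> carrier M" "r' \<odot>\<^bsub>M\<^esub> v \<in> carrier M"
      using UD(1) u r v by auto
    have "\<ominus>\<^bsub>M\<^esub> u' \<oplus>\<^bsub>M\<^esub> u \<oplus>\<^bsub>M\<^esub> r \<odot>\<^bsub>M\<^esub> v = \<ominus>\<^bsub>M\<^esub> u' \<oplus>\<^bsub>M\<^esub> (u' \<oplus>\<^bsub>M\<^esub> r' \<odot>\<^bsub>M\<^esub> v)"
      using cl by (simp add: M.a_assoc eq)
    also have "\<dots> = r' \<odot>\<^bsub>M\<^esub> v" using cl by (simp add: M.r_neg1)
    finally have e: "r' \<odot>\<^bsub>M\<^esub> v = \<ominus>\<^bsub>M\<^esub> u' \<oplus>\<^bsub>M\<^esub> u \<oplus>\<^bsub>M\<^esub> r \<odot>\<^bsub>M\<^esub> v" by simp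
    have "(r' \<ominus> r) \<odot>\<^bsub>M\<^esub> v = r' \<odot>\<^bsub>M\<^esub> v \<ominus>\<^bsub>M\<^esub> r \<odot>\<^bsub>M\<^esub> v"
      using r v by (simp add: a_minus_def M.smult_l_distr M.smult_l_minus)
    also have "\<dots> = \<ominus>\<^bsub>M\<^esub> u' \<oplus>\<^bsub>M\<^esub> u" unfolding e using cl by (simp add: a_minus_def M.a_assoc M.r_neg)
    finally have "(r' \<ominus> r) \<odot>\<^bsub>M\<^esub> v \<in> U" using UD(3)[OF UD(4)[OF u(2)] u(1)] by simp
    then have "(r' \<ominus> r) \<odot>\<^bsub>T\<^esub> t = \<zero>\<^bsub>T\<^esub>" using in_m[of "r' \<ominus> r"] t(2) r by simp
    then have "r' \<odot>\<^bsub>T\<^esub> t \<ominus>\<^bsub>T\<^esub> r \<odot>\<^bsub>T\<^esub> t = \<zero>\<^bsub>T\<^esub>"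
      using r t by (simp add: a_minus_def T.smult_l_distr T.smult_l_minus)
    then show ?thesis using r t by (simp add: T.minus_eq_zero_iff)
  qed
  have hc: "c (u \<oplus>\<^bsub>M\<^esub> r \<odot>\<^bsub>M\<^esub> v) \<odot>\<^bsub>T\<^esub> t = r \<odot>\<^bsub>T\<^esub> t" if u: "u \<in> U" and r: "r \<in> carrier R" for u r
    unfolding c_def by (rule someI2[of _ r]) (use u r uniq in blast)+
  let ?h = "\<lambda>w. c w \<odot>\<^bsub>T\<^esub> t"
  have "lin_map R M T ?h"
  proof (rule lin_mapI)
    fix w assume "w \<in> carrier M"
    then obtain u r where w: "w = u \<oplus>\<^bsub>M\<^esub> r \<odot>\<^bsub>M\<^esub> v" "u \<in> U" "r \<in> carrier R" using rep by blast
    show "?h w \<in> carrier T" unfolding w(1) hc[OF w(2,3)] using w(3) t by simp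
    fix s assume s: "s \<in> carrier R"
    have "s \<odot>\<^bsub>M\<^esub> w = s \<odot>\<^bsub>M\<^esub> u \<oplus>\<^bsub>M\<^esub> (s \<otimes> r) \<odot>\<^bsub>M\<^esub> v"
      using w s v UD(1) by (simp add: M.smult_r_distr M.smult_assoc1)
    then have "?h (s \<odot>\<^bsub>M\<^esub> w) = (s \<otimes> r) \<odot>\<^bsub>T\<^esub> t" using hc[OF UD(6)[OF s w(2)], of "s \<otimes> r"] s w(3) by simp
    then show "?h (s \<odot>\<^bsub>M\<^esub> w) = s \<odot>\<^bsub>T\<^esub> ?h w" unfolding w(1) hc[OF w(2,3)] using s w(3) t by (simp add: T.smult_assoc1)
  next
    fix w z assume "w \<in> carrier M" "z \<in> carrier M"
    then obtain u r u' r' where w: "w = u \<oplus>\<^bsub>M\<^esub> r \<odot>\<^bsub>M\<^esub> v" "u \<in> U" "r \<in> carrier R"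
      and z: "z = u' \<oplus>\<^bsub>M\<^esub> r' \<odot>\<^bsub>M\<^esub> v" "u' \<in> U" "r' \<in> carrier R" using rep by meson
    have cl: "u \<in> carrier M" "u' \<in> carrier M" "r \<odot>\<^bsub>M\<^esub> v \<in> carrier M" "r' \<odot>\<^bsub>M\<^esub> v \<in> carrier M"
      using UD(1) w z v by auto
    have "w \<oplus>\<^bsub>M\<^esub> z = (u \<oplus>\<^bsub>M\<^esub> u') \<oplus>\<^bsub>M\<^esub> (r \<oplus> r') \<odot>\<^bsub>M\<^esub> v"
      unfolding w(1) z(1) using cl w(3) z(3) v by (simp add: M.smult_l_distr M.a_assoc M.a_lcomm)
    then have "?h (w \<oplus>\<^bsub>M\<^esub> z) = (r \<oplus> r') \<odot>\<^bsub>T\<^esub> t" using hc[OF UD(3)[OF w(2) z(2)], of "r \<oplus> r'"] w(3) z(3) by simp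
    then show "?h (w \<oplus>\<^bsub>M\<^esub> z) = ?h w \<oplus>\<^bsub>T\<^esub> ?h z"
      unfolding w(1) z(1) hc[OF w(2,3)] hc[OF z(2,3)] using w(3) z(3) t by (simp add: T.smult_l_distr)
  qed
  moreover have "?h y = \<zero>\<^bsub>T\<^esub>" if "y \<in> W" for y
  proof -
    have y: "y \<in> U" "y \<in> carrier M" using that U(2) UD(1) by auto
    show ?thesis using hc[OF y(1), of \<zero>] y(2) v t by simp
  qed
  moreover have "?h v = t" using hc[OF UD(2), of \<one>] v t by simp
  ultimately show ?thesis by blast
qed

text \<open>If \<open>Hom(B, T) \<rightarrow> Hom(A, T)\<close> were not surjective modulo \<open>\<mm>\<close>, a functional separating its image
  would be evaluation at some \<open>x \<in> A\<close>, and \<open>f x\<close> would die under biduality.\<close>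

lemma dual_map_surj_mod_max_ideal:
  assumes A: "module R A" and B: "module R B" and T: "artinian_module R T"
    and f: "lin_map R A B f" "inj_on f (carrier A)"
    and bA: "biduality R A T ` carrier A = carrier (Hom_mod R (Hom_mod R A T) T)"
    and bB: "inj_on (biduality R B T) (carrier B)"
    and \<phi>: "\<phi> \<in> carrier (Hom_mod R A T)"
  shows "\<exists>\<psi>\<in>carrier (Hom_mod R B T).
    \<phi> \<ominus>\<^bsub>Hom_mod R A T\<^esub> dual_map A f \<psi>
      \<in> ideal_smult R (Hom_mod R A T) (max_ideal R) (carrier (Hom_mod R A T))"
proof -
  let ?M = "Hom_mod R A T" and ?P = "Hom_mod R B T" and ?F = "dual_map A f"
  let ?Y = "ideal_smult R ?M (max_ideal R) (carrier ?M)"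
  have Tm: "module R T" using T by (simp add: artinian_module_def)
  interpret A: module R A by fact
  interpret T: module R T by (rule Tm)
  interpret M: module R ?M by (rule Hom_module[OF A Tm])
  interpret P: module R ?P by (rule Hom_module[OF B Tm])
  have F: "lin_map R ?P ?M ?F" by (rule dual_map_lin[OF A f(1)])
  have sN: "submodule (?F ` carrier ?P) R ?M"
    by (rule image_submodule[OF P.module_axioms M.module_axioms F P.carrier_is_submodule])
  have sY: "submodule ?Y R ?M"
    using max_ideal_carrier by (intro ideal_smult_submodule M.module_axioms) auto
  note ND = submoduleD[OF M.module_axioms sN] and YD = submoduleD[OF M.module_axioms sY]
  define W where "W = {n \<oplus>\<^bsub>?M\<^esub> y | n y. n \<in> ?F ` carrier ?P \<and> y \<in> ?Y}"
  have sW: "submodule W R ?M" unfolding W_def by (rule M.submodule_sum[OF sN sY])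
  have YW: "y \<in> W" if "y \<in> ?Y" for y
    unfolding W_def using that YD(1) ND(2) by (intro CollectI exI[of _ "\<zero>\<^bsub>?M\<^esub>"] exI[of _ y]) simp
  have NW: "n \<in> W" if "n \<in> ?F ` carrier ?P" for n
    unfolding W_def using that ND(1) YD(2) by (intro CollectI exI[of _ n] exI[of _ "\<zero>\<^bsub>?M\<^esub>"]) simp
  have "\<phi> \<in> W"
  proof (rule ccontr)
    assume nW: "\<phi> \<notin> W"
    \<comment> \<open>A nonzero socle element of \<open>T\<close> must be found first. Lying outside
      \<open>W\<close>, the map \<open>\<phi>\<close> is nonzero, and a nonzero value of it is
      driven into the socle.\<close>
    have "\<exists>x\<in>carrier A. \<phi> x \<noteq> \<zero>\<^bsub>T\<^esub>"
    proof (rule ccontr)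
      assume "\<not> ?thesis"
      then have "\<phi> = \<zero>\<^bsub>?M\<^esub>" by (intro Hom_mod_eqI[OF \<phi> M.zero_closed]) (simp add: Hom_mod_simps(2))
      then show False using nW submoduleD(2)[OF M.module_axioms sW] by simp
    qed
    then obtain x0 where "x0 \<in> carrier A" "\<phi> x0 \<noteq> \<zero>\<^bsub>T\<^esub>" by blast
    moreover from this have "\<phi> x0 \<in> carrier T" using lin_mapD(1)[OF Hom_modD[OF \<phi>]] by blast
    ultimately obtain t where t: "t \<in> carrier T" "t \<noteq> \<zero>\<^bsub>T\<^esub>" "\<And>r. r \<in> max_ideal R \<Longrightarrow> r \<odot>\<^bsub>T\<^esub> t = \<zero>\<^bsub>T\<^esub>"
      using artinian_torsion[OF T] socle_element[OF Tm] by metis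
    have "r \<odot>\<^bsub>?M\<^esub> y \<in> W" if "r \<in> max_ideal R" "y \<in> carrier ?M" for r y
      by (rule YW[OF ideal_smult_in[OF that]])
    then obtain h where h: "lin_map R ?M T h" "\<And>y. y \<in> W \<Longrightarrow> h y = \<zero>\<^bsub>T\<^esub>" "h \<phi> = t"
      using functional_exists[OF M.module_axioms Tm sW _ \<phi> nW t(1,3)] by blast
    have "restrict h (carrier ?M) \<in> biduality R A T ` carrier A"
      unfolding bA by (rule restrict_in_Hom[OF M.module_axioms h(1)])
    then obtain x where x: "x \<in> carrier A" "restrict h (carrier ?M) = biduality R A T x" by blast
    have hx: "h \<chi> = \<chi> x" if "\<chi> \<in> carrier ?M" for \<chi>
      using fun_cong[OF x(2), of \<chi>] that by (simp add: biduality_def)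
    have fx: "f x \<in> carrier B" by (rule lin_mapD(1)[OF f(1) x(1)])
    have "biduality R B T (f x) = \<zero>\<^bsub>Hom_mod R ?P T\<^esub>"
    proof -
      have "\<psi> (f x) = \<zero>\<^bsub>T\<^esub>" if \<psi>: "\<psi> \<in> carrier ?P" for \<psi>
      proof -
        have "h (?F \<psi>) = \<zero>\<^bsub>T\<^esub>" using h(2) NW \<psi> by blast
        then show ?thesis using hx[OF lin_mapD(1)[OF F \<psi>]] x(1) by (simp add: dual_map_def)
      qed
      then show ?thesis by (auto simp: biduality_def Hom_mod_simps(2) fun_eq_iff)
    qed
    then have "f x = \<zero>\<^bsub>B\<^esub>"
      using lin_map_inj_zero[OF B Hom_module[OF P.module_axioms Tm] biduality_lin[OF B Tm] bB fx] by simp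
    then have "x = \<zero>\<^bsub>A\<^esub>" by (rule lin_map_inj_zero[OF A B f x(1)])
    then have "h \<phi> = \<zero>\<^bsub>T\<^esub>" using hx[OF \<phi>] lin_map_zero[OF A Tm Hom_modD[OF \<phi>]] by simp
    then show False using h(3) t(2) by simp
  qed
  then obtain \<psi> y where \<psi>: "\<phi> = ?F \<psi> \<oplus>\<^bsub>?M\<^esub> y" "\<psi> \<in> carrier ?P" "y \<in> ?Y"
    unfolding W_def by blast
  have c: "?F \<psi> \<in> carrier ?M" "y \<in> carrier ?M" using lin_mapD(1)[OF F \<psi>(2)] YD(1)[OF \<psi>(3)] .
  have "\<phi> \<ominus>\<^bsub>?M\<^esub> ?F \<psi> = y"
    unfolding \<psi>(1) using c by (simp add: a_minus_def M.a_comm[of "?F \<psi>" y] M.a_assoc M.r_neg)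
  then show ?thesis using \<psi>(2,3) by (intro bexI[of _ \<psi>]) simp
qed

text \<open>The correction terms lie in \<open>\<mm>^n Hom(B, T)\<close>, so at each element of \<open>B\<close> all but finitely many vanish
  and the partial sums stabilise.\<close>

lemma hom_extends_if_reflexive:
  assumes A: "module R A" and B: "artinian_module R B" and T: "artinian_module R T"
    and f: "lin_map R A B f" "inj_on f (carrier A)"
    and bA: "biduality R A T ` carrier A = carrier (Hom_mod R (Hom_mod R A T) T)"
    and bB: "inj_on (biduality R B T) (carrier B)"
    and k: "lin_map R A T k"
  shows "\<exists>q. lin_map R B T q \<and> (\<forall>x\<in>carrier A. q (f x) = k x)"
proof -
  let ?m = "max_ideal R"
  let ?M = "Hom_mod R A T" and ?P = "Hom_mod R B T" and ?F = "dual_map A f"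
  have Tm: "module R T" and Bm: "module R B" using B T by (simp_all add: artinian_module_def)
  interpret A: module R A by fact
  interpret B: module R B by (rule Bm)
  interpret T: module R T by (rule Tm)
  interpret M: module R ?M by (rule Hom_module[OF A Tm])
  interpret P: module R ?P by (rule Hom_module[OF Bm Tm])
  have mR: "?m \<subseteq> carrier R" using max_ideal_carrier by blast
  have F: "lin_map R ?P ?M ?F" by (rule dual_map_lin[OF A f(1)])
  note FD = lin_mapD[OF F]
  let ?IM = "ideal_pow_smult R ?M ?m" and ?IP = "ideal_pow_smult R ?P ?m"
  have sM: "submodule (?IM n) R ?M" and sP: "submodule (?IP n) R ?P" for n
    by (rule ideal_pow_smult_submodule[OF M.module_axioms mR] ideal_pow_smult_submodule[OF P.module_axioms mR])+
  note MD = submoduleD[OF M.module_axioms sM] and PD = submoduleD[OF P.module_axioms sP]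
  \<comment> \<open>Surjectivity modulo the maximal ideal passes to every layer: if
    \<open>\<nu>\<close> approximates \<open>\<chi>\<close>, then \<open>r \<nu>\<close>
    approximates \<open>r \<chi>\<close> one layer deeper, and such products generate. The
    correction is kept in \<open>?IP n\<close> so that it vanishes on
    \<open>ideal_torsion B ?m n\<close>.\<close>
  have step: "\<exists>\<nu>\<in>?IP n. \<phi> \<ominus>\<^bsub>?M\<^esub> ?F \<nu> \<in> ?IM (Suc n)" if "\<phi> \<in> ?IM n" for n \<phi>
    using that
  proof (induction n arbitrary: \<phi>)
    case 0
    then show ?case using dual_map_surj_mod_max_ideal[OF A Bm T f bA bB] by simp
  next
    case (Suc n)
    let ?H = "{a \<oplus>\<^bsub>?M\<^esub> b | a b. a \<in> ?F ` ?IP (Suc n) \<and> b \<in> ?IM (Suc (Suc n))}"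
    have "ideal_smult R ?M ?m (?IM n) \<subseteq> ?H"
    proof (rule ideal_smult_least)
      show "submodule ?H R ?M"
        by (rule M.submodule_sum[OF image_submodule[OF P.module_axioms M.module_axioms F sP] sM])
      fix r \<chi> assume r: "r \<in> ?m" and \<chi>: "\<chi> \<in> ?IM n"
      have rR: "r \<in> carrier R" using r mR by blast
      obtain \<nu> where \<nu>: "\<nu> \<in> ?IP n" "\<chi> \<ominus>\<^bsub>?M\<^esub> ?F \<nu> \<in> ?IM (Suc n)" using Suc.IH[OF \<chi>] by blast
      have c: "\<chi> \<in> carrier ?M" "?F \<nu> \<in> carrier ?M" "\<nu> \<in> carrier ?P"
        using MD(1)[OF \<chi>] FD(1) PD(1)[OF \<nu>(1)] by auto
      have "r \<odot>\<^bsub>?M\<^esub> (\<chi> \<ominus>\<^bsub>?M\<^esub> ?F \<nu>) \<in> ?IM (Suc (Suc n))" using ideal_smult_in[OF r \<nu>(2)] by simp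
      moreover have "r \<odot>\<^bsub>?P\<^esub> \<nu> \<in> ?IP (Suc n)" using ideal_smult_in[OF r \<nu>(1)] by simp
      moreover have "?F (r \<odot>\<^bsub>?P\<^esub> \<nu>) \<oplus>\<^bsub>?M\<^esub> r \<odot>\<^bsub>?M\<^esub> (\<chi> \<ominus>\<^bsub>?M\<^esub> ?F \<nu>) = r \<odot>\<^bsub>?M\<^esub> \<chi>"
      proof -
        have "?F (r \<odot>\<^bsub>?P\<^esub> \<nu>) \<oplus>\<^bsub>?M\<^esub> r \<odot>\<^bsub>?M\<^esub> (\<chi> \<ominus>\<^bsub>?M\<^esub> ?F \<nu>) = r \<odot>\<^bsub>?M\<^esub> ((\<chi> \<ominus>\<^bsub>?M\<^esub> ?F \<nu>) \<oplus>\<^bsub>?M\<^esub> ?F \<nu>)"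
          using c rR by (simp add: FD(3) M.smult_r_distr M.a_comm)
        also have "(\<chi> \<ominus>\<^bsub>?M\<^esub> ?F \<nu>) \<oplus>\<^bsub>?M\<^esub> ?F \<nu> = \<chi>" using c by (simp add: a_minus_def M.a_assoc M.l_neg)
        finally show ?thesis .
      qed
      ultimately show "r \<odot>\<^bsub>?M\<^esub> \<chi> \<in> ?H" by (metis (mono_tags, lifting) imageI mem_Collect_eq)
    qed
    then obtain \<nu> b where \<nu>: "\<phi> = ?F \<nu> \<oplus>\<^bsub>?M\<^esub> b" "\<nu> \<in> ?IP (Suc n)" "b \<in> ?IM (Suc (Suc n))"
      using Suc.prems by auto
    have c: "?F \<nu> \<in> carrier ?M" "b \<in> carrier ?M" using FD(1) PD(1)[OF \<nu>(2)] MD(1)[OF \<nu>(3)] by auto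
    have "\<phi> \<ominus>\<^bsub>?M\<^esub> ?F \<nu> = b"
      unfolding \<nu>(1) using c by (simp add: a_minus_def M.a_comm[of "?F \<nu>" b] M.a_assoc M.r_neg)
    then show ?case using \<nu> by blast
  qed
  let ?tB = "ideal_torsion B ?m"
  define \<phi> where "\<phi> = restrict k (carrier A)"
  have \<phi>: "\<phi> \<in> carrier ?M" unfolding \<phi>_def by (rule restrict_in_Hom[OF A k])
  let ?ok = "\<lambda>n s. s \<in> carrier ?P \<and> \<phi> \<ominus>\<^bsub>?M\<^esub> ?F s \<in> ?IM n"
  have "\<exists>s. \<forall>n. ?ok n (s n) \<and> (\<forall>x\<in>?tB n. s (Suc n) x = s n x)"
  proof (rule dependent_nat_choice)
    show "\<exists>s. ?ok 0 s" using \<phi> FD(1) by (intro exI[of _ "\<zero>\<^bsub>?P\<^esub>"]) simp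
  next
    fix s n assume s: "?ok n s"
    then obtain \<nu> where \<nu>: "\<nu> \<in> ?IP n" "(\<phi> \<ominus>\<^bsub>?M\<^esub> ?F s) \<ominus>\<^bsub>?M\<^esub> ?F \<nu> \<in> ?IM (Suc n)" using step by blast
    have c: "s \<in> carrier ?P" "\<nu> \<in> carrier ?P" "?F s \<in> carrier ?M" "?F \<nu> \<in> carrier ?M"
      using s PD(1)[OF \<nu>(1)] FD(1) by auto
    have "\<phi> \<ominus>\<^bsub>?M\<^esub> ?F (s \<oplus>\<^bsub>?P\<^esub> \<nu>) = (\<phi> \<ominus>\<^bsub>?M\<^esub> ?F s) \<ominus>\<^bsub>?M\<^esub> ?F \<nu>"
      using c \<phi> by (simp add: FD(2) a_minus_def M.minus_add M.a_assoc)
    then have "?ok (Suc n) (s \<oplus>\<^bsub>?P\<^esub> \<nu>)" using \<nu>(2) c by simp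
    moreover have "(s \<oplus>\<^bsub>?P\<^esub> \<nu>) x = s x" if x: "x \<in> ?tB n" for x
    proof -
      have xB: "x \<in> carrier B" using x ideal_torsion_carrier[OF Bm] by blast
      then show ?thesis
        using ideal_pow_smult_Hom_torsion[OF Bm Tm mR \<nu>(1) x] lin_mapD(1)[OF Hom_modD[OF c(1)] xB]
        by (simp add: Hom_mod_simps(3))
    qed
    ultimately show "\<exists>s'. ?ok (Suc n) s' \<and> (\<forall>x\<in>?tB n. s' x = s x)" by blast
  qed
  then obtain s where s: "\<And>n. s n \<in> carrier ?P" "\<And>n. \<phi> \<ominus>\<^bsub>?M\<^esub> ?F (s n) \<in> ?IM n"
    and s_Suc: "\<And>n x. x \<in> ?tB n \<Longrightarrow> s (Suc n) x = s n x" by blast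
  note sD = lin_mapD[OF Hom_modD[OF s(1)]]
  have mono: "x \<in> ?tB n \<Longrightarrow> n \<le> l \<Longrightarrow> x \<in> ?tB l" for x n l
    using ideal_torsion_mono[OF Bm mR] by blast
  have const: "s l x = s n x" if "x \<in> ?tB n" "n \<le> l" for x n l
    using that(2)
  proof (induction l rule: dec_induct)
    case (step l)
    then show ?case using s_Suc mono[OF that(1)] by simp
  qed simp
  define N where "N x = (SOME n. x \<in> ?tB n)" for x
  have N: "x \<in> ?tB (N x)" if "x \<in> carrier B" for x
    unfolding N_def using artinian_torsion[OF B that] by (rule someI_ex)
  define q where "q x = s (N x) x" for x
  have q: "q x = s l x" if "x \<in> carrier B" "x \<in> ?tB n" "n \<le> l" for x n l
  proof (cases "N x \<le> l")
    case True
    then show ?thesis unfolding q_def by (rule const[OF N[OF that(1)], symmetric])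
  next
    case False
    then have "n \<le> N x" using that(3) by simp
    then show ?thesis unfolding q_def using const[OF that(2)] that(3) by metis
  qed
  have "lin_map R B T q"
  proof (rule lin_mapI)
    fix x y assume x: "x \<in> carrier B" and y: "y \<in> carrier B"
    \<comment> \<open>At this index a single linear map \<open>s l\<close> computes all three values
      of \<open>q\<close>, so additivity is inherited from it.\<close>
    define l where "l = max (N x) (max (N y) (N (x \<oplus>\<^bsub>B\<^esub> y)))"
    have "q x = s l x" "q y = s l y" "q (x \<oplus>\<^bsub>B\<^esub> y) = s l (x \<oplus>\<^bsub>B\<^esub> y)"
      by (rule q[OF _ N]; simp add: x y l_def)+
    then show "q (x \<oplus>\<^bsub>B\<^esub> y) = q x \<oplus>\<^bsub>T\<^esub> q y" using sD(2) x y by simp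
  next
    fix r x assume r: "r \<in> carrier R" and x: "x \<in> carrier B"
    define l where "l = max (N x) (N (r \<odot>\<^bsub>B\<^esub> x))"
    have "q x = s l x" "q (r \<odot>\<^bsub>B\<^esub> x) = s l (r \<odot>\<^bsub>B\<^esub> x)"
      by (rule q[OF _ N]; simp add: r x l_def)+
    then show "q (r \<odot>\<^bsub>B\<^esub> x) = r \<odot>\<^bsub>T\<^esub> q x" using sD(3) r x by simp
  qed (simp add: q_def sD(1))
  moreover have "q (f x) = k x" if x: "x \<in> carrier A" for x
  proof -
    \<comment> \<open>At this index the error lies in \<open>?IM ?n\<close>, which vanishes on all
      elements of \<open>A\<close> of torsion order at most \<open>?n\<close>. Since
      \<open>f\<close> is injective, \<open>x\<close> is one of them, so the error is exactly zero
      at \<open>x\<close>.\<close>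
    let ?n = "N (f x)"
    have fx: "f x \<in> carrier B" by (rule lin_mapD(1)[OF f(1) x])
    have c: "\<phi> \<ominus>\<^bsub>?M\<^esub> ?F (s ?n) \<in> carrier ?M" "?F (s ?n) \<in> carrier ?M" using MD(1)[OF s(2)] FD(1)[OF s(1)] .
    have "\<phi> = (\<phi> \<ominus>\<^bsub>?M\<^esub> ?F (s ?n)) \<oplus>\<^bsub>?M\<^esub> ?F (s ?n)"
      using \<phi> c by (simp add: a_minus_def M.a_assoc M.l_neg)
    then have "\<phi> x = (\<phi> \<ominus>\<^bsub>?M\<^esub> ?F (s ?n)) x \<oplus>\<^bsub>T\<^esub> ?F (s ?n) x"
      using x by (metis (no_types, lifting) Hom_mod_simps(3) restrict_apply')
    moreover have "(\<phi> \<ominus>\<^bsub>?M\<^esub> ?F (s ?n)) x = \<zero>\<^bsub>T\<^esub>"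
      by (rule ideal_pow_smult_Hom_torsion[OF A Tm mR s(2) ideal_torsion_inj[OF A Bm f mR x N[OF fx]]])
    ultimately show ?thesis
      using x sD(1)[OF fx] by (simp add: \<phi>_def q_def dual_map_def)
  qed
  ultimately show ?thesis by blast
qed

end

section \<open>The three cases of the two-of-three condition\<close>

theorem theorem3:
  fixes R :: "('r, 'e) ring_scheme"
    and T :: "('r, 't, 'f) module_scheme"
    and L1 :: "('r, 'a, 'g) module_scheme"
    and L2 :: "('r, 'b, 'h) module_scheme"
    and L3 :: "('r, 'c, 'i) module_scheme"
    and f :: "'a \<Rightarrow> 'b" and g :: "'b \<Rightarrow> 'c"
  assumes "complete_noetherian_local_ring R"
    and "quasidualizing R T"
    and "module R L1" and "module R L2" and "module R L3"
    and "short_exact R L1 f L2 g L3"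
  shows "(L1 \<in> G_artin R T \<and> L2 \<in> G_artin R T \<longrightarrow> L3 \<in> G_artin R T) \<and>
         (L1 \<in> G_artin R T \<and> L3 \<in> G_artin R T \<longrightarrow> L2 \<in> G_artin R T) \<and>
         (L2 \<in> G_artin R T \<and> L3 \<in> G_artin R T \<longrightarrow> L1 \<in> G_artin R T)"
proof -
  interpret noetherian_local_ring R
    using assms(1) by (simp add: complete_noetherian_local_ring_def)
  have T: "artinian_module R T" using assms(2) by (simp add: quasidualizing_def)
  then have Tm: "module R T" by (simp add: artinian_module_def)
  note m = assms(3-5) and ses = assms(6)
  note f = short_exactD(1)[OF ses] and g = short_exactD(2)[OF ses]
  let ?D1 = "Hom_mod R L1 T" and ?D2 = "Hom_mod R L2 T" and ?D3 = "Hom_mod R L3 T"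
  let ?b1 = "biduality R L1 T" and ?b2 = "biduality R L2 T" and ?b3 = "biduality R L3 T"
  have mD: "module R ?D1" "module R ?D2" "module R ?D3"
    by (rule Hom_module[OF m(1) Tm] Hom_module[OF m(2) Tm] Hom_module[OF m(3) Tm])+
  \<comment> \<open>Linearity of the biduality map holds for every module, so its being an
    isomorphism comes down to bijectivity; degrees \<open>i > 0\<close> are rewritten as
    \<open>Suc n\<close> to match the Ext lemmas.\<close>
  have G: "L \<in> G_artin R T \<longleftrightarrow> artinian_module R L \<and>
      bij_betw (biduality R L T) (carrier L) (carrier (Hom_mod R (Hom_mod R L T) T)) \<and>
      (\<forall>n. zero_mod (Ext_mod R (Suc n) L T)) \<and> (\<forall>n. zero_mod (Ext_mod R (Suc n) (Hom_mod R L T) T))"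
    if "module R L" for L :: "('r, 'x, 'y) module_scheme"
    using that biduality_lin[OF that Tm] gr0_conv_Suc
    by (auto simp: G_artin_def derived_reflexive_def lin_iso_def)
  let ?extends = "\<forall>k. lin_map R L1 T k \<longrightarrow> (\<exists>q. lin_map R L2 T q \<and> (\<forall>x\<in>carrier L1. q (f x) = k x))"
  let ?dual_extends = "\<forall>k. lin_map R ?D3 T k \<longrightarrow> (\<exists>q. lin_map R ?D2 T q \<and> (\<forall>x\<in>carrier ?D3. q (dual_map L2 g x) = k x))"
  have dual: "short_exact R ?D3 (dual_map L2 g) ?D2 (dual_map L1 f) ?D1" if ?extends
    using that by (intro dual_short_exact[OF m Tm ses]) blast
  \<comment> \<open>Each of the two conditions gives right exactness for one of the two
    dualisations.\<close>
  have bidual: "ses_morphism R L1 f L2 g L3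
      (Hom_mod R ?D1 T) (dual_map ?D2 (dual_map L1 f)) (Hom_mod R ?D2 T)
      (dual_map ?D3 (dual_map L2 g)) (Hom_mod R ?D3 T) ?b1 ?b2 ?b3" if ?extends ?dual_extends
  proof (rule ses_morphism.intro)
    show "short_exact R (Hom_mod R ?D1 T) (dual_map ?D2 (dual_map L1 f)) (Hom_mod R ?D2 T)
        (dual_map ?D3 (dual_map L2 g)) (Hom_mod R ?D3 T)"
      using that by (intro dual_short_exact[OF mD(3,2,1) Tm dual]) blast+
  qed (intro m Hom_module[OF _ Tm] mD ses biduality_lin[OF _ Tm]
      biduality_natural[OF m(1) f] biduality_natural[OF m(2) g] | assumption)+
  have extends: "?extends" if "zero_mod (Ext_mod R (Suc 0) L3 T)"
    using Ext_zero_hom_extends[OF m Tm ses that] by blast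
  have dual_extends: "?dual_extends" if "?extends" "zero_mod (Ext_mod R (Suc 0) ?D1 T)"
    using Ext_zero_hom_extends[OF mD(3,2,1) Tm dual[OF that(1)] that(2)] by blast
  show ?thesis
    unfolding G[OF m(1)] G[OF m(2)] G[OF m(3)]
  proof (intro conjI impI; elim conjE)
    assume L1: "artinian_module R L1" "bij_betw ?b1 (carrier L1) (carrier (Hom_mod R ?D1 T))"
      "\<forall>n. zero_mod (Ext_mod R (Suc n) L1 T)" "\<forall>n. zero_mod (Ext_mod R (Suc n) ?D1 T)"
      and L2: "artinian_module R L2" "bij_betw ?b2 (carrier L2) (carrier (Hom_mod R ?D2 T))"
      "\<forall>n. zero_mod (Ext_mod R (Suc n) L2 T)" "\<forall>n. zero_mod (Ext_mod R (Suc n) ?D2 T)"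
    have e: ?extends
      using hom_extends_if_reflexive[OF m(1) L2(1) T f short_exactD(3)[OF ses]
          bij_betw_imp_surj_on[OF L1(2)] bij_betw_imp_inj_on[OF L2(2)]] by blast
    interpret ses_morphism R L1 f L2 g L3 "Hom_mod R ?D1 T" "dual_map ?D2 (dual_map L1 f)" "Hom_mod R ?D2 T"
      "dual_map ?D3 (dual_map L2 g)" "Hom_mod R ?D3 T" ?b1 ?b2 ?b3
      using bidual[OF e dual_extends[OF e]] L1(4) by blast
    show "artinian_module R L3" by (rule artinian_quotient[OF L2(1) m(3) g short_exactD(4)[OF ses]])
    show "bij_betw ?b3 (carrier L3) (carrier (Hom_mod R ?D3 T))" by (rule short_five_right[OF L1(2) L2(2)])
    show "\<forall>n. zero_mod (Ext_mod R (Suc n) L3 T)"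
    proof
      fix n
      \<comment> \<open>Degree one has no vanishing Ext of \<open>L1\<close> one degree lower to
        fall back on, so \<open>e\<close> takes its place; the higher degrees come from
        \<open>Ext_zero_right\<close>.\<close>
      show "zero_mod (Ext_mod R (Suc n) L3 T)"
        using hom_extends_Ext_zero[OF m Tm ses] e Ext_zero_right[OF m Tm ses] L1(3) L2(3) by (cases n) blast+
    qed
    \<comment> \<open>Dualising reverses the sequence, so \<open>?D3\<close> is now on the left and
      \<open>?D1\<close> on the right.\<close>
    show "\<forall>n. zero_mod (Ext_mod R (Suc n) ?D3 T)"
      using Ext_zero_left[OF mD(3,2,1) Tm dual[OF e]] L1(4) L2(4) by blast
  next
    assume L1: "artinian_module R L1" "bij_betw ?b1 (carrier L1) (carrier (Hom_mod R ?D1 T))"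
      "\<forall>n. zero_mod (Ext_mod R (Suc n) L1 T)" "\<forall>n. zero_mod (Ext_mod R (Suc n) ?D1 T)"
      and L3: "artinian_module R L3" "bij_betw ?b3 (carrier L3) (carrier (Hom_mod R ?D3 T))"
      "\<forall>n. zero_mod (Ext_mod R (Suc n) L3 T)" "\<forall>n. zero_mod (Ext_mod R (Suc n) ?D3 T)"
    have e: ?extends using extends L3(3) by blast
    interpret ses_morphism R L1 f L2 g L3 "Hom_mod R ?D1 T" "dual_map ?D2 (dual_map L1 f)" "Hom_mod R ?D2 T"
      "dual_map ?D3 (dual_map L2 g)" "Hom_mod R ?D3 T" ?b1 ?b2 ?b3
      using bidual[OF e dual_extends[OF e]] L1(4) by blast
    show "artinian_module R L2" by (rule artinian_extension[OF L1(1) L3(1) m(2) ses])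
    show "bij_betw ?b2 (carrier L2) (carrier (Hom_mod R ?D2 T))" by (rule short_five_middle[OF L1(2) L3(2)])
    show "\<forall>n. zero_mod (Ext_mod R (Suc n) L2 T)"
      using Ext_zero_middle[OF m Tm ses] L1(3) L3(3) by blast
    show "\<forall>n. zero_mod (Ext_mod R (Suc n) ?D2 T)"
      using Ext_zero_middle[OF mD(3,2,1) Tm dual[OF e]] L1(4) L3(4) by blast
  next
    assume L2: "artinian_module R L2" "bij_betw ?b2 (carrier L2) (carrier (Hom_mod R ?D2 T))"
      "\<forall>n. zero_mod (Ext_mod R (Suc n) L2 T)" "\<forall>n. zero_mod (Ext_mod R (Suc n) ?D2 T)"
      and L3: "artinian_module R L3" "bij_betw ?b3 (carrier L3) (carrier (Hom_mod R ?D3 T))"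
      "\<forall>n. zero_mod (Ext_mod R (Suc n) L3 T)" "\<forall>n. zero_mod (Ext_mod R (Suc n) ?D3 T)"
    have e: ?extends using extends L3(3) by blast
    \<comment> \<open>The vanishing of \<open>Ext^1(?D1, T)\<close> is still to be shown here, so
      \<open>dual_extends\<close> does not apply. By biduality for \<open>L3\<close> a functional on
      \<open>?D3\<close> is evaluation at some \<open>z = g y\<close>, and evaluation at
      \<open>y\<close> extends it to \<open>?D2\<close>.\<close>
    have e': ?dual_extends
    proof (intro allI impI)
      fix k assume k: "lin_map R ?D3 T k"
      have "restrict k (carrier ?D3) \<in> ?b3 ` carrier L3"
        unfolding bij_betw_imp_surj_on[OF L3(2)] by (rule restrict_in_Hom[OF mD(3) k])
      then obtain z where z: "z \<in> carrier L3" "restrict k (carrier ?D3) = ?b3 z" by blast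
      then obtain y where y: "y \<in> carrier L2" "z = g y" using short_exactD(4)[OF ses] by blast
      have "lin_map R ?D2 T (?b2 y)"
        using Hom_modD[OF lin_mapD(1)[OF biduality_lin[OF m(2) Tm] y(1)]] .
      moreover have "?b2 y (dual_map L2 g \<chi>) = k \<chi>" if \<chi>: "\<chi> \<in> carrier ?D3" for \<chi>
        using fun_cong[OF z(2), of \<chi>] \<chi> y lin_mapD(1)[OF dual_map_lin[OF m(2) g] \<chi>]
        by (simp add: biduality_def) (simp add: dual_map_def)
      ultimately show "\<exists>q. lin_map R ?D2 T q \<and> (\<forall>\<chi>\<in>carrier ?D3. q (dual_map L2 g \<chi>) = k \<chi>)" by blast
    qed
    interpret ses_morphism R L1 f L2 g L3 "Hom_mod R ?D1 T" "dual_map ?D2 (dual_map L1 f)" "Hom_mod R ?D2 T"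
      "dual_map ?D3 (dual_map L2 g)" "Hom_mod R ?D3 T" ?b1 ?b2 ?b3
      by (rule bidual[OF e e'])
    show "artinian_module R L1" by (rule artinian_submodule[OF L2(1) m(1) f short_exactD(3)[OF ses]])
    show "bij_betw ?b1 (carrier L1) (carrier (Hom_mod R ?D1 T))" by (rule short_five_left[OF L2(2) L3(2)])
    show "\<forall>n. zero_mod (Ext_mod R (Suc n) L1 T)"
      using Ext_zero_left[OF m Tm ses] L2(3) L3(3) by blast
    show "\<forall>n. zero_mod (Ext_mod R (Suc n) ?D1 T)"
    proof
      fix n
      \<comment> \<open>With \<open>?D1\<close> on the right of the dual sequence, degree one
        follows from \<open>e'\<close>, which was obtained independently of it.\<close>
      show "zero_mod (Ext_mod R (Suc n) ?D1 T)"
        using hom_extends_Ext_zero[OF mD(3,2,1) Tm dual[OF e]] e' Ext_zero_right[OF mD(3,2,1) Tm dual[OF e]]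
          L2(4) L3(4) by (cases n) blast+
    qed
  qed
qed

end
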